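(* If $T$ is an $\Omega$-bounded, reproductive bi-ordered tree such that $S_0$ (the LOTS of immediate successors of the root $0$) is a HLOTS, then the branch space $X(T)$, with its induced order, is a HLOTS.
   Context: A LOTS is a totally ordered set with the order topology. A HLOTS is a LOTS with at least three points which is order isomorphic to every nonempty open convex subset of itself. $\Omega$ denotes the first uncountable ordinal. A tree is a nonempty partially ordered set $(T,\prec)$ such that for each $p\in T$ the predecessor set $A_p=\{q:q\prec p\}$ is well-ordered; $o(p)$ is the ordinal with the order type of $A_p$; $T_p=\{q\in T: q=p \text{ or } p\prec q\}$; $S_p=\{q\in T_p: o(q)=o(p)+1\}$ is the set of immediate successors. The height of $A\subset T$ is $h(A)=\min\{\alpha: o(p)<\alpha \text{ for all }p\in A\}$. All trees are assumed semi-normal: (i) there is a unique element $0$ (the root) with $o(0)=0$; (ii) $S_p$ never has exactly one element; (iii) if $o(p)=o(q)$ is a limit ordinal and $A_p=A_q$ then $p=q$. A bi-ordered tree is a tree of height greater than $1$ with a linear order on each nonempty $S_p$. A branch is a maximal linearly ordered subset $x$ of $T$; $X(T)$ is the set of branches; $x_i$ is the element of $x$ of order $i$ (for $i<h(x)$). The induced order on $X(T)$: for distinct branches, $x<y$ iff for some ordinal $\epsilon$, $x_\epsilon=y_\epsilon$ and $x_{\epsilon+1}<y_{\epsilon+1}$ in the linear order of $S_{x_\epsilon}$. This makes $X(T)$ a LOTS. $T$ is $\Omega$-bounded if $h(x)<\Omega$ for every branch $x$. An isomorphism of bi-ordered trees is a bijection preserving (in both directions) $\prec$ and the linear orders on successor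 sets. Each $T_p$ is a tree with root $p$ with the inherited orders. $T$ is reproductive if for every $p\in T$, $T_p$ is isomorphic to $T$. *)

theory Defs
  imports "HOL-Analysis.Abstract_Topology" "HOL-Library.Countable_Set_Type"
begin

unbundle cardinal_syntax

text \<open>
  A poset is a carrier \<open>A\<close> with a reflexive order relation \<open>r \<subseteq> A \<times> A\<close>. Ordinals are represented by
  well-orders, up to \<open>=o\<close>; comparisons \<open><o\<close>, \<open>\<le>o\<close>, \<open>=o\<close> may relate well-orders on different types.
\<close>

subsection \<open>Linearly ordered topological spaces\<close>

definition lots_topology :: "'a set \<Rightarrow> 'a rel \<Rightarrow> 'a topology" where
  "lots_topology A r = topology_generated_by (insert A (underS r ` A \<union> aboveS r ` A))"

definition order_convex :: "'a set \<Rightarrow> 'a rel \<Rightarrow> 'a set \<Rightarrow> bool" where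
  "order_convex A r C \<longleftrightarrow>
     C \<subseteq> A \<and> (\<forall>x\<in>C. \<forall>z\<in>C. \<forall>y\<in>A. (x, y) \<in> r \<and> (y, z) \<in> r \<longrightarrow> y \<in> C)"

text \<open>
  \<^const>\<open>iso\<close> is meant here for arbitrary relations: by \<open>iso_iff2\<close> it is a bijection of the fields
  that preserves and reflects the relations.
\<close>

definition HLOTS :: "'a set \<Rightarrow> 'a rel \<Rightarrow> bool" where
  "HLOTS A r \<longleftrightarrow>
     linear_order_on A r \<and>
     (\<exists>x\<in>A. \<exists>y\<in>A. \<exists>z\<in>A. x \<noteq> y \<and> y \<noteq> z \<and> x \<noteq> z) \<and>
     (\<forall>C. C \<noteq> {} \<and> openin (lots_topology A r) C \<and> order_convex A r C \<longrightarrow>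
          (\<exists>f. iso r (Restr r C) f))"

subsection \<open>Ordinals\<close>

text \<open>\<open>\<alpha> + 1\<close>: a new greatest element \<^const>\<open>None\<close> is put on top of \<open>\<alpha>\<close>.\<close>

definition ord_suc :: "'a rel \<Rightarrow> 'a option rel" where
  "ord_suc \<alpha> = {(Some x, Some y) | x y. (x, y) \<in> \<alpha>} \<union> {(x, None) | x. x \<in> insert None (Some ` Field \<alpha>)}"

definition limit_ord :: "'a rel \<Rightarrow> bool" where
  "limit_ord \<alpha> \<longleftrightarrow> Well_order \<alpha> \<and> \<alpha> \<noteq> {} \<and> \<not> (\<exists>\<beta> :: 'a rel. \<alpha> =o ord_suc \<beta>)"

definition Omega :: "nat set rel" where
  "Omega = cardSuc natLeq"

lemma ordLess_Omega_iff: "Well_order \<alpha> \<Longrightarrow> \<alpha> <o Omega \<longleftrightarrow> countable (Field \<alpha>)"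
proof -
  assume w: "Well_order \<alpha>"
  have cO: "Card_order Omega" unfolding Omega_def by (rule cardSuc_Card_order[OF natLeq_Card_order])
  then have wO: "Well_order Omega" using card_order_on_well_order_on by blast
  have iso: "Omega =o |Field Omega|" using cO card_of_Field_ordIso ordIso_symmetric by blast
  have "Omega \<le>o \<alpha> \<longleftrightarrow> Omega \<le>o |Field \<alpha>|"
    using iso card_of_mono2 card_of_least[OF w] ordIso_ordLeq_trans ordLeq_transitive by blast
  then have "\<alpha> <o Omega \<longleftrightarrow> |Field \<alpha>| <o Omega"
    using not_ordLeq_iff_ordLess[OF w wO] not_ordLeq_iff_ordLess[OF card_of_Well_order wO] by blast
  also have "\<dots> \<longleftrightarrow> |Field \<alpha>| \<le>o natLeq"
    unfolding Omega_def by (rule cardSuc_ordLeq_ordLess[OF natLeq_Card_order card_of_Card_order])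
  finally show ?thesis by (simp add: countable_card_le_natLeq)
qed

subsection \<open>Trees\<close>

definition node_ord :: "'a rel \<Rightarrow> 'a \<Rightarrow> 'a rel" where
  "node_ord r p = Restr r (underS r p)"

definition tree :: "'a set \<Rightarrow> 'a rel \<Rightarrow> bool" where
  "tree T r \<longleftrightarrow>
     T \<noteq> {} \<and> partial_order_on T r \<and> (\<forall>p\<in>T. well_order_on (underS r p) (node_ord r p))"

text \<open>The sets \<open>T\<^sub>p\<close> are rendered by \<^term>\<open>above r p\<close>.\<close>

definition imm_succ :: "'a rel \<Rightarrow> 'a \<Rightarrow> 'a set" where
  "imm_succ r p = {q \<in> above r p. node_ord r q =o ord_suc (node_ord r p)}"

text \<open>
  The least ordinal above all \<open>o(p)\<close>, \<open>p \<in> A\<close>. It is taken among the well-orders on \<^typ>\<open>'a set\<close>,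
  which is large enough to carry a strict upper bound.
\<close>

definition is_height :: "'a rel \<Rightarrow> 'a set \<Rightarrow> 'a set rel \<Rightarrow> bool" where
  "is_height r A \<alpha> \<longleftrightarrow>
     Well_order \<alpha> \<and> (\<forall>p\<in>A. node_ord r p <o \<alpha>) \<and>
     (\<forall>\<beta> :: 'a set rel. Well_order \<beta> \<and> (\<forall>p\<in>A. node_ord r p <o \<beta>) \<longrightarrow> \<alpha> \<le>o \<beta>)"

definition height :: "'a rel \<Rightarrow> 'a set \<Rightarrow> 'a set rel" where
  "height r A = (SOME \<alpha>. is_height r A \<alpha>)"

lemma is_height_height:
  assumes "tree T r" "A \<subseteq> T"
  shows "is_height r A (height r A)"
proof -
  let ?B = "{\<beta> :: 'a set rel. Well_order \<beta> \<and> (\<forall>p\<in>A. node_ord r p <o \<beta>)}"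
  let ?b = "cardSuc |UNIV :: 'a set|"
  have co: "Card_order |UNIV :: 'a set|" by (rule card_of_Card_order)
  have wb: "Well_order ?b" using cardSuc_Card_order[OF co] card_order_on_well_order_on by blast
  have "node_ord r p <o ?b" if "p \<in> A" for p
  proof (rule ccontr)
    have w: "Well_order (node_ord r p)"
      using that assms well_order_on_Well_order unfolding tree_def by blast
    assume "\<not> node_ord r p <o ?b"
    then have "?b \<le>o node_ord r p" using not_ordLess_iff_ordLeq[OF wb w] by simp
    then have "|Field ?b| \<le>o |Field (node_ord r p)|" by (rule card_of_mono2)
    moreover have "|Field (node_ord r p)| \<le>o |UNIV :: 'a set|" by (simp add: card_of_mono1)
    moreover have "?b =o |Field ?b|"
      using cardSuc_Card_order[OF co] card_of_Field_ordIso ordIso_symmetric by blast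
    ultimately have "?b \<le>o |UNIV :: 'a set|"
      using ordIso_ordLeq_trans ordLeq_transitive by blast
    then show False using cardSuc_greater[OF co] not_ordLess_ordLeq by blast
  qed
  then have "?b \<in> ?B" using wb by blast
  then obtain \<alpha> where "\<alpha> \<in> ?B" "\<forall>\<beta>\<in>?B. \<alpha> \<le>o \<beta>"
    using exists_minim_Well_order[of ?B] by blast
  then have "is_height r A \<alpha>" unfolding is_height_def by blast
  then show ?thesis unfolding height_def by (rule someI)
qed

definition tree_root :: "'a set \<Rightarrow> 'a rel \<Rightarrow> 'a" where
  "tree_root T r = (THE p. p \<in> T \<and> node_ord r p =o ({} :: 'a rel))"

definition semi_normal :: "'a set \<Rightarrow> 'a rel \<Rightarrow> bool" where
  "semi_normal T r \<longleftrightarrow>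
     (\<exists>!p. p \<in> T \<and> node_ord r p =o ({} :: 'a rel)) \<and>
     (\<forall>p\<in>T. \<not> is_singleton (imm_succ r p)) \<and>
     (\<forall>p\<in>T. \<forall>q\<in>T. node_ord r p =o node_ord r q \<and> limit_ord (node_ord r p) \<and>
        underS r p = underS r q \<longrightarrow> p = q)"

text \<open>\<open>s p\<close> is the order on the successors of \<open>p\<close>; it is irrelevant where \<open>p\<close> has no successors.\<close>

definition bi_ordered_tree :: "'a set \<Rightarrow> 'a rel \<Rightarrow> ('a \<Rightarrow> 'a rel) \<Rightarrow> bool" where
  "bi_ordered_tree T r s \<longleftrightarrow>
     tree T r \<and> semi_normal T r \<and> ord_suc ({} :: unit rel) <o height r T \<and>
     (\<forall>p\<in>T. imm_succ r p \<noteq> {} \<longrightarrow> linear_order_on (imm_succ r p) (s p))"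

definition bi_tree_iso ::
    "'a rel \<Rightarrow> ('a \<Rightarrow> 'a rel) \<Rightarrow> 'b rel \<Rightarrow> ('b \<Rightarrow> 'b rel) \<Rightarrow> ('a \<Rightarrow> 'b) \<Rightarrow> bool" where
  "bi_tree_iso r s r' s' f \<longleftrightarrow>
     iso r r' f \<and>
     (\<forall>p\<in>Field r. \<forall>a\<in>imm_succ r p. \<forall>b\<in>imm_succ r p. (a, b) \<in> s p \<longleftrightarrow> (f a, f b) \<in> s' (f p))"

definition reproductive :: "'a set \<Rightarrow> 'a rel \<Rightarrow> ('a \<Rightarrow> 'a rel) \<Rightarrow> bool" where
  "reproductive T r s \<longleftrightarrow> (\<forall>p\<in>T. \<exists>f. bi_tree_iso (Restr r (above r p)) s r s f)"

subsection \<open>The branch space\<close>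

definition branches :: "'a rel \<Rightarrow> 'a set set" where
  "branches r = {x \<in> Chains r. \<forall>y\<in>Chains r. x \<subseteq> y \<longrightarrow> y = x}"

text \<open>\<open>branch_nth r x \<alpha> q\<close> says that \<open>x\<^sub>\<alpha>\<close> is defined and equal to \<open>q\<close>.\<close>

definition branch_nth :: "'a rel \<Rightarrow> 'a set \<Rightarrow> 'b rel \<Rightarrow> 'a \<Rightarrow> bool" where
  "branch_nth r x \<alpha> q \<longleftrightarrow> q \<in> x \<and> node_ord r q =o \<alpha>"

definition branch_less :: "'a rel \<Rightarrow> ('a \<Rightarrow> 'a rel) \<Rightarrow> 'a set \<Rightarrow> 'a set \<Rightarrow> bool" where
  "branch_less r s x y \<longleftrightarrow>
     (\<exists>\<epsilon> :: 'a rel. \<exists>p a b.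
        branch_nth r x \<epsilon> p \<and> branch_nth r y \<epsilon> p \<and>
        branch_nth r x (ord_suc \<epsilon>) a \<and> branch_nth r y (ord_suc \<epsilon>) b \<and>
        a \<noteq> b \<and> (a, b) \<in> s p)"

definition branch_order :: "'a rel \<Rightarrow> ('a \<Rightarrow> 'a rel) \<Rightarrow> 'a set rel" where
  "branch_order r s =
     {(x, y). x \<in> branches r \<and> y \<in> branches r \<and> (x = y \<or> branch_less r s x y)}"

definition Omega_bounded :: "'a rel \<Rightarrow> bool" where
  "Omega_bounded r \<longleftrightarrow> (\<forall>x\<in>branches r. height r x <o Omega)"

end

theory Submission
  imports Defs
begin

text \<open>
  Call a set of branches a copy if it is isomorphic to \<open>X(T)\<close>. Reproductivity makes every cone
  \<open>X(T\<^sub>p)\<close> a copy, and homogeneity of \<open>S\<^sub>p\<close> makes the union of the cones over an open convex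
  set of successors of \<open>p\<close> a copy. Every HLOTS has a cofinal sequence, because an increasing union
  of initial segments is again isomorphic to the whole; cutting along such a sequence in \<open>S\<^sub>0\<close>
  shows that copies are closed under sums of order type \<open>2\<close>, \<open>\<omega>\<close> and \<open>\<omega>\<^sup>*\<close>.
  For branches \<open>z < w\<close> splitting at \<open>p\<close>, the interval \<open>(z, w)\<close> consists of cones branching off
  \<open>z\<close>, cones over an interval of \<open>S\<^sub>p\<close>, and cones branching off \<open>w\<close>; since branches are countable,
  well-founded induction along \<open>z\<close> and \<open>w\<close> shows that it is a copy.
  Countability of the branches and of the cofinality of each \<open>S\<^sub>p\<close> also gives every convex set
  without maximum a cofinal sequence, so an open convex set and \<open>X(T)\<close> are both sums, of order type
  \<open>\<omega>\<^sup>* + \<omega>\<close>, of mutually isomorphic half-open intervals.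
\<close>

subsection \<open>Order isomorphisms and homogeneous orders\<close>

text \<open>The obstacle is cofinality. Branches beside \<open>z\<close> may leave \<open>z\<close>
  at any level, so those on one side of \<open>z\<close> form a sum indexed by the levels of
  \<open>z\<close>, whereas sums of copies are controlled only in the types \<open>2\<close>,
  \<open>\<omega>\<close> and \<open>\<omega>\<^sup>*\<close>. Countable cofinality of every limit
  level bridges the gap: departures between consecutive terms of a cofinal sequence of nodes form an
  \<open>\<omega>\<^sup>*\<close>-sum, because leaving later means lying nearer to \<open>z\<close>.
  A convex set may end in a gap of \<open>X\<close>. The gap is located by the nodes whose cones
  meet both the set and its strict upper bounds; they form a chain and are therefore countably many.
  The points at which a set is cut cannot be dropped. Attached to the open interval on their left,
  which is a copy, they give pieces that are all isomorphic, whatever the set and the cutting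
  sequence. Successors, splitting and limit levels are expressed by the tree order alone, so that
  ordinals occur only where the given notions are translated.\<close>

definition ord_isomorphic :: "('a \<Rightarrow> 'a \<Rightarrow> bool) \<Rightarrow> 'a set \<Rightarrow> ('b \<Rightarrow> 'b \<Rightarrow> bool) \<Rightarrow> 'b set \<Rightarrow> bool" where
  "ord_isomorphic lt A lt' B \<longleftrightarrow>
     (\<exists>f. bij_betw f A B \<and> (\<forall>x\<in>A. \<forall>y\<in>A. lt x y \<longleftrightarrow> lt' (f x) (f y)))"

definition set_less :: "('a \<Rightarrow> 'a \<Rightarrow> bool) \<Rightarrow> 'a set \<Rightarrow> 'a set \<Rightarrow> bool" where
  "set_less lt A B \<longleftrightarrow> (\<forall>x\<in>A. \<forall>y\<in>B. lt x y)"

lemma ord_isomorphic_refl: "ord_isomorphic lt A lt A"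
  unfolding ord_isomorphic_def by (rule exI[of _ id]) auto

lemma ord_isomorphic_sym:
  assumes "ord_isomorphic lt A lt' B" shows "ord_isomorphic lt' B lt A"
proof -
  obtain f where f: "bij_betw f A B" "\<forall>x\<in>A. \<forall>y\<in>A. lt x y \<longleftrightarrow> lt' (f x) (f y)"
    using assms unfolding ord_isomorphic_def by blast
  let ?g = "inv_into A f"
  have g: "bij_betw ?g B A" using f(1) by (rule bij_betw_inv_into)
  have "lt' x y \<longleftrightarrow> lt (?g x) (?g y)" if "x \<in> B" "y \<in> B" for x y
  proof -
    have "?g x \<in> A" "?g y \<in> A" using g that bij_betwE by blast+
    moreover have "f (?g x) = x" "f (?g y) = y" using f(1) that by (simp_all add: bij_betw_inv_into_right)
    ultimately show ?thesis using f(2) by metis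
  qed
  with g show ?thesis unfolding ord_isomorphic_def by blast
qed

lemma ord_isomorphic_trans:
  assumes "ord_isomorphic lt A lt' B" "ord_isomorphic lt' B lt'' C"
  shows "ord_isomorphic lt A lt'' C"
proof -
  obtain f where f: "bij_betw f A B" "\<forall>x\<in>A. \<forall>y\<in>A. lt x y \<longleftrightarrow> lt' (f x) (f y)"
    using assms unfolding ord_isomorphic_def by blast
  obtain g where g: "bij_betw g B C" "\<forall>x\<in>B. \<forall>y\<in>B. lt' x y \<longleftrightarrow> lt'' (g x) (g y)"
    using assms unfolding ord_isomorphic_def by blast
  have "bij_betw (g \<circ> f) A C" using f g bij_betw_trans by blast
  moreover have "\<forall>x\<in>A. \<forall>y\<in>A. lt x y \<longleftrightarrow> lt'' ((g \<circ> f) x) ((g \<circ> f) y)"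
    using f g by (auto dest: bij_betwE)
  ultimately show ?thesis unfolding ord_isomorphic_def by blast
qed

text \<open>Orders are strict predicates on an explicit carrier, so that reversing one is only a
  swap of arguments. With this lemma and its companions, statements about one end of an order are
  reused for the other.\<close>

lemma ord_isomorphic_reverse:
  "ord_isomorphic (\<lambda>x y. lt y x) A (\<lambda>x y. lt' y x) B \<longleftrightarrow> ord_isomorphic lt A lt' B"
  unfolding ord_isomorphic_def by blast

lemma ord_isomorphic_singleton:
  assumes "\<not> lt x x" "\<not> lt' y y" shows "ord_isomorphic lt {x} lt' {y}"
  unfolding ord_isomorphic_def by (rule exI[of _ "\<lambda>_. y"]) (use assms in \<open>auto simp: bij_betw_def\<close>)

lemma set_less_reverse: "set_less (\<lambda>x y. lt y x) A B \<longleftrightarrow> set_less lt B A"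
  unfolding set_less_def by blast

lemma set_less_mono: "set_less lt A B \<Longrightarrow> A' \<subseteq> A \<Longrightarrow> B' \<subseteq> B \<Longrightarrow> set_less lt A' B'"
  unfolding set_less_def by blast

lemma set_less_Un_right: "set_less lt A B \<Longrightarrow> set_less lt A C \<Longrightarrow> set_less lt A (B \<union> C)"
  unfolding set_less_def by blast

text \<open>Isomorphisms of the summands are glued. Points of different summands compare as their
  indices do, on both sides, so beyond this only asymmetry of \<open>lt\<close> and
  \<open>lt'\<close> has to be known; summands may be empty.\<close>

lemma ord_isomorphic_UN:
  fixes k :: "'i \<Rightarrow> 'i \<Rightarrow> bool"
  assumes total: "\<And>i j. i \<in> I \<Longrightarrow> j \<in> I \<Longrightarrow> i \<noteq> j \<Longrightarrow> k i j \<or> k j i"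
    and A: "\<And>i j. i \<in> I \<Longrightarrow> j \<in> I \<Longrightarrow> i \<noteq> j \<Longrightarrow> k i j \<Longrightarrow> set_less lt (A i) (A j)"
    and B: "\<And>i j. i \<in> I \<Longrightarrow> j \<in> I \<Longrightarrow> i \<noteq> j \<Longrightarrow> k i j \<Longrightarrow> set_less lt' (B i) (B j)"
    and asymA: "\<And>x y. x \<in> (\<Union>i\<in>I. A i) \<Longrightarrow> y \<in> (\<Union>i\<in>I. A i) \<Longrightarrow> lt x y \<Longrightarrow> \<not> lt y x"
    and asymB: "\<And>x y. x \<in> (\<Union>i\<in>I. B i) \<Longrightarrow> y \<in> (\<Union>i\<in>I. B i) \<Longrightarrow> lt' x y \<Longrightarrow> \<not> lt' y x"
    and iso: "\<And>i. i \<in> I \<Longrightarrow> ord_isomorphic lt (A i) lt' (B i)"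
  shows "ord_isomorphic lt (\<Union>i\<in>I. A i) lt' (\<Union>i\<in>I. B i)"
proof -
  have "\<forall>i\<in>I. \<exists>f. bij_betw f (A i) (B i) \<and> (\<forall>x\<in>A i. \<forall>y\<in>A i. lt x y \<longleftrightarrow> lt' (f x) (f y))"
    using iso unfolding ord_isomorphic_def by blast
  then obtain f where f: "\<And>i. i \<in> I \<Longrightarrow> bij_betw (f i) (A i) (B i)"
      "\<And>i x y. i \<in> I \<Longrightarrow> x \<in> A i \<Longrightarrow> y \<in> A i \<Longrightarrow> lt x y \<longleftrightarrow> lt' (f i x) (f i y)"
    by metis
  \<comment> \<open>The index is unambiguous by \<open>uniq\<close>: a point common to two summands
    would satisfy \<open>lt x x\<close>.\<close>
  define ix where "ix x = (SOME i. i \<in> I \<and> x \<in> A i)" for x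
  have uniq: "i = j" if "i \<in> I" "j \<in> I" "x \<in> A i" "x \<in> A j" for i j x
  proof (rule ccontr)
    assume "i \<noteq> j"
    then have "lt x x" using total[of i j] A[of i j] A[of j i] that unfolding set_less_def by metis
    then show False using asymA that by blast
  qed
  have ix: "ix x = i" if "i \<in> I" "x \<in> A i" for i x
  proof -
    have "ix x \<in> I \<and> x \<in> A (ix x)" unfolding ix_def by (rule someI[of _ i]) (use that in blast)
    then show ?thesis using uniq that by blast
  qed
  define g where "g x = f (ix x) x" for x
  have g: "g x = f i x" if "i \<in> I" "x \<in> A i" for i x using ix[OF that] g_def by simp
  have gB: "g x \<in> B i" if "i \<in> I" "x \<in> A i" for i x
    using g[OF that] f(1)[OF that(1)] that(2) bij_betwE by metis
  have ord: "lt x y \<longleftrightarrow> lt' (g x) (g y)" if xy: "i \<in> I" "x \<in> A i" "j \<in> I" "y \<in> A j" for i j x y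
  proof -
    consider "i = j" | "i \<noteq> j" "k i j" | "i \<noteq> j" "k j i" using total xy by blast
    then show ?thesis
    proof cases
      case 1 then show ?thesis using xy f(2) g by metis
    next
      case 2
      then show ?thesis using A[of i j] B[of i j] xy gB unfolding set_less_def by blast
    next
      case 3
      then have "lt y x" "lt' (g y) (g x)"
        using A[of j i] B[of j i] xy gB unfolding set_less_def by blast+
      then show ?thesis using asymA asymB xy gB by blast
    qed
  qed
  have inj: "inj_on g (\<Union>i\<in>I. A i)"
  proof (rule inj_onI)
    fix x y assume "x \<in> (\<Union>i\<in>I. A i)" "y \<in> (\<Union>i\<in>I. A i)" and eq: "g x = g y"
    then obtain i j where ij: "i \<in> I" "x \<in> A i" "j \<in> I" "y \<in> A j" by blast
    have "i = j"
    proof (rule ccontr)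
      assume "i \<noteq> j"
      then have "lt' (g x) (g y) \<or> lt' (g y) (g x)"
        using total[of i j] B[of i j] B[of j i] ij gB unfolding set_less_def by metis
      then show False using eq asymB gB ij by (metis UN_I)
    qed
    then show "x = y" using ij eq g f(1) by (metis bij_betw_def inj_on_def)
  qed
  have surj: "g ` (\<Union>i\<in>I. A i) = (\<Union>i\<in>I. B i)"
  proof
    show "g ` (\<Union>i\<in>I. A i) \<subseteq> (\<Union>i\<in>I. B i)" using gB by blast
    show "(\<Union>i\<in>I. B i) \<subseteq> g ` (\<Union>i\<in>I. A i)"
    proof
      fix y assume "y \<in> (\<Union>i\<in>I. B i)"
      then obtain i where i: "i \<in> I" "y \<in> B i" by blast
      then obtain x where "x \<in> A i" "f i x = y" using f(1)[OF i(1)] by (metis bij_betw_def imageE)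
      then show "y \<in> g ` (\<Union>i\<in>I. A i)" using i g by (metis UN_I imageI)
    qed
  qed
  show ?thesis unfolding ord_isomorphic_def
    by (rule exI[of _ g]) (use inj surj ord in \<open>auto simp: bij_betw_def\<close>)
qed

lemma ord_isomorphic_Un:
  assumes A: "set_less lt A A'" and B: "set_less lt' B B'"
    and asymA: "\<And>x y. x \<in> A \<union> A' \<Longrightarrow> y \<in> A \<union> A' \<Longrightarrow> lt x y \<Longrightarrow> \<not> lt y x"
    and asymB: "\<And>x y. x \<in> B \<union> B' \<Longrightarrow> y \<in> B \<union> B' \<Longrightarrow> lt' x y \<Longrightarrow> \<not> lt' y x"
    and iso: "ord_isomorphic lt A lt' B" "ord_isomorphic lt A' lt' B'"
  shows "ord_isomorphic lt (A \<union> A') lt' (B \<union> B')"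
proof -
  have eq: "(\<Union>i\<in>{False, True}. if i then A' else A) = A \<union> A'"
    "(\<Union>i\<in>{False, True}. if i then B' else B) = B \<union> B'" by auto
  have "ord_isomorphic lt (\<Union>i\<in>{False, True}. if i then A' else A) lt'
      (\<Union>i\<in>{False, True}. if i then B' else B)"
  proof (rule ord_isomorphic_UN[where k = "(<)"], unfold eq)
    show "\<And>x y. x \<in> A \<union> A' \<Longrightarrow> y \<in> A \<union> A' \<Longrightarrow> lt x y \<Longrightarrow> \<not> lt y x" by (rule asymA)
    show "\<And>x y. x \<in> B \<union> B' \<Longrightarrow> y \<in> B \<union> B' \<Longrightarrow> lt' x y \<Longrightarrow> \<not> lt' y x" by (rule asymB)
  qed (use A B iso in auto)
  then show ?thesis unfolding eq .
qed

section \<open>Strict linear orders: sums of type \<open>\<omega>\<close> and cofinal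
  sequences\<close>

locale strict_linear =
  fixes A :: "'a set" and lt :: "'a \<Rightarrow> 'a \<Rightarrow> bool"
  assumes irrefl: "x \<in> A \<Longrightarrow> \<not> lt x x"
    and trans: "x \<in> A \<Longrightarrow> y \<in> A \<Longrightarrow> z \<in> A \<Longrightarrow> lt x y \<Longrightarrow> lt y z \<Longrightarrow> lt x z"
    and total: "x \<in> A \<Longrightarrow> y \<in> A \<Longrightarrow> x \<noteq> y \<Longrightarrow> lt x y \<or> lt y x"
begin

lemma asym: "x \<in> A \<Longrightarrow> y \<in> A \<Longrightarrow> lt x y \<Longrightarrow> \<not> lt y x"
  using irrefl trans by blast

lemma ord_isomorphic_Un_subset:
  assumes "C \<subseteq> A" "C' \<subseteq> A" "D \<subseteq> A" "D' \<subseteq> A" "set_less lt C C'" "set_less lt D D'"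
    and "ord_isomorphic lt C lt D" "ord_isomorphic lt C' lt D'"
  shows "ord_isomorphic lt (C \<union> C') lt (D \<union> D')"
  by (rule ord_isomorphic_Un[OF assms(5,6) _ _ assms(7,8)]) (meson asym assms(1-4) UnE subsetD)+

lemma reverse: "strict_linear A (\<lambda>x y. lt y x)"
  by unfold_locales (use irrefl trans total in blast)+

text \<open>Consecutive comparisons propagate through a point of the summand in between, hence the
  condition that no \<open>J n\<close> is empty.\<close>

lemma set_less_chain:
  fixes J :: "nat \<Rightarrow> 'a set"
  assumes J: "\<And>n. J n \<subseteq> A" "\<And>n. J n \<noteq> {}" "\<And>n. set_less lt (J n) (J (Suc n))"
  shows "m < n \<Longrightarrow> set_less lt (J m) (J n)"
proof (induction n)
  case (Suc n)
  show ?case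
  proof (cases "m = n")
    case False
    then have mn: "set_less lt (J m) (J n)" using Suc by simp
    obtain z where z: "z \<in> J n" using J(2) by blast
    show ?thesis unfolding set_less_def
    proof (intro ballI)
      fix x y assume xy: "x \<in> J m" "y \<in> J (Suc n)"
      then have "lt x z" "lt z y" using mn J(3)[of n] z unfolding set_less_def by blast+
      then show "lt x y" using trans[of x z y] xy z J(1) by blast
    qed
  qed (use J(3) in simp)
qed simp

lemma ord_isomorphic_chain_UN:
  fixes J J' :: "nat \<Rightarrow> 'a set"
  assumes J: "\<And>n. J n \<subseteq> A" "\<And>n. J n \<noteq> {}" "\<And>n. set_less lt (J n) (J (Suc n))"
    and J': "\<And>n. J' n \<subseteq> A" "\<And>n. J' n \<noteq> {}" "\<And>n. set_less lt (J' n) (J' (Suc n))"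
    and iso: "\<And>n. ord_isomorphic lt (J n) lt (J' n)"
  shows "ord_isomorphic lt (\<Union>n. J n) lt (\<Union>n. J' n)"
proof (rule ord_isomorphic_UN[where k = "(<)"])
  show "\<And>x y. x \<in> (\<Union>n. J n) \<Longrightarrow> y \<in> (\<Union>n. J n) \<Longrightarrow> lt x y \<Longrightarrow> \<not> lt y x"
    using asym J(1) by blast
  show "\<And>x y. x \<in> (\<Union>n. J' n) \<Longrightarrow> y \<in> (\<Union>n. J' n) \<Longrightarrow> lt x y \<Longrightarrow> \<not> lt y x"
    using asym J'(1) by blast
qed (use set_less_chain[of J, OF J] set_less_chain[of J', OF J'] iso in auto)

lemma strict_mono_seq:
  assumes "\<And>n::nat. w n \<in> A" "\<And>n. lt (w n) (w (Suc n))"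
  shows "m < n \<Longrightarrow> lt (w m) (w n)"
  using set_less_chain[of "\<lambda>n. {w n}" m n] assms unfolding set_less_def by auto

text \<open>The prescribed first term matters later: the part of a set above \<open>z\<close> is cut
  into pieces beginning exactly at \<open>z\<close>, and sequences of nodes on a branch must begin
  at a given node.\<close>

lemma countable_cofinal_seq:
  assumes B: "countable B" "B \<subseteq> C" "C \<subseteq> A" "z \<in> C"
    and cof: "\<And>x. x \<in> C \<Longrightarrow> \<exists>b\<in>B. x = b \<or> lt x b"
    and nomax: "\<And>x. x \<in> C \<Longrightarrow> \<exists>y\<in>C. lt x y"
  shows "\<exists>w :: nat \<Rightarrow> 'a. w 0 = z \<and> (\<forall>n. w n \<in> C) \<and> (\<forall>n. lt (w n) (w (Suc n))) \<and> (\<forall>x\<in>C. \<exists>n. lt x (w n))"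
proof -
  have Bne: "B \<noteq> {}" using cof B(4) by blast
  define e where "e = from_nat_into B"
  have e: "e n \<in> B" for n :: nat unfolding e_def using Bne by (rule from_nat_into)
  have "\<exists>w :: nat \<Rightarrow> 'a. \<forall>n. (w n \<in> C \<and> (n = 0 \<longrightarrow> w n = z)) \<and>
      (lt (w n) (w (Suc n)) \<and> lt (e n) (w (Suc n)))"
  proof (rule dependent_nat_choice)
    show "\<exists>x. x \<in> C \<and> ((0::nat) = 0 \<longrightarrow> x = z)" using B(4) by blast
  next
    fix x and n :: nat assume x: "x \<in> C \<and> (n = 0 \<longrightarrow> x = z)"
    have en: "e n \<in> C" using e B(2) by blast
    \<comment> \<open>An element beyond the larger of \<open>x\<close> and \<open>e n\<close> keeps
      the sequence increasing and at the same time overtakes the \<open>n\<close>-th element of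
      \<open>B\<close>.\<close>
    define m where "m = (if lt x (e n) then e n else x)"
    have m: "m \<in> C" using en x m_def by simp
    obtain y where y: "y \<in> C" "lt m y" using nomax[OF m] by blast
    have "lt x y \<and> lt (e n) y"
      using trans[of x "e n" y] total[of x "e n"] trans[of "e n" x y] y x en B(3) m_def
      by (metis subsetD)
    then show "\<exists>y. (y \<in> C \<and> (Suc n = 0 \<longrightarrow> y = z)) \<and> lt x y \<and> lt (e n) y" using y by blast
  qed
  then obtain w where w: "w 0 = z" "\<And>n. w n \<in> C" "\<And>n. lt (w n) (w (Suc n))" "\<And>n. lt (e n) (w (Suc n))"
    by metis
  have "\<exists>n. lt x (w n)" if x: "x \<in> C" for x
  proof -
    obtain b where b: "b \<in> B" "x = b \<or> lt x b" using cof x by blast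
    obtain n where "b = e n" using b(1) B(1) from_nat_into_surj e_def by metis
    then show ?thesis using w(4)[of n] b trans[of x b "w (Suc n)"] x B(2,3) w(2) by blast
  qed
  then show ?thesis using w by blast
qed

end

section \<open>Homogeneity as a property of the order, without topology\<close>

definition order_dense :: "'a set \<Rightarrow> ('a \<Rightarrow> 'a \<Rightarrow> bool) \<Rightarrow> bool" where
  "order_dense A lt \<longleftrightarrow> A \<noteq> {} \<and>
     (\<forall>x\<in>A. \<forall>y\<in>A. lt x y \<longrightarrow> (\<exists>z\<in>A. lt x z \<and> lt z y)) \<and>
     (\<forall>x\<in>A. \<exists>y\<in>A. lt x y) \<and> (\<forall>x\<in>A. \<exists>y\<in>A. lt y x)"

text \<open>Openness is encoded as having neither a greatest nor a least element. For nonempty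
  convex sets in a dense order without endpoints this agrees with the order topology, see
  \<open>open_convex_iff\<close>.\<close>

definition open_convex :: "'a set \<Rightarrow> ('a \<Rightarrow> 'a \<Rightarrow> bool) \<Rightarrow> 'a set \<Rightarrow> bool" where
  "open_convex A lt C \<longleftrightarrow> C \<subseteq> A \<and> C \<noteq> {} \<and>
     (\<forall>x\<in>C. \<forall>z\<in>C. \<forall>y\<in>A. lt x y \<and> lt y z \<longrightarrow> y \<in> C) \<and>
     (\<forall>x\<in>C. \<exists>y\<in>C. lt x y) \<and> (\<forall>x\<in>C. \<exists>y\<in>C. lt y x)"

definition homogeneous :: "'a set \<Rightarrow> ('a \<Rightarrow> 'a \<Rightarrow> bool) \<Rightarrow> bool" where
  "homogeneous A lt \<longleftrightarrow> strict_linear A lt \<and> order_dense A lt \<and>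
     (\<forall>C. open_convex A lt C \<longrightarrow> ord_isomorphic lt C lt A)"

lemma order_dense_reverse: "order_dense A (\<lambda>x y. lt y x) \<longleftrightarrow> order_dense A lt"
  unfolding order_dense_def by blast

lemma open_convex_reverse: "open_convex A (\<lambda>x y. lt y x) C \<longleftrightarrow> open_convex A lt C"
  unfolding open_convex_def by blast

lemma homogeneous_reverse: "homogeneous A lt \<Longrightarrow> homogeneous A (\<lambda>x y. lt y x)"
  unfolding homogeneous_def order_dense_reverse[of A lt] open_convex_reverse[of A lt]
    ord_isomorphic_reverse[of lt _ lt]
  by (simp add: strict_linear.reverse)

text \<open>Carries homogeneity from the successors of the root to those of any node and, along the
  identity, from \<open>split_less\<close> to \<open>branch_order\<close>.\<close>

lemma homogeneous_iso:
  assumes f: "bij_betw f A B" "\<And>x y. x \<in> A \<Longrightarrow> y \<in> A \<Longrightarrow> lt x y \<longleftrightarrow> lt' (f x) (f y)"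
    and h: "homogeneous B lt'"
  shows "homogeneous A lt"
proof -
  interpret B: strict_linear B lt' using h unfolding homogeneous_def by blast
  have fB: "x \<in> A \<Longrightarrow> f x \<in> B" for x using f(1) bij_betwE by blast
  have fA: "y \<in> B \<Longrightarrow> \<exists>x\<in>A. f x = y" for y using f(1) by (metis bij_betw_def imageE)
  have inj: "x \<in> A \<Longrightarrow> y \<in> A \<Longrightarrow> f x = f y \<Longrightarrow> x = y" for x y
    using f(1) by (metis bij_betw_def inj_on_def)
  have lin: "strict_linear A lt"
  proof
    show "\<not> lt x x" if "x \<in> A" for x using that f(2) B.irrefl fB by blast
    show "lt x z" if "x \<in> A" "y \<in> A" "z \<in> A" "lt x y" "lt y z" for x y z
      using that f(2) B.trans[of "f x" "f y" "f z"] fB by simp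
    show "lt x y \<or> lt y x" if "x \<in> A" "y \<in> A" "x \<noteq> y" for x y
      using that f(2) B.total fB inj by metis
  qed
  have d: "order_dense B lt'" using h unfolding homogeneous_def by blast
  have dense: "order_dense A lt" unfolding order_dense_def
  proof (intro conjI ballI impI)
    show "A \<noteq> {}" using d fA unfolding order_dense_def by blast
    show "\<exists>z\<in>A. lt x z \<and> lt z y" if "x \<in> A" "y \<in> A" "lt x y" for x y
      using that d fA fB f(2) unfolding order_dense_def by metis
    show "\<exists>y\<in>A. lt x y" if "x \<in> A" for x
      using that d fA fB f(2) unfolding order_dense_def by metis
    show "\<exists>y\<in>A. lt y x" if "x \<in> A" for x
      using that d fA fB f(2) unfolding order_dense_def by metis
  qed
  have "ord_isomorphic lt C lt A" if C: "open_convex A lt C" for C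
  proof -
    have CA: "C \<subseteq> A" using C unfolding open_convex_def by blast
    have fC: "open_convex B lt' (f ` C)" unfolding open_convex_def
    proof (intro conjI ballI impI)
      show "f ` C \<subseteq> B" "f ` C \<noteq> {}" using CA fB C unfolding open_convex_def by blast+
      show "y \<in> f ` C" if h: "x \<in> f ` C" "z \<in> f ` C" "y \<in> B" "lt' x y \<and> lt' y z" for x y z
      proof -
        obtain x' z' where x': "x' \<in> C" "x = f x'" "z' \<in> C" "z = f z'" using h by blast
        obtain y' where y': "y' \<in> A" "f y' = y" using h fA by blast
        have "lt x' y'" "lt y' z'" using f(2) x' y' h(4) CA by blast+
        then have "y' \<in> C" using C x' y' unfolding open_convex_def by blast
        then show ?thesis using y' by blast
      qed
      show "\<exists>y\<in>f ` C. lt' x y" if "x \<in> f ` C" for x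
        using that C f(2) CA unfolding open_convex_def by blast
      show "\<exists>y\<in>f ` C. lt' y x" if "x \<in> f ` C" for x
        using that C f(2) CA unfolding open_convex_def by blast
    qed
    have 1: "ord_isomorphic lt C lt' (f ` C)" unfolding ord_isomorphic_def
      by (rule exI[of _ f]) (use f CA bij_betw_subset in blast)
    have 2: "ord_isomorphic lt' (f ` C) lt' B" using fC h unfolding homogeneous_def by blast
    have 3: "ord_isomorphic lt' B lt A"
      by (rule ord_isomorphic_sym) (use f in \<open>auto simp: ord_isomorphic_def\<close>)
    show ?thesis using 1 2 3 ord_isomorphic_trans by metis
  qed
  with lin dense show ?thesis unfolding homogeneous_def by blast
qed

lemma homogeneous_imp_cofinal_seq:
  assumes "homogeneous A lt"
  shows "\<exists>w :: nat \<Rightarrow> 'a. (\<forall>n. w n \<in> A) \<and> (\<forall>n. lt (w n) (w (Suc n))) \<and> (\<forall>x\<in>A. \<exists>n. lt x (w n))"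
proof -
  interpret strict_linear A lt using assms unfolding homogeneous_def by blast
  have d: "order_dense A lt" using assms unfolding homogeneous_def by blast
  then obtain a where a: "a \<in> A" unfolding order_dense_def by blast
  have "\<exists>w :: nat \<Rightarrow> 'a. \<forall>n. w n \<in> A \<and> lt (w n) (w (Suc n))"
    by (rule dependent_nat_choice) (use d a in \<open>auto simp: order_dense_def\<close>)
  then obtain w :: "nat \<Rightarrow> 'a" where w: "\<And>n. w n \<in> A" "\<And>n. lt (w n) (w (Suc n))" by blast
  \<comment> \<open>\<open>w\<close> need not be cofinal in \<open>A\<close>, but it is cofinal in
    the initial segment \<open>C\<close> that it generates, and an isomorphism of \<open>C\<close>
    onto \<open>A\<close> carries it to a cofinal sequence.\<close>
  define C where "C = {x \<in> A. \<exists>n. lt x (w n)}"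
  have wC: "w n \<in> C" for n using w C_def by blast
  have "open_convex A lt C" unfolding open_convex_def
  proof (intro conjI ballI impI)
    show "C \<subseteq> A" "C \<noteq> {}" using C_def wC by blast+
    show "y \<in> C" if "x \<in> C" "z \<in> C" "y \<in> A" "lt x y \<and> lt y z" for x y z
      using that trans w(1) unfolding C_def by blast
    show "\<exists>y\<in>C. lt x y" if "x \<in> C" for x using that wC C_def by blast
    show "\<exists>y\<in>C. lt y x" if x: "x \<in> C" for x
    proof -
      obtain y where "y \<in> A" "lt y x" using d x C_def unfolding order_dense_def by blast
      moreover then have "y \<in> C" using trans w(1) x unfolding C_def by blast
      ultimately show ?thesis by blast
    qed
  qed
  then have "ord_isomorphic lt C lt A" using assms unfolding homogeneous_def by blast
  then obtain f where f: "bij_betw f C A" "\<forall>x\<in>C. \<forall>y\<in>C. lt x y \<longleftrightarrow> lt (f x) (f y)"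
    unfolding ord_isomorphic_def by blast
  have "\<exists>n. lt x (f (w n))" if x: "x \<in> A" for x
  proof -
    obtain y where y: "y \<in> C" "f y = x" using x f(1) unfolding bij_betw_def by blast
    then show ?thesis using f(2) wC C_def by blast
  qed
  moreover have "f (w n) \<in> A" "lt (f (w n)) (f (w (Suc n)))" for n
    using f wC w bij_betwE by blast+
  ultimately show ?thesis by (intro exI[of _ "f \<circ> w"]) auto
qed

text \<open>The initial segment \<open>C\<close> generated by \<open>I\<close> is open and convex,
  hence isomorphic to \<open>A\<close>, and inherits a cofinal sequence; above each of its terms
  there is an element of \<open>I\<close>.\<close>

lemma homogeneous_subset_countable_cofinal:
  assumes h: "homogeneous A lt" and I: "I \<subseteq> A" "I \<noteq> {}" and nomax: "\<And>x. x \<in> I \<Longrightarrow> \<exists>y\<in>I. lt x y"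
  shows "\<exists>B. countable B \<and> B \<subseteq> I \<and> (\<forall>x\<in>I. \<exists>b\<in>B. lt x b)"
proof -
  interpret strict_linear A lt using h unfolding homogeneous_def by blast
  have d: "order_dense A lt" using h unfolding homogeneous_def by blast
  define C where "C = {x \<in> A. \<exists>y\<in>I. lt x y}"
  have IC: "I \<subseteq> C" using nomax I C_def by blast
  have "open_convex A lt C" unfolding open_convex_def
  proof (intro conjI ballI impI)
    show "C \<subseteq> A" "C \<noteq> {}" using C_def IC I by blast+
    show "y \<in> C" if "x \<in> C" "z \<in> C" "y \<in> A" "lt x y \<and> lt y z" for x y z
      using that trans I unfolding C_def by blast
    show "\<exists>y\<in>C. lt x y" if "x \<in> C" for x using that IC C_def by blast
    show "\<exists>y\<in>C. lt y x" if x: "x \<in> C" for x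
    proof -
      obtain y where "y \<in> A" "lt y x" using d x C_def unfolding order_dense_def by blast
      moreover then have "y \<in> C" using trans I x unfolding C_def by blast
      ultimately show ?thesis by blast
    qed
  qed
  then have "ord_isomorphic lt A lt C" using h ord_isomorphic_sym unfolding homogeneous_def by blast
  then obtain f where f: "bij_betw f A C" "\<forall>x\<in>A. \<forall>y\<in>A. lt x y \<longleftrightarrow> lt (f x) (f y)"
    unfolding ord_isomorphic_def by blast
  obtain w :: "nat \<Rightarrow> 'a" where w: "\<And>n. w n \<in> A" "\<And>x. x \<in> A \<Longrightarrow> \<exists>n. lt x (w n)"
    using homogeneous_imp_cofinal_seq[OF h] by blast
  have "\<exists>y\<in>I. lt (f (w n)) y" for n using f(1) w(1)[of n] bij_betwE C_def by blast
  then obtain y where y: "\<And>n. y n \<in> I" "\<And>n. lt (f (w n)) (y n)" by metis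
  have "\<exists>b\<in>range y. lt x b" if x: "x \<in> I" for x
  proof -
    obtain a where a: "a \<in> A" "f a = x" using x IC f(1) unfolding bij_betw_def by blast
    obtain n where n: "lt a (w n)" using w(2) a by blast
    then have "lt x (f (w n))" using f(2) a w by blast
    moreover have "f (w n) \<in> A" using f(1) w(1) bij_betwE C_def by blast
    ultimately have "lt x (y n)" using trans y I x by blast
    then show ?thesis by blast
  qed
  then show ?thesis using y by (intro exI[of _ "range y"]) auto
qed

lemma (in strict_linear) open_convex_rays:
  assumes d: "order_dense A lt" and a: "a \<in> A"
  shows "open_convex A lt {x \<in> A. lt a x}" "open_convex A lt {x \<in> A. lt x a}"
    and "b \<in> A \<Longrightarrow> lt a b \<Longrightarrow> open_convex A lt {x \<in> A. lt a x \<and> lt x b}"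
proof -
  have d': "\<And>x y. x \<in> A \<Longrightarrow> y \<in> A \<Longrightarrow> lt x y \<Longrightarrow> \<exists>z\<in>A. lt x z \<and> lt z y"
    "\<And>x. x \<in> A \<Longrightarrow> \<exists>y\<in>A. lt x y" "\<And>x. x \<in> A \<Longrightarrow> \<exists>y\<in>A. lt y x"
    using d unfolding order_dense_def by blast+
  show "open_convex A lt {x \<in> A. lt a x}"
    unfolding open_convex_def
  proof (intro conjI)
    show "\<forall>x\<in>{x \<in> A. lt a x}. \<exists>y\<in>{x \<in> A. lt a x}. lt x y" using d'(2) a trans by blast
    show "\<forall>x\<in>{x \<in> A. lt a x}. \<exists>y\<in>{x \<in> A. lt a x}. lt y x" using d'(1) a by blast
  qed (use d'(2) a trans in blast)+
  show "open_convex A lt {x \<in> A. lt x a}"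
    unfolding open_convex_def
  proof (intro conjI)
    show "\<forall>x\<in>{x \<in> A. lt x a}. \<exists>y\<in>{x \<in> A. lt x a}. lt x y" using d'(1) a by blast
    show "\<forall>x\<in>{x \<in> A. lt x a}. \<exists>y\<in>{x \<in> A. lt x a}. lt y x" using d'(3) a trans by blast
  qed (use d'(3) a trans in blast)+
  assume b: "b \<in> A" "lt a b"
  let ?I = "{x \<in> A. lt a x \<and> lt x b}"
  show "open_convex A lt ?I"
    unfolding open_convex_def
  proof (intro conjI)
    show "\<forall>x\<in>?I. \<exists>y\<in>?I. lt x y"
    proof
      fix x assume x: "x \<in> ?I"
      then obtain y where "y \<in> A" "lt x y" "lt y b" using d'(1) b by blast
      then show "\<exists>y\<in>?I. lt x y" using x a trans[of a x y] by blast
    qed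
    show "\<forall>x\<in>?I. \<exists>y\<in>?I. lt y x"
    proof
      fix x assume x: "x \<in> ?I"
      then obtain y where "y \<in> A" "lt a y" "lt y x" using d'(1) a by blast
      then show "\<exists>y\<in>?I. lt y x" using x b trans[of y x b] by blast
    qed
    show "\<forall>x\<in>?I. \<forall>z\<in>?I. \<forall>y\<in>A. lt x y \<and> lt y z \<longrightarrow> y \<in> ?I"
    proof (intro ballI impI)
      fix x z y assume "x \<in> ?I" "z \<in> ?I" "y \<in> A" "lt x y \<and> lt y z"
      then show "y \<in> ?I" using trans[of a x y] trans[of y z b] a b by blast
    qed
    show "?I \<noteq> {}" using d'(1) a b by blast
  qed blast
qed

definition strict_of :: "'a rel \<Rightarrow> 'a \<Rightarrow> 'a \<Rightarrow> bool" where
  "strict_of R x y \<longleftrightarrow> (x, y) \<in> R \<and> x \<noteq> y"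

locale partial_order_set =
  fixes T :: "'a set" and r :: "'a rel"
  assumes partial_order: "partial_order_on T r"
begin

lemma r_refl: "p \<in> T \<Longrightarrow> (p, p) \<in> r"
  using partial_order by (auto simp: partial_order_on_def preorder_on_def refl_on_def)

lemma r_sub: "(p, q) \<in> r \<Longrightarrow> p \<in> T \<and> q \<in> T"
  using partial_order by (auto simp: partial_order_on_def preorder_on_def refl_on_def)

lemma r_trans: "(p, q) \<in> r \<Longrightarrow> (q, c) \<in> r \<Longrightarrow> (p, c) \<in> r"
  using partial_order unfolding partial_order_on_def preorder_on_def by (blast dest: transD)

lemma r_antisym: "(p, q) \<in> r \<Longrightarrow> (q, p) \<in> r \<Longrightarrow> p = q"
  using partial_order unfolding partial_order_on_def by (blast dest: antisymD)

end

subsection \<open>Trees and their branches\<close>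

text \<open>The order-theoretic counterpart of \<open>imm_succ\<close>; the two are identified in
  \<open>imm_succ_covers\<close>.\<close>

definition covers :: "'a rel \<Rightarrow> 'a \<Rightarrow> 'a set" where
  "covers r p = {q. (p, q) \<in> r \<and> p \<noteq> q \<and> (\<forall>c. (p, c) \<in> r \<and> (c, q) \<in> r \<longrightarrow> c = p \<or> c = q)}"

definition cone_at :: "'a rel \<Rightarrow> 'a \<Rightarrow> 'a set set" where
  "cone_at r p = {x \<in> branches r. p \<in> x}"

text \<open>\<open>branch_less\<close> with the ordinals removed and \<open>l p\<close> as a strict
  order on the successors of \<open>p\<close>; compare
  \<open>branch_less_iff_split_less\<close>.\<close>

definition split_less :: "'a rel \<Rightarrow> ('a \<Rightarrow> 'a \<Rightarrow> 'a \<Rightarrow> bool) \<Rightarrow> 'a set \<Rightarrow> 'a set \<Rightarrow> bool" where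
  "split_less r l x y \<longleftrightarrow> (\<exists>p\<in>x \<inter> y. \<exists>a\<in>x \<inter> covers r p. \<exists>b\<in>y \<inter> covers r p. l p a b)"

definition is_copy :: "'a rel \<Rightarrow> ('a \<Rightarrow> 'a \<Rightarrow> 'a \<Rightarrow> bool) \<Rightarrow> 'a set set \<Rightarrow> bool" where
  "is_copy r l C \<longleftrightarrow> C \<subseteq> branches r \<and> ord_isomorphic (split_less r l) C (split_less r l) (branches r)"

text \<open>Reversing the order on every successor set reverses the order of branches, so mirror
  images are obtained by instantiating \<open>l\<close> with its reverse.\<close>

lemma split_less_reverse: "split_less r (\<lambda>p a b. l p b a) = (\<lambda>x y. split_less r l y x)"
  unfolding split_less_def by blast

lemma copy_reverse: "is_copy r (\<lambda>p a b. l p b a) C \<longleftrightarrow> is_copy r l C"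
  unfolding is_copy_def split_less_reverse[of r l] ord_isomorphic_reverse[of "split_less r l" _ "split_less r l"] ..

text \<open>The two assumptions retain of the well-ordered predecessor sets what the study of
  branches uses: linearity and the existence of minimal nodes.\<close>

locale tree_order = partial_order_set T r for T :: "'a set" and r :: "'a rel" +
  assumes pred_linear: "(q, p) \<in> r \<Longrightarrow> (q', p) \<in> r \<Longrightarrow> (q, q') \<in> r \<or> (q', q) \<in> r"
    and wf: "wf (r - Id)"
begin

lemma minimal_ex: "c \<in> A \<Longrightarrow> \<exists>m\<in>A. \<forall>a\<in>A. (a, m) \<in> r \<longrightarrow> a = m"
  using wf unfolding wf_eq_minimal by (metis DiffI pair_in_Id_conv)

lemma coversD: "a \<in> covers r p \<Longrightarrow> (p, a) \<in> r" "a \<in> covers r p \<Longrightarrow> p \<noteq> a"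
  "a \<in> covers r p \<Longrightarrow> (p, c) \<in> r \<Longrightarrow> (c, a) \<in> r \<Longrightarrow> c = p \<or> c = a"
  unfolding covers_def by blast+

lemma covers_sub: "a \<in> covers r p \<Longrightarrow> a \<in> T"
  using coversD(1) r_sub by blast

lemma cover_below:
  assumes "(p, q) \<in> r" "p \<noteq> q" shows "\<exists>a\<in>covers r p. (a, q) \<in> r"
proof -
  let ?A = "{c. (p, c) \<in> r \<and> p \<noteq> c \<and> (c, q) \<in> r}"
  have "q \<in> ?A" using assms r_refl r_sub by blast
  from minimal_ex[OF this] obtain m where m: "m \<in> ?A" "\<forall>a\<in>?A. (a, m) \<in> r \<longrightarrow> a = m" by blast
  have "m \<in> covers r p" unfolding covers_def using m r_trans by blast
  then show ?thesis using m by blast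
qed

lemma branch_chain: "x \<in> branches r \<Longrightarrow> p \<in> x \<Longrightarrow> q \<in> x \<Longrightarrow> (p, q) \<in> r \<or> (q, p) \<in> r"
  unfolding branches_def Chains_def by blast

lemma branch_sub: "x \<in> branches r \<Longrightarrow> p \<in> x \<Longrightarrow> p \<in> T"
  using branch_chain r_sub by blast

lemma branch_maximal: "x \<in> branches r \<Longrightarrow> y \<in> branches r \<Longrightarrow> x \<subseteq> y \<Longrightarrow> x = y"
  unfolding branches_def by blast

lemma branch_insert:
  assumes x: "x \<in> branches r" and q: "q \<in> T" "\<And>c. c \<in> x \<Longrightarrow> (c, q) \<in> r \<or> (q, c) \<in> r"
  shows "q \<in> x"
proof -
  have "insert q x \<in> Chains r"
    using x q(2) r_refl[OF q(1)] unfolding branches_def Chains_def by blast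
  then show ?thesis using x unfolding branches_def by blast
qed

lemma branch_down:
  assumes x: "x \<in> branches r" and p: "p \<in> x" "(q, p) \<in> r" shows "q \<in> x"
proof (rule branch_insert[OF x])
  show "q \<in> T" using p r_sub by blast
  show "(c, q) \<in> r \<or> (q, c) \<in> r" if "c \<in> x" for c
    using branch_chain[OF x that p(1)] pred_linear[OF p(2)] r_trans[OF p(2)] by blast
qed

lemma chain_extends:
  assumes "\<And>p q. p \<in> C \<Longrightarrow> q \<in> C \<Longrightarrow> (p, q) \<in> r \<or> (q, p) \<in> r"
  shows "\<exists>x\<in>branches r. C \<subseteq> x"
proof -
  let ?A = "{y \<in> Chains r. C \<subseteq> y}"
  have "\<exists>M\<in>?A. \<forall>X\<in>?A. M \<subseteq> X \<longrightarrow> X = M"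
  proof (rule subset_Zorn_nonempty)
    show "?A \<noteq> {}" using assms unfolding Chains_def by blast
  next
    fix \<C> assume ne: "\<C> \<noteq> {}" and ch: "subset.chain ?A \<C>"
    have sub: "\<And>X. X \<in> \<C> \<Longrightarrow> X \<in> Chains r \<and> C \<subseteq> X"
      and cmp: "\<And>X Y. X \<in> \<C> \<Longrightarrow> Y \<in> \<C> \<Longrightarrow> X \<subseteq> Y \<or> Y \<subseteq> X"
      using ch unfolding subset_chain_def by blast+
    have "(p, q) \<in> r \<or> (q, p) \<in> r" if "p \<in> X" "q \<in> Y" "X \<in> \<C>" "Y \<in> \<C>" for p q X Y
      using cmp[OF that(3,4)] sub[OF that(3)] sub[OF that(4)] that(1,2) unfolding Chains_def by blast
    then have "\<Union>\<C> \<in> Chains r" unfolding Chains_def by blast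
    then show "\<Union>\<C> \<in> ?A" using sub ne by blast
  qed
  then obtain M where M: "M \<in> ?A" "\<forall>X\<in>?A. M \<subseteq> X \<longrightarrow> X = M" by (rule bexE)
  have "y = M" if "y \<in> Chains r" "M \<subseteq> y" for y
    using M(2)[rule_format, of y] that M(1) by blast
  then have "M \<in> branches r" using M(1) unfolding branches_def by blast
  then show ?thesis using M by blast
qed

lemma cone_nonempty: "p \<in> T \<Longrightarrow> cone_at r p \<noteq> {}"
  using chain_extends[of "{p}"] r_refl unfolding cone_at_def by blast

end

text \<open>In \<open>limit_unique\<close> the limit level is expressed by the absence of a greatest
  predecessor. This includes nodes with no predecessor at all, so the assumption also says that
  there is at most one root.\<close>

locale tree_branches = tree_order +
  assumes limit_unique: "p \<in> T \<Longrightarrow> q \<in> T \<Longrightarrow> underS r p = underS r q \<Longrightarrow>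
      (\<And>c. c \<in> underS r p \<Longrightarrow> \<exists>d\<in>underS r p. (c, d) \<in> r \<and> c \<noteq> d) \<Longrightarrow> p = q"
    and covers_nonempty: "p \<in> T \<Longrightarrow> covers r p \<noteq> {}"
begin

text \<open>A cover of a last node could be added to the branch, so no branch has a last
  node.\<close>

lemma branch_next:
  assumes x: "x \<in> branches r" and p: "p \<in> x" shows "\<exists>a\<in>x. a \<in> covers r p"
proof -
  obtain b where b: "b \<in> covers r p" using covers_nonempty branch_sub[OF x p] by blast
  have "\<exists>q\<in>x. (q, p) \<notin> r"
  proof (rule ccontr)
    assume neg: "\<not> (\<exists>q\<in>x. (q, p) \<notin> r)"
    then have "b \<in> x" using branch_insert[OF x] covers_sub[OF b] coversD(1)[OF b] r_trans by blast
    then show False using neg coversD[OF b] r_antisym by blast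
  qed
  then obtain q where q: "q \<in> x" "(p, q) \<in> r" "p \<noteq> q" using branch_chain[OF x p] by blast
  then show ?thesis using cover_below[OF q(2,3)] branch_down[OF x q(1)] by blast
qed

lemma cover_unique:
  assumes "x \<in> branches r" "a \<in> x" "b \<in> x" "a \<in> covers r p" "b \<in> covers r p" shows "a = b"
  using branch_chain[OF assms(1-3)] coversD[OF assms(4)] coversD[OF assms(5)] by blast

lemma cover_le:
  assumes "x \<in> branches r" "a \<in> x" "q \<in> x" "a \<in> covers r p" "(p, q) \<in> r" "p \<noteq> q"
  shows "(a, q) \<in> r"
  using branch_chain[OF assms(1-3)] coversD(3)[OF assms(4,5)] assms(6) r_refl covers_sub[OF assms(4)]
  by blast

text \<open>The least node of \<open>y\<close> outside \<open>Q\<close> has exactly \<open>Q\<close>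
  as its set of predecessors. This locates the first node after a split, after a limit, and after a
  gap.\<close>

lemma node_after:
  assumes y: "y \<in> branches r" and Q: "Q \<subseteq> y" "Q \<noteq> y"
    and down: "\<forall>q\<in>Q. \<forall>c. (c, q) \<in> r \<longrightarrow> c \<in> Q"
  shows "\<exists>p\<in>y. p \<notin> Q \<and> underS r p = Q"
proof -
  obtain c where "c \<in> y - Q" using Q by blast
  from minimal_ex[OF this] obtain p where p: "p \<in> y - Q" "\<forall>a\<in>y - Q. (a, p) \<in> r \<longrightarrow> a = p"
    by blast
  have "underS r p \<subseteq> Q" using p branch_down[OF y] unfolding underS_def by blast
  moreover have "q \<in> underS r p" if "q \<in> Q" for q
    using branch_chain[OF y, of q p] that p(1) Q(1) down unfolding underS_def by blast
  ultimately show ?thesis using p by blast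
qed

lemma max_underS_covers:
  assumes "c \<in> underS r p" "\<And>d. d \<in> underS r p \<Longrightarrow> (c, d) \<in> r \<Longrightarrow> c = d"
  shows "p \<in> covers r c"
  using assms unfolding underS_def covers_def by blast

text \<open>The nodes following \<open>x \<inter> y\<close> on the two branches are distinct but
  have the same predecessors. By \<open>limit_unique\<close> these have a greatest element, and that
  is where the branches split.\<close>

lemma branches_split:
  assumes x: "x \<in> branches r" and y: "y \<in> branches r" and ne: "x \<noteq> y"
  shows "\<exists>p\<in>x \<inter> y. \<exists>a\<in>x \<inter> covers r p. \<exists>b\<in>y \<inter> covers r p. a \<noteq> b"
proof -
  let ?Q = "x \<inter> y"
  have Q: "?Q \<noteq> x" "?Q \<noteq> y" using branch_maximal[OF x y] branch_maximal[OF y x] ne by blast+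
  have down: "\<forall>q\<in>?Q. \<forall>c. (c, q) \<in> r \<longrightarrow> c \<in> ?Q"
    using branch_down[OF x] branch_down[OF y] by blast
  obtain a where a: "a \<in> x" "a \<notin> ?Q" "underS r a = ?Q" using node_after[OF x Int_lower1 Q(1) down] by blast
  obtain b where b: "b \<in> y" "b \<notin> ?Q" "underS r b = ?Q" using node_after[OF y Int_lower2 Q(2) down] by blast
  have ab: "a \<noteq> b" using a b by blast
  then obtain p where p: "p \<in> ?Q" "\<And>d. d \<in> ?Q \<Longrightarrow> (p, d) \<in> r \<Longrightarrow> p = d"
    using limit_unique[of a b] branch_sub[OF x a(1)] branch_sub[OF y b(1)] a(3) b(3) by metis
  have "a \<in> covers r p" "b \<in> covers r p"
    using max_underS_covers[of p a] max_underS_covers[of p b] a(3) b(3) p by blast+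
  then show ?thesis using a b p ab by blast
qed

lemma cone_mono: "(p, q) \<in> r \<Longrightarrow> cone_at r q \<subseteq> cone_at r p"
  unfolding cone_at_def using branch_down by blast

lemma cone_covers: "cone_at r p = (\<Union>a\<in>covers r p. cone_at r a)"
proof
  show "cone_at r p \<subseteq> (\<Union>a\<in>covers r p. cone_at r a)" unfolding cone_at_def using branch_next by blast
  show "(\<Union>a\<in>covers r p. cone_at r a) \<subseteq> cone_at r p" using cone_mono coversD(1) by blast
qed

end

section \<open>The linear order of the branches and its cones\<close>

locale branch_space = tree_branches T r for T :: "'a set" and r :: "'a rel" +
  fixes l :: "'a \<Rightarrow> 'a \<Rightarrow> 'a \<Rightarrow> bool" and root :: 'a
  assumes root: "root \<in> T" "p \<in> T \<Longrightarrow> (root, p) \<in> r"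
    and homogeneous_covers: "p \<in> T \<Longrightarrow> homogeneous (covers r p) (l p)"
    and countable_branch: "x \<in> branches r \<Longrightarrow> countable x"
    and cone_iso: "p \<in> T \<Longrightarrow>
      ord_isomorphic (split_less r l) (cone_at r p) (split_less r l) (branches r)"
begin

abbreviation blt where "blt \<equiv> split_less r l"
abbreviation X where "X \<equiv> branches r"

text \<open>The locale is self-dual; this is the source of all left-hand versions of the results
  below.\<close>

lemma reverse: "branch_space T r (\<lambda>p a b. l p b a) root"
proof unfold_locales
  fix p assume p: "p \<in> T"
  show "homogeneous (covers r p) (\<lambda>a b. l p b a)"
    using homogeneous_reverse[OF homogeneous_covers[OF p]] .
  show "ord_isomorphic (split_less r (\<lambda>p a b. l p b a)) (cone_at r p) (split_less r (\<lambda>p a b. l p b a)) X"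
    unfolding split_less_reverse[of r l] ord_isomorphic_reverse[of blt _ blt] by (rule cone_iso[OF p])
qed (use root countable_branch in blast)+

lemma covers_linear: "p \<in> T \<Longrightarrow> strict_linear (covers r p) (l p)"
  using homogeneous_covers unfolding homogeneous_def by blast

lemma covers_dense: "p \<in> T \<Longrightarrow> order_dense (covers r p) (l p)"
  using homogeneous_covers unfolding homogeneous_def by blast

lemma blt_cases:
  assumes "x \<in> X" "y \<in> X" "blt x y"
  obtains p a b where "p \<in> x" "p \<in> y" "a \<in> x" "b \<in> y" "a \<in> covers r p" "b \<in> covers r p" "l p a b"
    "a \<noteq> b" "p \<in> T"
proof -
  obtain p a b where *: "p \<in> x" "p \<in> y" "a \<in> x" "b \<in> y" "a \<in> covers r p" "b \<in> covers r p" "l p a b"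
    using assms(3) unfolding split_less_def by blast
  moreover have p: "p \<in> T" using branch_sub[OF assms(1) *(1)] .
  moreover have "a \<noteq> b" using strict_linear.irrefl[OF covers_linear[OF p] *(5)] * by blast
  ultimately show ?thesis using that by blast
qed

lemma bltI: "p \<in> x \<Longrightarrow> p \<in> y \<Longrightarrow> a \<in> x \<Longrightarrow> b \<in> y \<Longrightarrow> a \<in> covers r p \<Longrightarrow> b \<in> covers r p \<Longrightarrow> l p a b \<Longrightarrow> blt x y"
  unfolding split_less_def by blast

sublocale X: strict_linear X blt
proof
  fix x assume x: "x \<in> X"
  show "\<not> blt x x"
  proof
    assume "blt x x"
    then show False using blt_cases[OF x x] cover_unique[OF x] by metis
  qed
next
  fix x y z assume x: "x \<in> X" and y: "y \<in> X" and z: "z \<in> X" and "blt x y" "blt y z"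
  obtain p a b where pab: "p \<in> x" "p \<in> y" "a \<in> x" "b \<in> y" "a \<in> covers r p" "b \<in> covers r p" "l p a b"
    "a \<noteq> b" "p \<in> T" using blt_cases[OF x y \<open>blt x y\<close>] .
  obtain q c d where qcd: "q \<in> y" "q \<in> z" "c \<in> y" "d \<in> z" "c \<in> covers r q" "d \<in> covers r q" "l q c d"
    "c \<noteq> d" "q \<in> T" using blt_cases[OF y z \<open>blt y z\<close>] .
  \<comment> \<open>Both splitting nodes lie on \<open>y\<close>, hence are comparable, and the
    lower one already separates \<open>x\<close> from \<open>z\<close>.\<close>
  consider "p = q" | "(p, q) \<in> r" "p \<noteq> q" | "(q, p) \<in> r" "p \<noteq> q"
    using branch_chain[OF y pab(2) qcd(1)] by blast
  then show "blt x z"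
  proof cases
    case 1
    then have bc: "b = c" using cover_unique[OF y] pab qcd by blast
    have "l p a d"
      using strict_linear.trans[OF covers_linear[OF pab(9)], of a b d] 1 bc pab qcd by blast
    then show ?thesis using bltI[of p x z a d] 1 pab qcd by blast
  next
    case 2
    then have "(b, q) \<in> r" using cover_le[OF y pab(4) qcd(1) pab(6)] by blast
    then have "b \<in> z" "p \<in> z" using branch_down[OF z qcd(2)] 2 by blast+
    then show ?thesis using bltI[of p x z a b] pab by blast
  next
    case 3
    then have "(c, p) \<in> r" using cover_le[OF y qcd(3) pab(2) qcd(5)] by blast
    then have "c \<in> x" "q \<in> x" using branch_down[OF x pab(1)] 3 by blast+
    then show ?thesis using bltI[of q x z c d] qcd by blast
  qed
next
  fix x y assume x: "x \<in> X" and y: "y \<in> X" and "x \<noteq> y"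
  then obtain p a b where *: "p \<in> x" "p \<in> y" "a \<in> x" "a \<in> covers r p" "b \<in> y" "b \<in> covers r p" "a \<noteq> b"
    using branches_split by blast
  have "l p a b \<or> l p b a"
    using strict_linear.total[OF covers_linear[OF branch_sub[OF x *(1)]]] * by blast
  then show "blt x y \<or> blt y x" using bltI * by blast
qed

lemma cone_sub: "cone_at r p \<subseteq> X"
  unfolding cone_at_def by blast

text \<open>\<open>z\<close> splits from \<open>x\<close> strictly below \<open>t\<close>, and up to
  \<open>t\<close> the branches \<open>x\<close> and \<open>y\<close> agree. So a branch outside a
  cone lies on one side of the whole cone.\<close>

lemma cone_less:
  assumes x: "x \<in> X" "t \<in> x" and y: "y \<in> X" "t \<in> y" and z: "z \<in> X" "t \<notin> z" and "blt x z"
  shows "blt y z"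
proof -
  obtain p a b where *: "p \<in> x" "p \<in> z" "a \<in> x" "b \<in> z" "a \<in> covers r p" "b \<in> covers r p" "l p a b"
    using blt_cases[OF x(1) z(1) \<open>blt x z\<close>] by metis
  have "(t, p) \<notin> r" using branch_down[OF z(1) *(2)] z(2) by blast
  then have "(p, t) \<in> r" "p \<noteq> t" using branch_chain[OF x(1) *(1) x(2)] z(2) *(2) by blast+
  then have "(a, t) \<in> r" using cover_le[OF x(1) *(3) x(2) *(5)] by blast
  then have "a \<in> y" "p \<in> y" using branch_down[OF y] \<open>(p, t) \<in> r\<close> by blast+
  then show ?thesis using bltI[of p y z a b] * by blast
qed

lemma cone_greater:
  assumes "x \<in> X" "t \<in> x" "y \<in> X" "t \<in> y" "z \<in> X" "t \<notin> z" and "blt z x"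
  shows "blt z y"
  using branch_space.cone_less[OF reverse, of x t y z] assms unfolding split_less_reverse[of r l] by blast

lemma cones_less: "a \<in> covers r p \<Longrightarrow> b \<in> covers r p \<Longrightarrow> l p a b \<Longrightarrow> set_less blt (cone_at r a) (cone_at r b)"
  using cone_mono[OF coversD(1)[of a p]] cone_mono[OF coversD(1)[of b p]] bltI[of p _ _ a b]
  unfolding set_less_def cone_at_def by blast

lemma root_in: "x \<in> X \<Longrightarrow> root \<in> x"
  using branch_insert root branch_sub by blast

lemma cone_root: "cone_at r root = X"
  unfolding cone_at_def using root_in by blast

section \<open>Copies of the branch space and their sums\<close>

lemma copy_cone: "p \<in> T \<Longrightarrow> is_copy r l (cone_at r p)"
  unfolding is_copy_def using cone_sub cone_iso by blast

lemma copy_iso: "is_copy r l C \<Longrightarrow> is_copy r l D \<Longrightarrow> ord_isomorphic blt C blt D"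
  unfolding is_copy_def using ord_isomorphic_sym ord_isomorphic_trans by metis

lemma iso_copy: "C \<subseteq> X \<Longrightarrow> is_copy r l D \<Longrightarrow> ord_isomorphic blt C blt D \<Longrightarrow> is_copy r l C"
  unfolding is_copy_def using ord_isomorphic_trans by metis

lemma X_nonempty: "X \<noteq> {}"
  using cone_nonempty[OF root(1)] cone_sub by blast

lemma copy_nonempty: "is_copy r l C \<Longrightarrow> C \<noteq> {}"
  using X_nonempty unfolding is_copy_def ord_isomorphic_def bij_betw_def by blast

text \<open>An isomorphism of \<open>I\<close> onto all successors of \<open>p\<close> matches the
  cones over \<open>I\<close> with the cones that make up \<open>cone_at r p\<close>; matched cones
  are both copies.\<close>

lemma copy_covers:
  assumes p: "p \<in> T" and I: "open_convex (covers r p) (l p) I"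
  shows "is_copy r l (\<Union>a\<in>I. cone_at r a)"
proof (rule iso_copy[OF _ copy_cone[OF p]])
  show "(\<Union>a\<in>I. cone_at r a) \<subseteq> X" using cone_sub by blast
  interpret S: strict_linear "covers r p" "l p" using covers_linear[OF p] .
  have IS: "I \<subseteq> covers r p" using I unfolding open_convex_def by blast
  have "ord_isomorphic (l p) I (l p) (covers r p)"
    using homogeneous_covers[OF p] I unfolding homogeneous_def by blast
  then obtain f where f: "bij_betw f I (covers r p)" "\<And>x y. x \<in> I \<Longrightarrow> y \<in> I \<Longrightarrow> l p x y \<longleftrightarrow> l p (f x) (f y)"
    unfolding ord_isomorphic_def by blast
  have fS: "i \<in> I \<Longrightarrow> f i \<in> covers r p" for i using f(1) bij_betwE by blast
  have "ord_isomorphic blt (\<Union>a\<in>I. cone_at r a) blt (\<Union>a\<in>I. cone_at r (f a))"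
  proof (rule ord_isomorphic_UN[where k = "l p"])
    show "l p i j \<or> l p j i" if "i \<in> I" "j \<in> I" "i \<noteq> j" for i j using S.total that IS by blast
    show "set_less blt (cone_at r i) (cone_at r j)" if "i \<in> I" "j \<in> I" "l p i j" for i j
      using cones_less that IS by blast
    show "set_less blt (cone_at r (f i)) (cone_at r (f j))" if "i \<in> I" "j \<in> I" "l p i j" for i j
      using cones_less that fS f(2) by blast
    show "ord_isomorphic blt (cone_at r i) blt (cone_at r (f i))" if "i \<in> I" for i
      using copy_iso copy_cone covers_sub fS that IS by blast
  qed (use X.asym cone_sub in blast)+
  moreover have "(\<Union>a\<in>I. cone_at r (f a)) = cone_at r p"
    using f(1) unfolding cone_covers[of p] bij_betw_def by (metis UN_simps(10))
  ultimately show "ord_isomorphic blt (\<Union>a\<in>I. cone_at r a) blt (cone_at r p)" by simp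
qed

lemma set_less_UN_cones:
  assumes "I \<subseteq> covers r p" "J \<subseteq> covers r p" "set_less (l p) I J"
  shows "set_less blt (\<Union>a\<in>I. cone_at r a) (\<Union>a\<in>J. cone_at r a)"
proof -
  have "set_less blt (cone_at r a) (cone_at r b)" if "a \<in> I" "b \<in> J" for a b
    using cones_less[of a p b] assms that unfolding set_less_def[of "l p"] by blast
  then show ?thesis unfolding set_less_def by blast
qed

text \<open>
  With \<open>s\<close> cofinal in the successors of the root, cutting at the \<open>s n\<close> presents \<open>X\<close> as a sum of
  \<open>\<omega>\<close> copies of itself, the first of which is \<open>(-\<infinity>, s 0)\<close>; without that first copy the sum is
  still of the type \<open>X \<cdot> \<omega>\<close>, but it is also the sum of the cone of \<open>s 0\<close> and of the part above it.
\<close>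
lemma omega_sum:
  obtains B :: "nat \<Rightarrow> 'a set set" and E F
  where "\<And>n. is_copy r l (B n)" "\<And>n. set_less blt (B n) (B (Suc n))" "(\<Union>n. B n) = X"
    "is_copy r l E" "is_copy r l F" "set_less blt E F" "(\<Union>n. B (Suc n)) = E \<union> F"
proof -
  let ?S = "covers r root" and ?l = "l root"
  interpret S: strict_linear ?S ?l using covers_linear[OF root(1)] .
  have dense: "order_dense ?S ?l" using covers_dense[OF root(1)] .
  obtain s :: "nat \<Rightarrow> 'a" where s: "\<And>n. s n \<in> ?S" "\<And>n. ?l (s n) (s (Suc n))"
    and cof: "\<And>x. x \<in> ?S \<Longrightarrow> \<exists>n. ?l x (s n)"
    using homogeneous_imp_cofinal_seq[OF homogeneous_covers[OF root(1)]] by blast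
  \<comment> \<open>Points and open intervals alternate, so that the pieces exhaust everything from
    \<open>s 0\<close> on. \<open>J\<close> puts the ray below \<open>s 0\<close> in front of them,
    and the shift to \<open>Suc n\<close> in the index removes it again.\<close>
  define J' where "J' k = (if even k then {s (k div 2)} else
    {x \<in> ?S. ?l (s (k div 2)) x \<and> ?l x (s (Suc (k div 2)))})" for k
  define J where "J k = (case k of 0 \<Rightarrow> {x \<in> ?S. ?l x (s 0)} | Suc m \<Rightarrow> J' m)" for k
  define B where "B n = (\<Union>a\<in>J n. cone_at r a)" for n
  have J'S: "J' k \<subseteq> ?S" for k unfolding J'_def using s by auto
  have JS: "J k \<subseteq> ?S" for k unfolding J_def using J'S by (auto split: nat.split)
  have J'less: "set_less ?l (J' k) (J' (Suc k))" for k
    unfolding set_less_def J'_def by (auto elim!: oddE evenE)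
  have Jless: "set_less ?l (J k) (J (Suc k))" for k
  proof (cases k)
    case 0
    then show ?thesis unfolding J_def J'_def set_less_def by simp
  next
    case (Suc m)
    then show ?thesis using J'less[of m] unfolding J_def by simp
  qed
  have singleton: "is_copy r l (\<Union>a\<in>{s n}. cone_at r a)" for n
    using copy_cone[OF covers_sub[OF s(1)]] by simp
  have J'is_copy: "is_copy r l (\<Union>a\<in>J' k. cone_at r a)" for k
    unfolding J'_def using singleton copy_covers[OF root(1) S.open_convex_rays(3)[OF dense s(1) s(1) s(2)]]
    by simp
  have Jgood: "is_copy r l (B k)" for k
    unfolding B_def J_def using J'is_copy copy_covers[OF root(1) S.open_convex_rays(2)[OF dense s(1)]]
    by (simp split: nat.split)
  have UJ': "x \<in> (\<Union>k. J' k)" if x: "x \<in> ?S" "x = s 0 \<or> ?l (s 0) x" for x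
  proof -
    \<comment> \<open>The first term beyond \<open>x\<close>. It is not \<open>s 0\<close>, so it
      has a predecessor \<open>s j\<close>, and \<open>x\<close> is \<open>s j\<close> or lies in
      the open interval following it.\<close>
    define n where "n = (LEAST n. ?l x (s n))"
    have n: "?l x (s n)" unfolding n_def using cof[OF x(1)] by (rule LeastI_ex)
    have "n \<noteq> 0" using n x S.irrefl S.asym s(1) by metis
    then obtain j where j: "n = Suc j" by (cases n) auto
    then have "\<not> ?l x (s j)" using not_less_Least[of j "\<lambda>n. ?l x (s n)"] n_def by simp
    then have "x = s j \<or> ?l (s j) x" using S.total x(1) s(1) by blast
    then have "x \<in> J' (2 * j) \<or> x \<in> J' (Suc (2 * j))" using n j x unfolding J'_def by simp
    then show ?thesis by blast
  qed
  have UJ: "(\<Union>k. J k) = ?S"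
  proof
    show "?S \<subseteq> (\<Union>k. J k)"
    proof
      fix x assume x: "x \<in> ?S"
      show "x \<in> (\<Union>k. J k)"
      proof (cases "?l x (s 0)")
        case True
        then have "x \<in> J 0" unfolding J_def using x by simp
        then show ?thesis by blast
      next
        case False
        then obtain k where "x \<in> J' k" using UJ' x S.total s(1) by blast
        then have "x \<in> J (Suc k)" unfolding J_def by simp
        then show ?thesis by blast
      qed
    qed
  qed (use JS in blast)
  have J'sub: "J' k \<subseteq> {s 0} \<union> {x \<in> ?S. ?l (s 0) x}" for k
  proof
    fix x assume x: "x \<in> J' k"
    have le: "s 0 = s n \<or> ?l (s 0) (s n)" for n
      using S.strict_mono_seq[of s 0 n] s by (cases n) auto
    have "x = s (k div 2) \<or> ?l (s (k div 2)) x" using x unfolding J'_def by (auto split: if_splits)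
    then show "x \<in> {s 0} \<union> {x \<in> ?S. ?l (s 0) x}"
      using le[of "k div 2"] S.trans[of "s 0" "s (k div 2)" x] x J'S s(1) by auto
  qed
  have UJ'eq: "(\<Union>k. J' k) = {s 0} \<union> {x \<in> ?S. ?l (s 0) x}"
    using J'sub UJ' s(1) by blast
  let ?E = "\<Union>a\<in>{s 0}. cone_at r a" and ?F = "\<Union>a\<in>{x \<in> ?S. ?l (s 0) x}. cone_at r a"
  have "(\<Union>n. B (Suc n)) = (\<Union>a\<in>(\<Union>k. J' k). cone_at r a)" unfolding B_def J_def by simp
  then have tail: "(\<Union>n. B (Suc n)) = ?E \<union> ?F" unfolding UJ'eq by blast
  have whole: "(\<Union>n. B n) = X"
    using UJ unfolding B_def cone_root[symmetric] cone_covers[of root] by blast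
  have F: "is_copy r l ?F" using copy_covers[OF root(1) S.open_convex_rays(1)[OF dense s(1)]] .
  have EF: "set_less blt ?E ?F"
    by (rule set_less_UN_cones) (use s in \<open>auto simp: set_less_def\<close>)
  have Bless: "set_less blt (B n) (B (Suc n))" for n
    unfolding B_def by (rule set_less_UN_cones[OF JS JS Jless])
  show ?thesis by (rule that[OF Jgood Bless whole singleton F EF tail])
qed

text \<open>By \<open>omega_sum\<close> the space \<open>X\<close> is itself such a sum, and the
  type of the sum is determined by the types of its terms.\<close>

lemma copy_UN:
  fixes A :: "nat \<Rightarrow> 'a set set"
  assumes A: "\<And>n. is_copy r l (A n)" "\<And>n. set_less blt (A n) (A (Suc n))"
  shows "is_copy r l (\<Union>n. A n)"
proof -
  obtain B :: "nat \<Rightarrow> 'a set set" and E F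
    where B: "\<And>n. is_copy r l (B n)" "\<And>n. set_less blt (B n) (B (Suc n))" "(\<Union>n. B n) = X"
      and "is_copy r l E" "is_copy r l F" "set_less blt E F" "(\<Union>n. B (Suc n)) = E \<union> F"
    by (rule omega_sum) (rule that)
  have sub: "is_copy r l C \<Longrightarrow> C \<subseteq> X" for C unfolding is_copy_def by blast
  have "ord_isomorphic blt (\<Union>n. A n) blt (\<Union>n. B n)"
    by (rule X.ord_isomorphic_chain_UN)
      (rule sub copy_nonempty copy_iso A B(1,2))+
  then show ?thesis unfolding is_copy_def B(3) using A(1) sub by blast
qed

text \<open>The tail of the decomposition of \<open>X\<close> is a copy, being an
  \<open>\<omega>\<close>-sum of copies, and it is also the sum of the two copies \<open>E\<close>
  and \<open>F\<close>.\<close>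

lemma copy_Un:
  assumes "is_copy r l C" "is_copy r l D" "set_less blt C D" shows "is_copy r l (C \<union> D)"
proof -
  obtain B :: "nat \<Rightarrow> 'a set set" and E F
    where B: "\<And>n. is_copy r l (B n)" "\<And>n. set_less blt (B n) (B (Suc n))" "(\<Union>n. B n) = X"
      and E: "is_copy r l E" "is_copy r l F" "set_less blt E F" "(\<Union>n. B (Suc n)) = E \<union> F"
    by (rule omega_sum) (rule that)
  have EF: "is_copy r l (E \<union> F)" using copy_UN[of "\<lambda>n. B (Suc n)"] B E(4) by simp
  have sub: "is_copy r l C \<Longrightarrow> C \<subseteq> X" for C unfolding is_copy_def by blast
  have "ord_isomorphic blt (C \<union> D) blt (E \<union> F)"
    by (rule X.ord_isomorphic_Un_subset[OF sub[OF assms(1)] sub[OF assms(2)] sub[OF E(1)] sub[OF E(2)]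
          assms(3) E(3) copy_iso[OF assms(1) E(1)] copy_iso[OF assms(2) E(2)]])
  moreover have "C \<union> D \<subseteq> X" using sub[OF assms(1)] sub[OF assms(2)] by (rule Un_least)
  ultimately show ?thesis using iso_copy[OF _ EF] by simp
qed

lemma copy_UN_down:
  fixes A :: "nat \<Rightarrow> 'a set set"
  assumes A: "\<And>n. is_copy r l (A n)" "\<And>n. set_less blt (A (Suc n)) (A n)"
  shows "is_copy r l (\<Union>n. A n)"
  using branch_space.copy_UN[OF reverse, of A] A
  unfolding split_less_reverse[of r l] copy_reverse[of r l] set_less_reverse[of blt] .

section \<open>Open intervals of the branch space are copies\<close>

lemma branch_strict_linear: "x \<in> X \<Longrightarrow> strict_linear x (strict_of r)"
  unfolding strict_of_def
  by unfold_locales (use r_trans r_antisym branch_chain in blast)+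

text \<open>Countability of branches enters here: every part of a branch without a last node is
  reached by a sequence of nodes of type \<open>\<omega>\<close>.\<close>

lemma cofinal_nodes:
  assumes z: "z \<in> X" and Q: "Q \<subseteq> z" "t \<in> Q" and nomax: "\<And>c. c \<in> Q \<Longrightarrow> \<exists>d\<in>Q. (c, d) \<in> r \<and> c \<noteq> d"
  obtains q :: "nat \<Rightarrow> 'a" where "q 0 = t" "\<And>n. q n \<in> Q" "\<And>n. (q n, q (Suc n)) \<in> r" "\<And>n. q n \<noteq> q (Suc n)"
    "\<And>c. c \<in> Q \<Longrightarrow> \<exists>n. (c, q n) \<in> r"
proof -
  interpret z: strict_linear z "strict_of r" using branch_strict_linear[OF z] .
  have "countable Q" using countable_branch[OF z] Q(1) countable_subset by blast
  then have "\<exists>w :: nat \<Rightarrow> 'a. w 0 = t \<and> (\<forall>n. w n \<in> Q) \<and> (\<forall>n. strict_of r (w n) (w (Suc n))) \<and>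
      (\<forall>x\<in>Q. \<exists>n. strict_of r x (w n))"
    by (rule z.countable_cofinal_seq) (use Q nomax in \<open>auto simp: strict_of_def\<close>)
  then obtain w :: "nat \<Rightarrow> 'a" where w: "w 0 = t" "\<forall>n. w n \<in> Q" "\<forall>n. strict_of r (w n) (w (Suc n))"
      "\<forall>x\<in>Q. \<exists>n. strict_of r x (w n)" by (elim exE conjE)
  show ?thesis by (rule that[of w]) (use w in \<open>auto simp: strict_of_def\<close>)
qed

text \<open>A branch that leaves \<open>z\<close> later is nearer to \<open>z\<close>. The
  departures between \<open>q n\<close> and \<open>q (Suc n)\<close> therefore form a descending
  sequence of copies.\<close>

lemma copy_above_limit:
  fixes q :: "nat \<Rightarrow> 'a"
  assumes z: "z \<in> X" and q: "\<And>n. q n \<in> z" "\<And>n. (q n, q (Suc n)) \<in> r"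
    and is_copy: "\<And>n. is_copy r l {y \<in> X. q n \<in> y \<and> q (Suc n) \<notin> y \<and> blt z y}"
  shows "is_copy r l {y \<in> X. q 0 \<in> y \<and> (\<exists>n. q n \<notin> y) \<and> blt z y}"
proof -
  let ?A = "\<lambda>n. {y \<in> X. q n \<in> y \<and> q (Suc n) \<notin> y \<and> blt z y}"
  have less: "set_less blt (?A (Suc n)) (?A n)" for n
    unfolding set_less_def using cone_less[OF z q(1)] by blast
  have le: "(q 0, q n) \<in> r" for n
  proof (induction n)
    case 0 show ?case using q(2) r_sub r_refl by blast
  next
    case (Suc n) then show ?case using q(2) r_trans by blast
  qed
  have "y \<in> (\<Union>n. ?A n)" if y: "y \<in> X" "q 0 \<in> y" "q n \<notin> y" "blt z y" for y n
  proof -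
    define m where "m = (LEAST n. q n \<notin> y)"
    have m: "q m \<notin> y" unfolding m_def using y(3) by (rule LeastI)
    obtain k where k: "m = Suc k" using m y(2) by (cases m) auto
    then have "q k \<in> y" using not_less_Least[of k "\<lambda>n. q n \<notin> y"] m_def by simp
    then show ?thesis using y m k by blast
  qed
  moreover have "(\<Union>n. ?A n) \<subseteq> {y \<in> X. q 0 \<in> y \<and> (\<exists>n. q n \<notin> y) \<and> blt z y}"
    using branch_down le by blast
  ultimately have eq: "{y \<in> X. q 0 \<in> y \<and> (\<exists>n. q n \<notin> y) \<and> blt z y} = (\<Union>n. ?A n)" by blast
  show ?thesis unfolding eq by (rule copy_UN_down[of ?A]) (rule is_copy less)+
qed

lemma covers_mem_cases:
  assumes "z \<in> X" "a \<in> z" "a \<in> covers r p" "y \<in> X" "p \<in> y" "a \<notin> y" "blt z y"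
  shows "\<exists>b\<in>y. b \<in> covers r p \<and> l p a b"
proof -
  obtain b where b: "b \<in> y" "b \<in> covers r p" using branch_next[OF assms(4,5)] by blast
  have p: "p \<in> T" "p \<in> z" using branch_sub assms(4,5) branch_down[OF assms(1,2)] coversD(1)[OF assms(3)] by blast+
  have "a \<noteq> b" using b assms by blast
  moreover have "\<not> l p b a" using bltI[of p y z b a] X.asym[of z y] b p assms by blast
  ultimately show ?thesis using strict_linear.total[OF covers_linear[OF p(1)] assms(3) b(2)] b by blast
qed

text \<open>The branches in question leave \<open>z\<close> upwards at a node from \<open>t\<close>
  on and before \<open>p\<close>. The induction treats all \<open>t\<close> at once, because at a
  limit it is applied between consecutive terms of a cofinal sequence. If \<open>p\<close> covers
  \<open>c\<close>, the departures at \<open>c\<close> itself form cones over an open ray of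
  successors of \<open>c\<close>.\<close>

lemma copy_above:
  assumes z: "z \<in> X"
  shows "p \<in> z \<Longrightarrow> (t, p) \<in> r \<Longrightarrow> t \<noteq> p \<Longrightarrow> is_copy r l {y \<in> X. t \<in> y \<and> p \<notin> y \<and> blt z y}"
proof (induction p arbitrary: t rule: wf_induct_rule[OF wf])
  case (1 p)
  note p = \<open>p \<in> z\<close> and tp = \<open>(t, p) \<in> r\<close> \<open>t \<noteq> p\<close>
  have IH: "is_copy r l {y \<in> X. t' \<in> y \<and> q \<notin> y \<and> blt z y}"
    if "(q, p) \<in> r" "q \<noteq> p" "(t', q) \<in> r" "t' \<noteq> q" for t' q
    using 1(1)[of q t'] that branch_down[OF z p] by blast
  have tz: "t \<in> z" using branch_down[OF z p] tp by blast
  show ?case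
  proof (cases "\<forall>c\<in>underS r p. \<exists>d\<in>underS r p. (c, d) \<in> r \<and> c \<noteq> d")
    case True
    have "underS r p \<subseteq> z" "t \<in> underS r p" using branch_down[OF z p] tp unfolding underS_def by blast+
    then obtain q :: "nat \<Rightarrow> 'a" where q: "q 0 = t" "\<And>n. q n \<in> underS r p" "\<And>n. (q n, q (Suc n)) \<in> r"
      "\<And>n. q n \<noteq> q (Suc n)" "\<And>c. c \<in> underS r p \<Longrightarrow> \<exists>n. (c, q n) \<in> r"
      by (rule cofinal_nodes[OF z]) (use True in blast, rule that)
    have lt: "(q n, p) \<in> r" "q n \<noteq> p" for n using q(2) unfolding underS_def by blast+
    have "is_copy r l {y \<in> X. q 0 \<in> y \<and> (\<exists>n. q n \<notin> y) \<and> blt z y}"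
    proof (rule copy_above_limit[of z q, OF z])
      fix n
      show "q n \<in> z" using branch_down[OF z p] lt by blast
      show "(q n, q (Suc n)) \<in> r" using q(3) .
      show "is_copy r l {y \<in> X. q n \<in> y \<and> q (Suc n) \<notin> y \<and> blt z y}" using IH lt q(3,4) by blast
    qed
    \<comment> \<open>A branch containing all predecessors of \<open>p\<close> contains
      \<open>p\<close>: its next node has the same predecessors, and \<open>p\<close> is at a limit
      level.\<close>
    moreover have "(\<exists>n. q n \<notin> y) \<longleftrightarrow> p \<notin> y" if y: "y \<in> X" for y
    proof
      show "p \<notin> y" if "\<exists>n. q n \<notin> y" using branch_down[OF y] lt(1) that by blast
    next
      assume py: "p \<notin> y"
      show "\<exists>n. q n \<notin> y"
      proof (rule ccontr)
        assume "\<not> ?thesis"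
        then have sub: "underS r p \<subseteq> y" using q(5) branch_down[OF y] by blast
        have "y \<noteq> underS r p"
          using branch_insert[OF y, of p] branch_sub[OF z p] py unfolding underS_def by blast
        then obtain b where b: "b \<in> y" "underS r b = underS r p"
          using node_after[OF y sub] r_trans r_antisym unfolding underS_def by blast
        have "p = b"
          by (rule limit_unique) (use b True branch_sub[OF z p] branch_sub[OF y b(1)] in auto)
        then show False using b py by blast
      qed
    qed
    ultimately show ?thesis unfolding q(1) by (simp cong: conj_cong)
  next
    case False
    then obtain c where c: "c \<in> underS r p" "\<And>d. d \<in> underS r p \<Longrightarrow> (c, d) \<in> r \<Longrightarrow> c = d" by blast
    have pc: "p \<in> covers r c" by (rule max_underS_covers[OF c])
    have cz: "c \<in> z" "c \<in> T" using c(1) branch_down[OF z p] r_sub unfolding underS_def by blast+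
    let ?I = "{b \<in> covers r c. l c p b}"
    have I: "open_convex (covers r c) (l c) ?I"
      by (rule strict_linear.open_convex_rays(1)[OF covers_linear[OF cz(2)] covers_dense[OF cz(2)] pc])
    have eq: "{y \<in> X. c \<in> y \<and> p \<notin> y \<and> blt z y} = (\<Union>b\<in>?I. cone_at r b)"
    proof (intro equalityI subsetI)
      fix y assume "y \<in> {y \<in> X. c \<in> y \<and> p \<notin> y \<and> blt z y}"
      then show "y \<in> (\<Union>b\<in>?I. cone_at r b)"
        using covers_mem_cases[OF z p pc, of y] unfolding cone_at_def by blast
    next
      fix y assume "y \<in> (\<Union>b\<in>?I. cone_at r b)"
      then obtain b where b: "y \<in> X" "b \<in> y" "b \<in> covers r c" "l c p b" unfolding cone_at_def by blast
      have cy: "c \<in> y" using branch_down[OF b(1,2)] coversD(1)[OF b(3)] by blast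
      have "p \<noteq> b" using strict_linear.irrefl[OF covers_linear[OF cz(2)] pc] b(4) by blast
      then have "p \<notin> y" using cover_unique[OF b(1) _ b(2) pc b(3)] by blast
      then show "y \<in> {y \<in> X. c \<in> y \<and> p \<notin> y \<and> blt z y}"
        using b cy bltI[OF cz(1) cy p b(2) pc b(3,4)] by blast
    qed
    have top: "is_copy r l {y \<in> X. c \<in> y \<and> p \<notin> y \<and> blt z y}"
      unfolding eq by (rule copy_covers[OF cz(2) I])
    show ?thesis
    proof (cases "t = c")
      case True then show ?thesis using top by simp
    next
      case False
      have tc: "(t, c) \<in> r" using coversD(3)[OF pc, of t] branch_chain[OF z tz cz(1)] tp False by blast
      have cp: "(c, p) \<in> r" "c \<noteq> p" using coversD[OF pc] by blast+
      have low: "is_copy r l {y \<in> X. t \<in> y \<and> c \<notin> y \<and> blt z y}" using IH cp tc False by blast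
      \<comment> \<open>The later departures come first in the order.\<close>
      have less: "set_less blt {y \<in> X. c \<in> y \<and> p \<notin> y \<and> blt z y} {y \<in> X. t \<in> y \<and> c \<notin> y \<and> blt z y}"
        unfolding set_less_def using cone_less[OF z cz(1)] by blast
      have split: "{y \<in> X. t \<in> y \<and> p \<notin> y \<and> blt z y} =
          {y \<in> X. c \<in> y \<and> p \<notin> y \<and> blt z y} \<union> {y \<in> X. t \<in> y \<and> c \<notin> y \<and> blt z y}"
      proof -
        have "t \<in> y" if "y \<in> X" "c \<in> y" for y using branch_down that tc by blast
        moreover have "p \<notin> y" if "y \<in> X" "c \<notin> y" for y using branch_down that cp by blast
        ultimately show ?thesis by blast
      qed
      show ?thesis unfolding split by (rule copy_Un[OF top low less])
    qed
  qed
qed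

text \<open>The limit argument of \<open>copy_above\<close>, carried out at the end of
  \<open>z\<close>: there is no last node, and a branch other than \<open>z\<close> misses some term
  of a cofinal sequence of nodes.\<close>

lemma copy_right_of:
  assumes z: "z \<in> X" and t: "t \<in> z" shows "is_copy r l {y \<in> X. t \<in> y \<and> blt z y}"
proof -
  let ?Q = "{q \<in> z. (t, q) \<in> r}"
  have tQ: "t \<in> ?Q" using t r_refl branch_sub[OF z t] by blast
  have "\<exists>d\<in>?Q. (c, d) \<in> r \<and> c \<noteq> d" if c: "c \<in> ?Q" for c
    using branch_next[OF z, of c] c coversD(1,2) r_trans by blast
  then obtain q :: "nat \<Rightarrow> 'a" where q: "q 0 = t" "\<And>n. q n \<in> ?Q" "\<And>n. (q n, q (Suc n)) \<in> r"
      "\<And>n. q n \<noteq> q (Suc n)" "\<And>c. c \<in> ?Q \<Longrightarrow> \<exists>n. (c, q n) \<in> r"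
    using cofinal_nodes[OF z _ tQ] by blast
  have "is_copy r l {y \<in> X. q 0 \<in> y \<and> (\<exists>n. q n \<notin> y) \<and> blt z y}"
  proof (rule copy_above_limit[of z q, OF z])
    fix n
    show "q n \<in> z" using q(2) by blast
    show "(q n, q (Suc n)) \<in> r" using q(3) .
    show "is_copy r l {y \<in> X. q n \<in> y \<and> q (Suc n) \<notin> y \<and> blt z y}"
      using copy_above[OF z _ q(3,4)] q(2) by blast
  qed
  moreover have "\<exists>n. q n \<notin> y" if y: "y \<in> X" "blt z y" for y
  proof (rule ccontr)
    assume "\<not> ?thesis"
    then have all: "\<And>n. q n \<in> y" by blast
    have "c \<in> y" if c: "c \<in> z" for c
    proof (cases "(t, c) \<in> r")
      case True
      then show ?thesis using q(5)[of c] c branch_down[OF y(1)] all by blast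
    next
      case False
      then show ?thesis using branch_chain[OF z t c] branch_down[OF y(1) all[of 0]] q(1) by blast
    qed
    then show False using branch_maximal[OF z y(1)] y X.irrefl[OF z] by blast
  qed
  then have "{y \<in> X. t \<in> y \<and> (\<exists>n. q n \<notin> y) \<and> blt z y} = {y \<in> X. t \<in> y \<and> blt z y}"
    by blast
  ultimately show ?thesis unfolding q(1) by metis
qed

lemma copy_left_of:
  assumes "z \<in> X" "t \<in> z" shows "is_copy r l {y \<in> X. t \<in> y \<and> blt y z}"
  using branch_space.copy_right_of[OF reverse assms]
  unfolding split_less_reverse[of r l] copy_reverse[of r l] .

lemma copy_between:
  assumes z: "z \<in> X" and w: "w \<in> X" and "blt z w"
  shows "is_copy r l {y \<in> X. blt z y \<and> blt y w}"
proof -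
  obtain p a b where pab: "p \<in> z" "p \<in> w" "a \<in> z" "b \<in> w" "a \<in> covers r p" "b \<in> covers r p" "l p a b"
    "a \<noteq> b" "p \<in> T" using blt_cases[OF z w \<open>blt z w\<close>] .
  interpret S: strict_linear "covers r p" "l p" using covers_linear[OF pab(9)] .
  interpret rev: branch_space T r "\<lambda>p a b. l p b a" root by (rule reverse)
  let ?L = "{y \<in> X. a \<in> y \<and> blt z y}" and ?R = "{y \<in> X. b \<in> y \<and> blt y w}"
  let ?I = "{c \<in> covers r p. l p a c \<and> l p c b}" let ?M = "\<Union>c\<in>?I. cone_at r c"
  have M: "is_copy r l ?M"
    by (rule copy_covers[OF pab(9) S.open_convex_rays(3)[OF covers_dense[OF pab(9)] pab(5,6,7)]])
  have acone: "set_less blt (cone_at r a) (cone_at r b)" by (rule cones_less[OF pab(5,6,7)])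
  have LM: "set_less blt (cone_at r a) ?M" "set_less blt ?M (cone_at r b)"
    using cones_less[of _ p] pab unfolding set_less_def by blast+
  have LR: "?L \<subseteq> cone_at r a" "?R \<subseteq> cone_at r b" unfolding cone_at_def by blast+
  have zw: "z \<in> cone_at r a" "w \<in> cone_at r b" unfolding cone_at_def using z w pab by blast+
  have "is_copy r l (?L \<union> (?M \<union> ?R))"
  proof (intro copy_Un copy_right_of copy_left_of M z w pab)
    show "set_less blt ?M ?R" by (rule set_less_mono[OF LM(2) subset_refl LR(2)])
    show "set_less blt ?L (?M \<union> ?R)"
      by (intro set_less_Un_right set_less_mono[OF LM(1) LR(1) subset_refl] set_less_mono[OF acone LR])
  qed
  moreover have "{y \<in> X. blt z y \<and> blt y w} = ?L \<union> (?M \<union> ?R)"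
  proof (intro equalityI subsetI)
    fix y assume y: "y \<in> {y \<in> X. blt z y \<and> blt y w}"
    have py: "p \<in> y" using cone_less[OF z pab(1) w pab(2), of y] y X.asym w by blast
    show "y \<in> ?L \<union> (?M \<union> ?R)"
    proof (cases "a \<in> y \<or> b \<in> y")
      case False
      obtain c where c: "c \<in> y" "c \<in> covers r p" "l p a c"
        using covers_mem_cases[OF z pab(3,5), of y] y py False by blast
      obtain d where d: "d \<in> y" "d \<in> covers r p" "l p d b"
        using rev.covers_mem_cases[OF w pab(4,6), of y] y py False
        unfolding split_less_reverse[of r l] by blast
      \<comment> \<open>The successor of \<open>p\<close> on \<open>y\<close> is found beyond
        \<open>a\<close> by one argument and before \<open>b\<close> by its mirror image.\<close>
      have "c = d" using cover_unique[OF _ c(1) d(1) c(2) d(2)] y by blast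
      then show ?thesis using c d y unfolding cone_at_def by blast
    qed (use y in blast)
  next
    have "?M \<subseteq> {y \<in> X. blt z y \<and> blt y w}"
      using cone_sub LM zw unfolding set_less_def by blast
    moreover have "?L \<subseteq> {y \<in> X. blt z y \<and> blt y w}" "?R \<subseteq> {y \<in> X. blt z y \<and> blt y w}"
      using acone LR zw unfolding set_less_def by blast+
    moreover fix y assume "y \<in> ?L \<union> (?M \<union> ?R)"
    ultimately show "y \<in> {y \<in> X. blt z y \<and> blt y w}" by blast
  qed
  ultimately show ?thesis by metis
qed

section \<open>Countable cofinality of sets of branches\<close>

lemma cone_countable_cofinal:
  assumes p: "p \<in> T"
  shows "\<exists>B. countable B \<and> B \<subseteq> cone_at r p \<and> (\<forall>x\<in>cone_at r p. \<exists>b\<in>B. blt x b)"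
proof -
  obtain s :: "nat \<Rightarrow> 'a" where s: "\<And>n. s n \<in> covers r p"
    and cof: "\<And>x. x \<in> covers r p \<Longrightarrow> \<exists>n. l p x (s n)"
    using homogeneous_imp_cofinal_seq[OF homogeneous_covers[OF p]] by blast
  have "\<forall>n. \<exists>y. y \<in> cone_at r (s n)" using cone_nonempty covers_sub s by blast
  then obtain y where y: "\<And>n. y n \<in> cone_at r (s n)" by metis
  have "\<exists>b\<in>range y. blt x b" if x: "x \<in> cone_at r p" for x
  proof -
    obtain a where a: "a \<in> covers r p" "x \<in> cone_at r a" using x cone_covers by blast
    obtain n where "l p a (s n)" using cof[OF a(1)] by blast
    then have "blt x (y n)" using cones_less[OF a(1) s[of n]] a(2) y unfolding set_less_def by blast
    then show ?thesis by blast
  qed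
  moreover have "range y \<subseteq> cone_at r p" using y s cone_covers by blast
  ultimately show ?thesis by (intro exI[of _ "range y"]) simp
qed

text \<open>\<open>P\<close> below is the path towards the supremum of \<open>D\<close>, possibly a
  gap. Either the members of \<open>D\<close> leave this path cofinally, or from some point on they
  all follow it to its end; then the question is settled among the nodes immediately after
  it.\<close>

lemma countable_cofinal:
  assumes D: "D \<subseteq> X" "D \<noteq> {}" and nomax: "\<And>x. x \<in> D \<Longrightarrow> \<exists>y\<in>D. blt x y"
  shows "\<exists>B. countable B \<and> B \<subseteq> D \<and> (\<forall>x\<in>D. \<exists>b\<in>B. x = b \<or> blt x b)"
proof -
  define U where "U = {u \<in> X. \<forall>d\<in>D. blt d u}"
  \<comment> \<open>Two relaxations. \<open>B\<close> may leave \<open>D\<close>, since a branch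
    outside \<open>U\<close> is at most some member of \<open>D\<close>; and it has to dominate only
    the members from \<open>w0\<close> on.\<close>
  have reduce: ?thesis
    if B: "countable B" "B \<subseteq> X" "B \<inter> U = {}" and w0: "w0 \<in> D"
      and cof: "\<And>x. x \<in> D \<Longrightarrow> x = w0 \<or> blt w0 x \<Longrightarrow> \<exists>b\<in>B. blt x b" for B w0
  proof -
    have "\<forall>b\<in>B. \<exists>d. d \<in> D \<and> (b = d \<or> blt b d)"
      using B(2,3) X.total D(1) unfolding U_def by blast
    then obtain f where f: "\<And>b. b \<in> B \<Longrightarrow> f b \<in> D" "\<And>b. b \<in> B \<Longrightarrow> b = f b \<or> blt b (f b)"
      by metis
    have up: "\<exists>b\<in>f ` B. blt x b" if x: "x \<in> D" "x = w0 \<or> blt w0 x" for x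
    proof -
      obtain b where b: "b \<in> B" "blt x b" using cof[OF x] by blast
      then have "blt x (f b)" using f[OF b(1)] X.trans[of x b "f b"] x D(1) B(2) by (metis subsetD)
      then show ?thesis using b by blast
    qed
    have "\<exists>b\<in>f ` B. x = b \<or> blt x b" if x: "x \<in> D" for x
    proof (cases "x = w0 \<or> blt w0 x")
      case True then show ?thesis using up x by blast
    next
      case False
      then have "blt x w0" using X.total x w0 D(1) by blast
      moreover obtain b where "b \<in> f ` B" "blt w0 b" using up w0 by blast
      ultimately show ?thesis using X.trans[of x w0 b] x w0 D(1) f(1) by blast
    qed
    then show ?thesis using B(1) f(1) by (intro exI[of _ "f ` B"]) auto
  qed
  \<comment> \<open>Nodes that do not yet separate \<open>D\<close> from its strict upper bounds. If
    \<open>D\<close> is unbounded, \<open>U\<close> and hence \<open>P\<close> are empty.\<close>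
  define P where "P = {c \<in> T. cone_at r c \<inter> D \<noteq> {} \<and> cone_at r c \<inter> U \<noteq> {}}"
  \<comment> \<open>\<open>w\<close> lies below an upper bound \<open>u\<close> in the cone, and it
    lies on one side of the whole cone.\<close>
  have star: "blt w y" if w: "w \<in> D" "c \<in> P" "c \<notin> w" "y \<in> cone_at r c" for w c y
  proof -
    obtain u where "u \<in> cone_at r c" "u \<in> U" using w(2) P_def by blast
    then show ?thesis using cone_greater[of u c y w] w D(1) unfolding U_def cone_at_def by blast
  qed
  \<comment> \<open>For incomparable nodes, members of \<open>D\<close> through them would each lie
    below the other.\<close>
  have comparable: "(c, c') \<in> r \<or> (c', c) \<in> r" if c: "c \<in> P" "c' \<in> P" for c c'
  proof (rule ccontr)
    assume neg: "\<not> ?thesis"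
    obtain d d' where d: "d \<in> cone_at r c" "d \<in> D" "d' \<in> cone_at r c'" "d' \<in> D"
      using c P_def by blast
    have "c' \<notin> d" "c \<notin> d'" using d branch_chain neg unfolding cone_at_def by blast+
    then have "blt d d'" "blt d' d" using star c d by blast+
    then show False using X.asym d D(1) by blast
  qed
  obtain x where "x \<in> X" "P \<subseteq> x" using chain_extends[of P] comparable by blast
  then have countableP: "countable P" using countable_branch countable_subset by blast
  have P_down: "\<forall>q\<in>P. \<forall>c. (c, q) \<in> r \<longrightarrow> c \<in> P"
    using cone_mono r_sub unfolding P_def by blast
  show ?thesis
  proof (cases "\<exists>w0\<in>D. P \<subseteq> w0")
    case False
    \<comment> \<open>Every member of \<open>D\<close> misses some \<open>c\<close> in
      \<open>P\<close> and then lies below \<open>y c\<close>, so one member of \<open>D\<close> for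
      each node of \<open>P\<close> suffices.\<close>
    have "\<forall>c\<in>P. \<exists>y. y \<in> cone_at r c \<and> y \<in> D" unfolding P_def by blast
    then obtain y where y: "\<And>c. c \<in> P \<Longrightarrow> y c \<in> cone_at r c" "\<And>c. c \<in> P \<Longrightarrow> y c \<in> D" by metis
    obtain w0 where w0: "w0 \<in> D" using D(2) by blast
    show ?thesis
    proof (rule reduce[OF _ _ _ w0])
      show "countable (y ` P)" using countableP by simp
      show "y ` P \<subseteq> X" using y D(1) by blast
      show "y ` P \<inter> U = {}" using y X.irrefl D(1) unfolding U_def by blast
      fix x assume x: "x \<in> D"
      then obtain c where c: "c \<in> P" "c \<notin> x" using False by blast
      then show "\<exists>b\<in>y ` P. blt x b" using star[OF x c y(1)[OF c(1)]] by blast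
    qed
  next
    case True
    then obtain w0 where w0: "w0 \<in> D" "P \<subseteq> w0" by blast
    define D' where "D' = {w \<in> D. w = w0 \<or> blt w0 w}"
    have w0D': "w0 \<in> D'" using w0 D'_def by blast
    have PD': "P \<subseteq> w" if w: "w \<in> D'" for w
    proof
      fix c assume c: "c \<in> P"
      show "c \<in> w"
      proof (rule ccontr)
        assume "c \<notin> w"
        then have "blt w w0" using star[of w c w0] w c w0 D(1) unfolding D'_def cone_at_def by blast
        then show False using w w0(1) X.asym X.irrefl D(1) unfolding D'_def by blast
      qed
    qed
    \<comment> \<open>Otherwise a larger member of \<open>D\<close>, which also contains
      \<open>P\<close>, would contain the branch \<open>w\<close> and thus equal it.\<close>
    have Pne: "P \<noteq> w" if w: "w \<in> D'" for w
    proof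
      assume Pw: "P = w"
      obtain v where v: "v \<in> D" "blt w v" using nomax w D'_def by blast
      have "v \<in> D'" using v w w0(1) X.trans[of w0 w v] D(1) unfolding D'_def by blast
      then have "w \<subseteq> v" using PD' Pw by blast
      then have "w = v" using branch_maximal v w D(1) unfolding D'_def by blast
      then show False using v X.irrefl D(1) by blast
    qed
    \<comment> \<open>\<open>nd w\<close> is the first node of \<open>w\<close> after
      \<open>P\<close>. Its cone meets \<open>D\<close>, and since the node is not in
      \<open>P\<close> the cone misses \<open>U\<close>; so every branch in it is admissible for
      \<open>reduce\<close>.\<close>
    have "\<forall>w\<in>D'. \<exists>p\<in>w. p \<notin> P \<and> underS r p = P"
      using node_after[OF _ PD' Pne P_down] D(1) unfolding D'_def by blast
    then obtain nd where nd: "\<And>w. w \<in> D' \<Longrightarrow> nd w \<in> w" "\<And>w. w \<in> D' \<Longrightarrow> nd w \<notin> P"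
      "\<And>w. w \<in> D' \<Longrightarrow> underS r (nd w) = P" by metis
    have D'X: "w \<in> X" if "w \<in> D'" for w using that D(1) D'_def by blast
    have ndT: "nd w \<in> T" if "w \<in> D'" for w using branch_sub[OF D'X nd(1)] that by blast
    have ndU: "cone_at r (nd w) \<inter> U = {}" if w: "w \<in> D'" for w
    proof -
      have "w \<in> cone_at r (nd w) \<inter> D" using w nd(1) D'X unfolding cone_at_def D'_def by blast
      then show ?thesis using nd(2)[OF w] ndT[OF w] unfolding P_def by blast
    qed
    \<comment> \<open>If the cone of \<open>nd m\<close> comes last, a countable cofinal set of this
      cone does it, although it need not lie in \<open>D\<close>.\<close>
    have cone_case: ?thesis
      if m: "m \<in> D'" and le: "\<And>w. w \<in> D' \<Longrightarrow> nd w = nd m \<or> set_less blt (cone_at r (nd w)) (cone_at r (nd m))" for m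
    proof -
      obtain B where B: "countable B" "B \<subseteq> cone_at r (nd m)" "\<And>x. x \<in> cone_at r (nd m) \<Longrightarrow> \<exists>b\<in>B. blt x b"
        using cone_countable_cofinal[OF ndT[OF m]] by blast
      show ?thesis
      proof (rule reduce[OF B(1) _ _ w0(1)])
        show "B \<subseteq> X" using B(2) cone_sub by blast
        show "B \<inter> U = {}" using B(2) ndU[OF m] by blast
        fix x assume "x \<in> D" "x = w0 \<or> blt w0 x"
        then have x: "x \<in> D'" unfolding D'_def by blast
        have xc: "x \<in> cone_at r (nd x)" using x nd(1) D'X unfolding cone_at_def by blast
        have mc: "m \<in> cone_at r (nd m)" using m nd(1) D'X unfolding cone_at_def by blast
        show "\<exists>b\<in>B. blt x b"
        proof (cases "nd x = nd m")
          case True then show ?thesis using B(3) xc by simp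
        next
          case False
          then have "\<forall>b\<in>B. blt x b" using le[OF x] xc B(2) unfolding set_less_def by blast
          then show ?thesis using B(3)[OF mc] by blast
        qed
      qed
    qed
    show ?thesis
    proof (cases "\<forall>c\<in>P. \<exists>d\<in>P. (c, d) \<in> r \<and> c \<noteq> d")
      case True
      \<comment> \<open>Only one node has the predecessor set \<open>P\<close> when \<open>P\<close>
        has no greatest element; for empty \<open>P\<close> it is the root.\<close>
      have "nd w = nd w0" if w: "w \<in> D'" for w
        by (rule limit_unique) (use ndT[OF w] ndT[OF w0D'] nd(3)[OF w] nd(3)[OF w0D'] True in auto)
      then show ?thesis using cone_case[OF w0D'] by blast
    next
      case False
      then obtain c where c: "c \<in> P" "\<And>d. d \<in> P \<Longrightarrow> (c, d) \<in> r \<Longrightarrow> c = d" by blast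
      have cT: "c \<in> T" using c P_def by blast
      have ndc: "nd w \<in> covers r c" if w: "w \<in> D'" for w
        by (rule max_underS_covers) (use c nd(3)[OF w] in auto)
      interpret S: strict_linear "covers r c" "l c" using covers_linear[OF cT] .
      show ?thesis
      proof (cases "\<exists>m\<in>D'. \<forall>w\<in>D'. \<not> l c (nd m) (nd w)")
        case True
        then obtain m where m: "m \<in> D'" "\<forall>w\<in>D'. \<not> l c (nd m) (nd w)" by blast
        show ?thesis
        proof (rule cone_case[OF m(1)])
          fix w assume w: "w \<in> D'"
          have "nd w = nd m \<or> l c (nd w) (nd m)" using S.total[OF ndc ndc] m w by blast
          then show "nd w = nd m \<or> set_less blt (cone_at r (nd w)) (cone_at r (nd m))"
            using cones_less[OF ndc ndc] m(1) w by blast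
        qed
      next
        case False
        \<comment> \<open>Here the nodes \<open>nd w\<close> are successors of \<open>c\<close>
          without a greatest one, and homogeneity at \<open>c\<close> bounds their
          cofinality.\<close>
        have "\<exists>B. countable B \<and> B \<subseteq> nd ` D' \<and> (\<forall>x\<in>nd ` D'. \<exists>b\<in>B. l c x b)"
          by (rule homogeneous_subset_countable_cofinal[OF homogeneous_covers[OF cT]])
            (use ndc w0D' False in blast)+
        then obtain B where B: "countable B" "B \<subseteq> nd ` D'" "\<forall>x\<in>nd ` D'. \<exists>b\<in>B. l c x b"
          by (elim exE conjE)
        have "\<forall>b\<in>B. \<exists>w. w \<in> D' \<and> nd w = b" using B(2) by blast
        then obtain g where g: "\<And>b. b \<in> B \<Longrightarrow> g b \<in> D'" "\<And>b. b \<in> B \<Longrightarrow> nd (g b) = b" by metis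
        show ?thesis
        proof (rule reduce[OF _ _ _ w0(1)])
          show "countable (g ` B)" using B(1) by simp
          show "g ` B \<subseteq> X" using g(1) D'X by blast
          show "g ` B \<inter> U = {}" using g(1) X.irrefl D(1) unfolding U_def D'_def by blast
          fix x assume "x \<in> D" "x = w0 \<or> blt w0 x"
          then have x: "x \<in> D'" unfolding D'_def by blast
          obtain b where b: "b \<in> B" "l c (nd x) b" using B(3) x by blast
          have gb: "g b \<in> D'" "nd (g b) = b" using g b(1) by blast+
          have "set_less blt (cone_at r (nd x)) (cone_at r (nd (g b)))"
            by (rule cones_less[OF ndc[OF x] ndc[OF gb(1)]]) (use b gb in simp)
          then have "blt x (g b)"
            using x gb(1) nd(1) D'X unfolding set_less_def cone_at_def by blast
          then show "\<exists>b\<in>g ` B. blt x b" using b by blast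
        qed
      qed
    qed
  qed
qed

section \<open>Homogeneity of the branch space\<close>

lemma iso_right_parts:
  assumes D: "open_convex X blt D" "z \<in> D" and E: "open_convex X blt E" "u \<in> E"
  shows "ord_isomorphic blt {y \<in> D. blt z y} blt {y \<in> E. blt u y}"
proof -
  \<comment> \<open>Proved once and applied to \<open>D\<close> and to \<open>E\<close>. The open
    intervals in the decomposition are copies, so corresponding pieces of the two sums are
    isomorphic.\<close>
  have seq: "\<exists>w :: nat \<Rightarrow> 'a set. w 0 = z \<and> (\<forall>n. w n \<in> D) \<and> (\<forall>n. blt (w n) (w (Suc n))) \<and>
      {y \<in> D. blt z y} = (\<Union>n. {y \<in> X. blt (w n) y \<and> blt y (w (Suc n))} \<union> {w (Suc n)})"
    if D: "open_convex X blt D" "z \<in> D" for D z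
  proof -
    have DX: "D \<subseteq> X" and nomax: "\<And>x. x \<in> D \<Longrightarrow> \<exists>y\<in>D. blt x y"
      and convex: "\<And>a b y. a \<in> D \<Longrightarrow> b \<in> D \<Longrightarrow> y \<in> X \<Longrightarrow> blt a y \<Longrightarrow> blt y b \<Longrightarrow> y \<in> D"
      using D(1) unfolding open_convex_def by blast+
    have "D \<noteq> {}" using D(2) by blast
    then have "\<exists>B. countable B \<and> B \<subseteq> D \<and> (\<forall>x\<in>D. \<exists>b\<in>B. x = b \<or> blt x b)"
      by (rule countable_cofinal[OF DX]) (rule nomax)
    then obtain B where B: "countable B" "B \<subseteq> D" "\<forall>x\<in>D. \<exists>b\<in>B. x = b \<or> blt x b"
      by (elim exE conjE)
    obtain w :: "nat \<Rightarrow> 'a set" where w: "w 0 = z" "\<And>n. w n \<in> D" "\<And>n. blt (w n) (w (Suc n))"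
      "\<And>x. x \<in> D \<Longrightarrow> \<exists>n. blt x (w n)"
    proof -
      have "\<exists>w :: nat \<Rightarrow> 'a set. w 0 = z \<and> (\<forall>n. w n \<in> D) \<and> (\<forall>n. blt (w n) (w (Suc n))) \<and>
          (\<forall>x\<in>D. \<exists>n. blt x (w n))"
        by (rule X.countable_cofinal_seq[OF B(1,2) DX D(2) B(3)[rule_format] nomax])
      then show ?thesis using that by (elim exE conjE) blast
    qed
    have wX: "w n \<in> X" for n using w(2) DX by blast
    have zw: "z = w n \<or> blt z (w n)" for n
      using X.strict_mono_seq[of w 0 n] w(1,3) wX by (cases n) auto
    have zX: "z \<in> X" using D(2) DX by blast
    have "{y \<in> D. blt z y} = (\<Union>n. {y \<in> X. blt (w n) y \<and> blt y (w (Suc n))} \<union> {w (Suc n)})" (is "?L = ?R")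
    proof (intro equalityI subsetI)
      fix y assume y: "y \<in> ?L"
      then have yX: "y \<in> X" using DX by blast
      \<comment> \<open>The piece ending at the first \<open>w m\<close> beyond \<open>y\<close>
        contains \<open>y\<close>, unless \<open>y\<close> is its excluded left end
        \<open>w k\<close>; then \<open>y\<close> ends the piece before. The left end
        \<open>w 0\<close> is \<open>z\<close> itself and does not occur.\<close>
      define m where "m = (LEAST n. blt y (w n))"
      have m: "blt y (w m)" unfolding m_def by (rule LeastI_ex) (use w(4) y in blast)
      have "m \<noteq> 0" using m y w(1) X.asym[OF yX zX] by (metis mem_Collect_eq)
      then obtain k where k: "m = Suc k" by (cases m) auto
      have nk: "\<not> blt y (w k)" using not_less_Least[of k "\<lambda>n. blt y (w n)"] k m_def by simp
      show "y \<in> ?R"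
      proof (cases "y = w k")
        case False
        then have "blt (w k) y" using nk X.total[OF yX wX] by blast
        then show ?thesis using m k yX by blast
      next
        case True
        then have "k \<noteq> 0" using y w(1) X.irrefl[OF zX] by (metis mem_Collect_eq)
        then obtain j where "k = Suc j" by (cases k) auto
        then show ?thesis using True by blast
      qed
    next
      fix y assume "y \<in> ?R"
      then obtain n where "y = w (Suc n) \<or> (y \<in> X \<and> blt (w n) y \<and> blt y (w (Suc n)))" by blast
      then show "y \<in> ?L"
      proof
        assume y: "y = w (Suc n)"
        then have "blt z y" using zw[of n] w(3)[of n] X.trans[OF zX wX wX, of n "Suc n"] by metis
        then show ?thesis using y w(2) by blast
      next
        assume y: "y \<in> X \<and> blt (w n) y \<and> blt y (w (Suc n))"
        then have "blt z y" using zw[of n] X.trans[OF zX wX, of y n] by metis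
        then show ?thesis using y convex w(2) by blast
      qed
    qed
    then show ?thesis using w by blast
  qed
  have DX: "D \<subseteq> X" "E \<subseteq> X" using D(1) E(1) unfolding open_convex_def by blast+
  obtain w :: "nat \<Rightarrow> 'a set" where w: "\<And>n. w n \<in> X" "\<And>n. blt (w n) (w (Suc n))"
    and wD: "{y \<in> D. blt z y} = (\<Union>n. {y \<in> X. blt (w n) y \<and> blt y (w (Suc n))} \<union> {w (Suc n)})"
  proof -
    from seq[OF D] obtain w :: "nat \<Rightarrow> 'a set" where "\<forall>n. w n \<in> D" "\<forall>n. blt (w n) (w (Suc n))"
      "{y \<in> D. blt z y} = (\<Union>n. {y \<in> X. blt (w n) y \<and> blt y (w (Suc n))} \<union> {w (Suc n)})"
      by (elim exE conjE)
    then show ?thesis using that[of w] DX(1) by blast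
  qed
  obtain v :: "nat \<Rightarrow> 'a set" where v: "\<And>n. v n \<in> X" "\<And>n. blt (v n) (v (Suc n))"
    and vE: "{y \<in> E. blt u y} = (\<Union>n. {y \<in> X. blt (v n) y \<and> blt y (v (Suc n))} \<union> {v (Suc n)})"
  proof -
    from seq[OF E] obtain w :: "nat \<Rightarrow> 'a set" where "\<forall>n. w n \<in> E" "\<forall>n. blt (w n) (w (Suc n))"
      "{y \<in> E. blt u y} = (\<Union>n. {y \<in> X. blt (w n) y \<and> blt y (w (Suc n))} \<union> {w (Suc n)})"
      by (elim exE conjE)
    then show ?thesis using that[of w] DX(2) by blast
  qed
  let ?A = "\<lambda>w n. {y \<in> X. blt (w n) y \<and> blt y (w (Suc n))} \<union> {w (Suc n)}"
  have less: "set_less blt (?A w n) (?A w (Suc n))"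
    if w: "\<And>n. w n \<in> X" "\<And>n. blt (w n) (w (Suc n))" for w :: "nat \<Rightarrow> 'a set" and n
  proof -
    have below: "x = w (Suc n) \<or> blt x (w (Suc n))" "x \<in> X" if "x \<in> ?A w n" for x
      using that w(1) by blast+
    have above: "blt (w (Suc n)) y" "y \<in> X" if "y \<in> ?A w (Suc n)" for y using that w by blast+
    show ?thesis unfolding set_less_def
    proof (intro ballI)
      fix x y assume x: "x \<in> ?A w n" and y: "y \<in> ?A w (Suc n)"
      show "blt x y"
        using below(1)[OF x] above(1)[OF y] X.trans[OF below(2)[OF x] w(1) above(2)[OF y]] by blast
    qed
  qed
  show ?thesis unfolding wD vE
  proof (rule X.ord_isomorphic_chain_UN[of "?A w" "?A v"])
    fix n
    show "?A w n \<subseteq> X" "?A v n \<subseteq> X" using w(1) v(1) by blast+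
    show "?A w n \<noteq> {}" "?A v n \<noteq> {}" by blast+
    show "set_less blt (?A w n) (?A w (Suc n))" by (rule less[of w, OF w])
    show "set_less blt (?A v n) (?A v (Suc n))" by (rule less[of v, OF v])
    have "?A w n \<subseteq> X" "?A v n \<subseteq> X" using w(1) v(1) by blast+
    then show "ord_isomorphic blt (?A w n) blt (?A v n)"
    proof (intro ord_isomorphic_Un)
      show "ord_isomorphic blt {w (Suc n)} blt {v (Suc n)}"
        by (rule ord_isomorphic_singleton) (use X.irrefl w(1) v(1) in blast)+
      show "ord_isomorphic blt {y \<in> X. blt (w n) y \<and> blt y (w (Suc n))} blt
          {y \<in> X. blt (v n) y \<and> blt y (v (Suc n))}"
        by (rule copy_iso[OF copy_between[OF w(1) w(1) w(2)] copy_between[OF v(1) v(1) v(2)]])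
    qed (use X.asym in \<open>auto simp: set_less_def\<close>)
  qed
qed

text \<open>Copies are nonempty, and both intervals and rays are copies; a ray is the case of
  \<open>copy_right_of\<close> or \<open>copy_left_of\<close> at the root.\<close>

lemma order_dense_X: "order_dense X blt"
  unfolding order_dense_def
proof (intro conjI ballI impI)
  show "X \<noteq> {}" by (rule X_nonempty)
next
  fix x y assume x: "x \<in> X" "y \<in> X" "blt x y"
  then show "\<exists>z\<in>X. blt x z \<and> blt z y" using copy_nonempty[OF copy_between[OF x]] by blast
next
  fix x assume x: "x \<in> X"
  show "\<exists>y\<in>X. blt x y" using copy_nonempty[OF copy_right_of[OF x root_in[OF x]]] by blast
  show "\<exists>y\<in>X. blt y x" using copy_nonempty[OF copy_left_of[OF x root_in[OF x]]] by blast
qed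

theorem homogeneous_branches: "homogeneous X blt"
  unfolding homogeneous_def
proof (intro conjI allI impI)
  show "strict_linear X blt" by (rule X.strict_linear_axioms)
  show "order_dense X blt" by (rule order_dense_X)
next
  fix D assume D: "open_convex X blt D"
  interpret rev: branch_space T r "\<lambda>p a b. l p b a" root by (rule reverse)
  have X: "open_convex X blt X" using order_dense_X unfolding order_dense_def open_convex_def by blast
  obtain z where z: "z \<in> D" using D unfolding open_convex_def by blast
  have DX: "D \<subseteq> X" using D unfolding open_convex_def by blast
  then have zX: "z \<in> X" using z by blast
  let ?l = "\<lambda>C. {y \<in> C. blt y z}" and ?r = "\<lambda>C. {y \<in> C. blt z y}"
  \<comment> \<open>\<open>D\<close> and \<open>X\<close> are cut at the same point
    \<open>z\<close>; the left parts are the right parts of the reversed space.\<close>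
  have "ord_isomorphic (\<lambda>x y. blt y x) (?l D) (\<lambda>x y. blt y x) (?l X)"
    using rev.iso_right_parts[of D z X z] D X z zX
    unfolding split_less_reverse[of r l] open_convex_reverse[of X blt] by blast
  then have left: "ord_isomorphic blt (?l D) blt (?l X)"
    unfolding ord_isomorphic_reverse[of blt _ blt] .
  have right: "ord_isomorphic blt (?r D) blt (?r X)" by (rule iso_right_parts[OF D z X zX])
  have parts: "C = (?l C \<union> {z}) \<union> ?r C" if "C \<subseteq> X" "z \<in> C" for C
    using that X.total zX by blast
  have less: "set_less blt (?l C) {z}" "set_less blt (?l C \<union> {z}) (?r C)" if "C \<subseteq> X" for C
  proof -
    show "set_less blt (?l C) {z}" unfolding set_less_def by blast
    have "blt x y" if "x \<in> ?l C" "y \<in> ?r C" for x y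
      using X.trans[of x z y] that \<open>C \<subseteq> X\<close> zX by blast
    then show "set_less blt (?l C \<union> {z}) (?r C)" unfolding set_less_def by blast
  qed
  have sub: "?l C \<subseteq> X" "{z} \<subseteq> X" "?l C \<union> {z} \<subseteq> X" "?r C \<subseteq> X" if "C \<subseteq> X" for C
    using that zX by blast+
  note subX = sub[OF subset_refl] and subD = sub[OF DX]
  have "ord_isomorphic blt (?l D \<union> {z}) blt (?l X \<union> {z})"
    by (rule X.ord_isomorphic_Un_subset[OF subD(1,2) subX(1,2) less(1)[OF DX] less(1)[OF subset_refl]
          left ord_isomorphic_refl])
  then have "ord_isomorphic blt ((?l D \<union> {z}) \<union> ?r D) blt ((?l X \<union> {z}) \<union> ?r X)"
    by (rule X.ord_isomorphic_Un_subset[OF subD(3,4) subX(3,4) less(2)[OF DX] less(2)[OF subset_refl]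
          _ right])
  then show "ord_isomorphic blt D blt X"
    using parts[OF DX z] parts[OF subset_refl zX] by simp
qed

end

subsection \<open>HLOTS as homogeneous orders\<close>

locale linear_set =
  fixes A :: "'a set" and R :: "'a rel"
  assumes linear: "linear_order_on A R"
begin

sublocale partial_order_set A R
  using linear unfolding linear_order_on_def by unfold_locales blast

lemma le_total: "x \<in> A \<Longrightarrow> y \<in> A \<Longrightarrow> x \<noteq> y \<Longrightarrow> (x, y) \<in> R \<or> (y, x) \<in> R"
  using linear unfolding linear_order_on_def total_on_def by blast

sublocale strict_linear A "strict_of R"
proof
  fix x y z
  show "\<not> strict_of R x x" unfolding strict_of_def by simp
  show "strict_of R x z" if "strict_of R x y" "strict_of R y z"
    using that r_trans[of x y z] r_antisym[of x y] unfolding strict_of_def by blast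
  show "strict_of R x y \<or> strict_of R y x" if "x \<in> A" "y \<in> A" "x \<noteq> y"
    using le_total[OF that] that(3) unfolding strict_of_def by blast
qed

lemma rays: "underS R a = {x \<in> A. strict_of R x a}" "aboveS R a = {x \<in> A. strict_of R a x}"
  unfolding underS_def aboveS_def strict_of_def using r_sub by blast+

lemma Field_R: "Field R = A"
  unfolding Field_def using r_sub r_refl by blast

lemma Field_Restr: "C \<subseteq> A \<Longrightarrow> Field (Restr R C) = C"
  unfolding Field_def using r_refl by blast

lemma iso_Restr_iff:
  assumes C: "C \<subseteq> A"
  shows "(\<exists>f. iso R (Restr R C) f) \<longleftrightarrow> ord_isomorphic (strict_of R) A (strict_of R) C"
proof -
  have "(\<forall>a\<in>A. \<forall>b\<in>A. (a, b) \<in> R \<longleftrightarrow> (f a, f b) \<in> Restr R C) \<longleftrightarrow>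
      (\<forall>a\<in>A. \<forall>b\<in>A. strict_of R a b \<longleftrightarrow> strict_of R (f a) (f b))"
    if f: "bij_betw f A C" for f
  proof -
    have fC: "f a \<in> C" if "a \<in> A" for a using f that bij_betwE by blast
    have "((a, b) \<in> R \<longleftrightarrow> (f a, f b) \<in> Restr R C) \<longleftrightarrow> (strict_of R a b \<longleftrightarrow> strict_of R (f a) (f b))"
      if "a \<in> A" "b \<in> A" for a b
    proof (cases "a = b")
      case True
      then show ?thesis using r_refl fC[OF that(1)] C that unfolding strict_of_def by blast
    next
      case False
      then have "f a \<noteq> f b" using f that unfolding bij_betw_def inj_on_def by blast
      then show ?thesis using fC that False unfolding strict_of_def by blast
    qed
    then show ?thesis by blast
  qed
  then show ?thesis unfolding iso_iff2 Field_R Field_Restr[OF C] ord_isomorphic_def by blast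
qed

lemma order_convex_iff:
  "order_convex A R C \<longleftrightarrow>
     C \<subseteq> A \<and> (\<forall>x\<in>C. \<forall>z\<in>C. \<forall>y\<in>A. strict_of R x y \<and> strict_of R y z \<longrightarrow> y \<in> C)"
  unfolding order_convex_def strict_of_def by blast

lemma openin_rays:
  assumes "a \<in> A"
  shows "openin (lots_topology A R) {x \<in> A. strict_of R x a}"
    "openin (lots_topology A R) {x \<in> A. strict_of R a x}"
  unfolding lots_topology_def rays[symmetric] using assms
  by (auto intro!: topology_generated_by_Basis)

text \<open>Subbasic sets bound a point on at most one side; the absence of endpoints supplies the
  missing bounds.\<close>

lemma openin_interval_around:
  assumes nomax: "\<And>x. x \<in> A \<Longrightarrow> \<exists>y\<in>A. strict_of R x y" and nomin: "\<And>x. x \<in> A \<Longrightarrow> \<exists>y\<in>A. strict_of R y x"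
    and U: "openin (lots_topology A R) U" and x: "x \<in> U" "x \<in> A"
  shows "\<exists>a\<in>A. \<exists>b\<in>A. strict_of R a x \<and> strict_of R x b \<and>
    (\<forall>y\<in>A. strict_of R a y \<and> strict_of R y b \<longrightarrow> y \<in> U)"
proof -
  have "generate_topology_on (insert A (underS R ` A \<union> aboveS R ` A)) U"
    using U unfolding lots_topology_def openin_topology_generated_by_iff .
  then show ?thesis using x(1)
  proof (induction rule: generate_topology_on.induct)
    case Empty then show ?case by simp
  next
    case (Int U V)
    obtain a b where ab: "a \<in> A" "b \<in> A" "strict_of R a x" "strict_of R x b"
      "\<forall>y\<in>A. strict_of R a y \<and> strict_of R y b \<longrightarrow> y \<in> U" using Int by blast
    obtain c d where cd: "c \<in> A" "d \<in> A" "strict_of R c x" "strict_of R x d"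
      "\<forall>y\<in>A. strict_of R c y \<and> strict_of R y d \<longrightarrow> y \<in> V" using Int by blast
    \<comment> \<open>The larger of the left ends and, next, the smaller of the right ends.\<close>
    define a' where "a' = (if strict_of R a c then c else a)"
    define b' where "b' = (if strict_of R b d then b else d)"
    have 1: "a' \<in> A" "b' \<in> A" "strict_of R a' x" "strict_of R x b'"
      unfolding a'_def b'_def using ab cd by auto
    have 2: "strict_of R a y \<and> strict_of R c y" if "y \<in> A" "strict_of R a' y" for y
      using that ab(1) cd(1) trans[of a c y] trans[of c a y] total[of a c]
      unfolding a'_def by (auto split: if_splits)
    have 3: "strict_of R y b \<and> strict_of R y d" if "y \<in> A" "strict_of R y b'" for y
      using that ab(2) cd(2) trans[of y b d] trans[of y d b] total[of b d]
      unfolding b'_def by (auto split: if_splits)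
    show ?case using 1 2 3 ab(5) cd(5) by blast
  next
    case (UN K)
    then obtain k where "k \<in> K" "x \<in> k" by blast
    then show ?case using UN.IH[of k] by blast
  next
    case (Basis S)
    obtain u v where uv: "u \<in> A" "strict_of R u x" "v \<in> A" "strict_of R x v"
      using nomax[OF x(2)] nomin[OF x(2)] by blast
    consider "S = A" | p where "p \<in> A" "S = underS R p" | p where "p \<in> A" "S = aboveS R p"
      using Basis by blast
    then show ?case
    proof cases
      case 1 then show ?thesis using uv by blast
    next
      case 2 then show ?thesis using uv Basis(2) unfolding rays by blast
    next
      case 3 then show ?thesis using uv Basis(2) unfolding rays by blast
    qed
  qed
qed

text \<open>A convex set without extremal elements is the union of the open intervals between its
  own points. Conversely, an interval around a point inside an open set contains, by density, points
  on both sides.\<close>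

lemma open_convex_iff:
  assumes dense: "order_dense A (strict_of R)"
  shows "open_convex A (strict_of R) C \<longleftrightarrow>
    C \<noteq> {} \<and> openin (lots_topology A R) C \<and> order_convex A R C"
proof
  assume C: "open_convex A (strict_of R) C"
  have CA: "C \<subseteq> A" using C unfolding open_convex_def by blast
  let ?I = "\<lambda>a b. {x \<in> A. strict_of R a x} \<inter> {x \<in> A. strict_of R x b}"
  have "C = (\<Union>a\<in>C. \<Union>b\<in>C. ?I a b)"
  proof
    show "C \<subseteq> (\<Union>a\<in>C. \<Union>b\<in>C. ?I a b)"
    proof
      fix x assume x: "x \<in> C"
      obtain a b where "a \<in> C" "b \<in> C" "strict_of R a x" "strict_of R x b"
        using C x unfolding open_convex_def by blast
      then show "x \<in> (\<Union>a\<in>C. \<Union>b\<in>C. ?I a b)" using x CA by blast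
    qed
    show "(\<Union>a\<in>C. \<Union>b\<in>C. ?I a b) \<subseteq> C" using C unfolding open_convex_def by blast
  qed
  moreover have "openin (lots_topology A R) (\<Union>a\<in>C. \<Union>b\<in>C. ?I a b)"
    by (intro openin_Union[of "_ ` _"] openin_Int; use openin_rays CA in blast)
  ultimately have "openin (lots_topology A R) C" by metis
  then show "C \<noteq> {} \<and> openin (lots_topology A R) C \<and> order_convex A R C"
    using C unfolding open_convex_def order_convex_iff by blast
next
  assume C: "C \<noteq> {} \<and> openin (lots_topology A R) C \<and> order_convex A R C"
  then have CA: "C \<subseteq> A" unfolding order_convex_def by blast
  have d: "\<And>x y. x \<in> A \<Longrightarrow> y \<in> A \<Longrightarrow> strict_of R x y \<Longrightarrow> \<exists>z\<in>A. strict_of R x z \<and> strict_of R z y"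
    "\<And>x. x \<in> A \<Longrightarrow> \<exists>y\<in>A. strict_of R x y" "\<And>x. x \<in> A \<Longrightarrow> \<exists>y\<in>A. strict_of R y x"
    using dense unfolding order_dense_def by blast+
  have "(\<exists>y\<in>C. strict_of R x y) \<and> (\<exists>y\<in>C. strict_of R y x)" if x: "x \<in> C" for x
  proof -
    have xA: "x \<in> A" using x CA by blast
    obtain a b where ab: "a \<in> A" "b \<in> A" "strict_of R a x" "strict_of R x b"
      "\<forall>y\<in>A. strict_of R a y \<and> strict_of R y b \<longrightarrow> y \<in> C"
      using openin_interval_around[OF d(2,3) _ x xA] C by blast
    obtain y where y: "y \<in> A" "strict_of R x y" "strict_of R y b" using d(1)[OF xA ab(2,4)] by blast
    obtain z where z: "z \<in> A" "strict_of R a z" "strict_of R z x" using d(1)[OF ab(1) xA ab(3)] by blast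
    have "y \<in> C" using ab(5) y trans[OF ab(1) xA y(1) ab(3) y(2)] by blast
    moreover have "z \<in> C" using ab(5) z trans[OF z(1) xA ab(2) z(3) ab(4)] by blast
    ultimately show ?thesis using y z by blast
  qed
  then show "open_convex A (strict_of R) C" using C unfolding open_convex_def order_convex_iff by blast
qed

text \<open>If \<open>x\<close> were greatest, the open ray below it, being isomorphic to
  \<open>A\<close>, would have a greatest element too and \<open>{x}\<close> would be open; but then
  \<open>A\<close> would be isomorphic to a singleton. With no greatest element in \<open>A\<close>,
  a jump from \<open>x\<close> to \<open>y\<close> is impossible, as it would make \<open>x\<close>
  greatest in the open ray below \<open>y\<close>.\<close>

lemma HLOTS_dense:
  assumes three: "\<exists>x\<in>A. \<exists>y\<in>A. \<exists>z\<in>A. x \<noteq> y \<and> y \<noteq> z \<and> x \<noteq> z"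
    and iso: "\<And>C. C \<noteq> {} \<Longrightarrow> openin (lots_topology A R) C \<Longrightarrow> order_convex A R C \<Longrightarrow>
      ord_isomorphic (strict_of R) A (strict_of R) C"
  shows "order_dense A (strict_of R)"
proof -
  have singleton: "\<not> openin (lots_topology A R) {p}" if p: "p \<in> A" for p
  proof
    assume "openin (lots_topology A R) {p}"
    then obtain f where f: "bij_betw f A {p}"
      using iso[of "{p}"] p asym unfolding order_convex_iff ord_isomorphic_def by blast
    have "x = y" if xy: "x \<in> A" "y \<in> A" for x y
    proof -
      have "f x = p" "f y = p" using f xy bij_betwE by blast+
      then show ?thesis using f xy unfolding bij_betw_def inj_on_def by blast
    qed
    then show False using three by metis
  qed
  have max_transfer: "\<exists>m\<in>A. \<forall>x\<in>A. \<not> strict_of R m x"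
    if C: "C \<noteq> {}" "openin (lots_topology A R) C" "order_convex A R C" "m \<in> C"
      "\<forall>x\<in>C. \<not> strict_of R m x" for C m
  proof -
    obtain f where f: "bij_betw f A C" "\<forall>x\<in>A. \<forall>y\<in>A. strict_of R x y \<longleftrightarrow> strict_of R (f x) (f y)"
      using iso[OF C(1-3)] unfolding ord_isomorphic_def by blast
    obtain a where a: "a \<in> A" "f a = m" using f(1) C(4) unfolding bij_betw_def by blast
    have "\<not> strict_of R a x" if "x \<in> A" for x using f a C(5) that bij_betwE by metis
    then show ?thesis using a by blast
  qed
  have convex_rays: "order_convex A R {x \<in> A. strict_of R x a}" "order_convex A R {x \<in> A. strict_of R a x}"
    if "a \<in> A" for a
    unfolding order_convex_iff using trans that by blast+
  have other: "\<exists>y\<in>A. y \<noteq> x" for x using three by metis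
  have nomax: "\<exists>y\<in>A. strict_of R x y" if x: "x \<in> A" for x
  proof (rule ccontr)
    assume neg: "\<not> (\<exists>y\<in>A. strict_of R x y)"
    let ?C = "{y \<in> A. strict_of R y x}"
    have all: "\<And>y. y \<in> A \<Longrightarrow> y \<noteq> x \<Longrightarrow> strict_of R y x" using neg total x by blast
    have ne: "?C \<noteq> {}" using other all by blast
    have "ord_isomorphic (strict_of R) A (strict_of R) ?C"
      by (rule iso[OF ne openin_rays(1)[OF x] convex_rays(1)[OF x]])
    then obtain f where f: "bij_betw f A ?C" "\<forall>x\<in>A. \<forall>y\<in>A. strict_of R x y \<longleftrightarrow> strict_of R (f x) (f y)"
      unfolding ord_isomorphic_def by blast
    have m: "f x \<in> ?C" using f(1) x bij_betwE by blast
    have m': "y = f x \<or> strict_of R y (f x)" if y: "y \<in> ?C" for y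
    proof -
      have "y \<in> f ` A" using y bij_betw_imp_surj_on[OF f(1)] by simp
      then obtain a where a: "a \<in> A" "f a = y" by blast
      show ?thesis
      proof (cases "a = x")
        case False
        then show ?thesis using all[OF a(1)] f(2) x a by blast
      qed (use a in simp)
    qed
    have "{y \<in> A. strict_of R (f x) y} = {x}"
    proof (intro equalityI subsetI)
      fix y assume y: "y \<in> {y \<in> A. strict_of R (f x) y}"
      show "y \<in> {x}"
      proof (rule ccontr)
        assume "y \<notin> {x}"
        then have "y \<in> ?C" using all y by blast
        then show False using m'[of y] y m irrefl asym by blast
      qed
    qed (use m x in blast)
    then show False using openin_rays(2)[of "f x"] singleton[OF x] m by simp
  qed
  have nomin: "\<exists>y\<in>A. strict_of R y x" if x: "x \<in> A" for x
  proof (rule ccontr)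
    assume neg: "\<not> (\<exists>y\<in>A. strict_of R y x)"
    let ?C = "{y \<in> A. strict_of R x y}"
    have all: "\<And>y. y \<in> A \<Longrightarrow> y \<noteq> x \<Longrightarrow> strict_of R x y" using neg total x by blast
    have ne: "?C \<noteq> {}" using other all by blast
    have "ord_isomorphic (strict_of R) A (strict_of R) ?C"
      by (rule iso[OF ne openin_rays(2)[OF x] convex_rays(2)[OF x]])
    then obtain f where f: "bij_betw f A ?C" "\<forall>x\<in>A. \<forall>y\<in>A. strict_of R x y \<longleftrightarrow> strict_of R (f x) (f y)"
      unfolding ord_isomorphic_def by blast
    have m: "f x \<in> ?C" using f(1) x bij_betwE by blast
    have m': "y = f x \<or> strict_of R (f x) y" if y: "y \<in> ?C" for y
    proof -
      have "y \<in> f ` A" using y bij_betw_imp_surj_on[OF f(1)] by simp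
      then obtain a where a: "a \<in> A" "f a = y" by blast
      show ?thesis
      proof (cases "a = x")
        case False
        then show ?thesis using all[OF a(1)] f(2) x a by blast
      qed (use a in simp)
    qed
    have "{y \<in> A. strict_of R y (f x)} = {x}"
    proof (intro equalityI subsetI)
      fix y assume y: "y \<in> {y \<in> A. strict_of R y (f x)}"
      show "y \<in> {x}"
      proof (rule ccontr)
        assume "y \<notin> {x}"
        then have "y \<in> ?C" using all y by blast
        then show False using m'[of y] y m irrefl asym by blast
      qed
    qed (use m x in blast)
    then show False using openin_rays(1)[of "f x"] singleton[OF x] m by simp
  qed
  have "\<exists>z\<in>A. strict_of R x z \<and> strict_of R z y" if xy: "x \<in> A" "y \<in> A" "strict_of R x y" for x y
  proof (rule ccontr)
    assume neg: "\<not> (\<exists>z\<in>A. strict_of R x z \<and> strict_of R z y)"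
    let ?C = "{z \<in> A. strict_of R z y}"
    have "\<exists>m\<in>A. \<forall>x\<in>A. \<not> strict_of R m x"
    proof (rule max_transfer[OF _ openin_rays(1)[OF xy(2)] convex_rays(1)[OF xy(2)]])
      show "?C \<noteq> {}" "x \<in> ?C" using xy by blast+
      show "\<forall>z\<in>?C. \<not> strict_of R x z" using neg by blast
    qed
    then show False using nomax by blast
  qed
  then show ?thesis unfolding order_dense_def using nomax nomin three by blast
qed

end

lemma HLOTS_iff_homogeneous:
  "HLOTS A R \<longleftrightarrow> linear_order_on A R \<and> homogeneous A (strict_of R)"
proof (cases "linear_order_on A R")
  case True
  then interpret linear_set A R by unfold_locales
  show ?thesis
  proof
    assume H: "HLOTS A R"
    have iso: "ord_isomorphic (strict_of R) A (strict_of R) C"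
      if "C \<noteq> {}" "openin (lots_topology A R) C" "order_convex A R C" for C
      using H that iso_Restr_iff[of C] unfolding HLOTS_def order_convex_def by blast
    have dense: "order_dense A (strict_of R)"
      by (rule HLOTS_dense[OF _ iso]) (use H HLOTS_def in blast)
    have "ord_isomorphic (strict_of R) C (strict_of R) A" if "open_convex A (strict_of R) C" for C
      by (rule ord_isomorphic_sym[OF iso]) (use that open_convex_iff[OF dense] in blast)+
    then show "linear_order_on A R \<and> homogeneous A (strict_of R)"
      unfolding homogeneous_def using True strict_linear_axioms dense by blast
  next
    assume "linear_order_on A R \<and> homogeneous A (strict_of R)"
    then have dense: "order_dense A (strict_of R)"
      and iso: "\<And>C. open_convex A (strict_of R) C \<Longrightarrow> ord_isomorphic (strict_of R) C (strict_of R) A"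
      unfolding homogeneous_def by blast+
    obtain x where x: "x \<in> A" using dense unfolding order_dense_def by blast
    obtain y where y: "y \<in> A" "strict_of R x y" using dense x unfolding order_dense_def by blast
    obtain z where z: "z \<in> A" "strict_of R y z" using dense y unfolding order_dense_def by blast
    have "x \<noteq> y \<and> y \<noteq> z \<and> x \<noteq> z" using x y z irrefl asym by blast
    moreover have "\<exists>f. iso R (Restr R C) f"
      if C: "C \<noteq> {}" "openin (lots_topology A R) C" "order_convex A R C" for C
    proof -
      have "open_convex A (strict_of R) C" using C open_convex_iff[OF dense] by blast
      then show ?thesis using iso ord_isomorphic_sym iso_Restr_iff C unfolding order_convex_def by blast
    qed
    ultimately show "HLOTS A R" unfolding HLOTS_def using True x y z by blast
  qed
qed (simp add: HLOTS_def)

subsection \<open>Ordinals and the nodes of a tree\<close>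

context tree_branches
begin

text \<open>A branch through \<open>p\<close> is determined by its part in \<open>T\<^sub>p\<close>, so an isomorphism of \<open>T\<^sub>p\<close> onto \<open>T\<close> acts on branches.\<close>
lemma cone_isomorphic:
  assumes p: "p \<in> T" and f: "bij_betw f (above r p) T"
    and ord: "\<And>x y. x \<in> above r p \<Longrightarrow> y \<in> above r p \<Longrightarrow> (x, y) \<in> r \<longleftrightarrow> (f x, f y) \<in> r"
    and covers: "\<And>q a. q \<in> above r p \<Longrightarrow> a \<in> above r p \<Longrightarrow> a \<in> covers r q \<longleftrightarrow> f a \<in> covers r (f q)"
    and l: "\<And>q a b. q \<in> above r p \<Longrightarrow> a \<in> covers r q \<Longrightarrow> b \<in> covers r q \<Longrightarrow> l q a b \<longleftrightarrow> l (f q) (f a) (f b)"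
    and irrefl: "\<And>q a. \<not> l q a a"
  shows "ord_isomorphic (split_less r l) (cone_at r p) (split_less r l) (branches r)"
proof -
  let ?A = "above r p"
  define F where "F x = f ` (x \<inter> ?A)" for x
  have pA: "p \<in> ?A" using r_refl[OF p] unfolding above_def by simp
  have A_up: "y \<in> ?A" if "x \<in> ?A" "(x, y) \<in> r" for x y using that r_trans unfolding above_def by blast
  have covA: "a \<in> ?A" if "q \<in> ?A" "a \<in> covers r q" for q a using A_up[OF that(1)] coversD(1)[OF that(2)] .
  have fA: "\<exists>x\<in>?A. f x = y" if "y \<in> T" for y
    using bij_betw_imp_surj_on[OF f] that by (metis imageE)
  have inj: "x = y" if "x \<in> ?A" "y \<in> ?A" "f x = f y" for x y
    using bij_betw_imp_inj_on[OF f] that unfolding inj_on_def by blast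
  have memF: "f a \<in> F x \<longleftrightarrow> a \<in> x" if "a \<in> ?A" for a x
    unfolding F_def using inj that by blast
  have memFD: "\<exists>a\<in>x \<inter> ?A. f a = b" if "b \<in> F x" for b x using that unfolding F_def by blast
  have part: "c \<in> ?A \<or> (c, p) \<in> r" if "x \<in> cone_at r p" "c \<in> x" for x c
    using branch_chain[of x p c] that unfolding cone_at_def above_def by blast
  have Fbranch: "F x \<in> branches r" if x: "x \<in> cone_at r p" for x
  proof -
    have xb: "x \<in> branches r" "p \<in> x" using x unfolding cone_at_def by blast+
    have "(b, b') \<in> r \<or> (b', b) \<in> r" if b: "b \<in> F x" "b' \<in> F x" for b b'
    proof -
      obtain a a' where "a \<in> x \<inter> ?A" "f a = b" "a' \<in> x \<inter> ?A" "f a' = b'" using memFD b by metis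
      then show ?thesis using branch_chain[OF xb(1), of a a'] ord by blast
    qed
    then have ch: "F x \<in> Chains r" unfolding Chains_def by blast
    have "y = F x" if y: "y \<in> Chains r" "F x \<subseteq> y" for y
    proof
      show "y \<subseteq> F x"
      proof
        fix t assume t: "t \<in> y"
        then have "t \<in> T" using y(1) r_sub unfolding Chains_def by blast
        then obtain u where u: "u \<in> ?A" "f u = t" using fA by blast
        have "u \<in> x"
        proof (rule branch_insert[OF xb(1)])
          show "u \<in> T" using u(1) r_sub unfolding above_def by blast
          fix c assume c: "c \<in> x"
          show "(c, u) \<in> r \<or> (u, c) \<in> r"
          proof (cases "c \<in> ?A")
            case True
            then have "f c \<in> y" using memF c y(2) by blast
            then have "(f c, t) \<in> r \<or> (t, f c) \<in> r" using t y(1) unfolding Chains_def by blast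
            then show ?thesis using ord True u by blast
          next
            case False
            then have "(c, p) \<in> r" using part[OF x c] by blast
            then show ?thesis using u(1) r_trans unfolding above_def by blast
          qed
        qed
        then show "t \<in> F x" using memF[OF u(1)] u(2) by blast
      qed
    qed (rule y(2))
    then show ?thesis using ch unfolding branches_def by blast
  qed
  have Finj: "x = x'" if x: "x \<in> cone_at r p" "x' \<in> cone_at r p" and eq: "F x = F x'" for x x'
  proof (rule branch_maximal)
    show "x \<in> branches r" "x' \<in> branches r" using x unfolding cone_at_def by blast+
    show "x \<subseteq> x'"
    proof
      fix c assume c: "c \<in> x"
      show "c \<in> x'"
      proof (cases "c \<in> ?A")
        case True then show ?thesis using memF[OF True] c eq by blast
      next
        case False
        then have "(c, p) \<in> r" using part[OF x(1) c] by blast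
        then show ?thesis using branch_down[of x' p c] x(2) unfolding cone_at_def by blast
      qed
    qed
  qed
  have Fsurj: "\<exists>x\<in>cone_at r p. F x = y" if y: "y \<in> branches r" for y
  proof -
    \<comment> \<open>\<open>p\<close> is included so that the branch extending this chain lies in
      the cone of \<open>p\<close>.\<close>
    let ?C = "insert p {u \<in> ?A. f u \<in> y}"
    have "(u, v) \<in> r \<or> (v, u) \<in> r" if "u \<in> ?C" "v \<in> ?C" for u v
      using that branch_chain[OF y, of "f u" "f v"] ord[of u v] ord[of v u] pA r_refl[OF p]
      unfolding above_def by blast
    then obtain x where x: "x \<in> branches r" "?C \<subseteq> x" using chain_extends by blast
    have xc: "x \<in> cone_at r p" using x unfolding cone_at_def by blast
    have "y \<subseteq> F x"
    proof
      fix t assume t: "t \<in> y"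
      obtain u where "u \<in> ?A" "f u = t" using fA branch_sub[OF y t] by blast
      then show "t \<in> F x" using memF[of u x] x(2) t by blast
    qed
    then show ?thesis using branch_maximal[OF y Fbranch[OF xc]] xc by blast
  qed
  have "split_less r l x x' \<longleftrightarrow> split_less r l (F x) (F x')" if x: "x \<in> cone_at r p" "x' \<in> cone_at r p" for x x'
  proof -
    have xb: "x \<in> branches r" "p \<in> x" "x' \<in> branches r" "p \<in> x'" using x unfolding cone_at_def by blast+
    show ?thesis
    proof
      assume "split_less r l x x'"
      then obtain q a b where q: "q \<in> x" "q \<in> x'" "a \<in> x" "a \<in> covers r q" "b \<in> x'" "b \<in> covers r q" "l q a b"
        unfolding split_less_def by blast
      \<comment> \<open>Two branches through \<open>p\<close> take the same successor at every node
        strictly below \<open>p\<close>, and \<open>l q\<close> is irreflexive; so they split inside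
        \<open>T\<^sub>p\<close>.\<close>
      have qA: "q \<in> ?A"
      proof (rule ccontr)
        assume "q \<notin> ?A"
        then have qp: "(q, p) \<in> r" "q \<noteq> p" using part[OF x(1) q(1)] pA by blast+
        have "(b, p) \<in> r" using cover_le[OF xb(3) q(5) xb(4) q(6) qp] .
        then have "b \<in> x" using branch_down[OF xb(1,2)] by blast
        then have "a = b" using cover_unique[OF xb(1) q(3) _ q(4,6)] by blast
        then show False using q(7) irrefl by blast
      qed
      have aA: "a \<in> ?A" "b \<in> ?A" using covA[OF qA] q by blast+
      have "f q \<in> F x" "f q \<in> F x'" "f a \<in> F x" "f b \<in> F x'" using memF qA aA q by blast+
      moreover have "f a \<in> covers r (f q)" "f b \<in> covers r (f q)" using covers[OF qA] aA q by blast+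
      moreover have "l (f q) (f a) (f b)" using l[OF qA q(4,6)] q(7) by blast
      ultimately show "split_less r l (F x) (F x')" unfolding split_less_def by blast
    next
      assume "split_less r l (F x) (F x')"
      then obtain q' a' b' where q': "q' \<in> F x" "q' \<in> F x'" "a' \<in> F x" "a' \<in> covers r q'" "b' \<in> F x'"
        "b' \<in> covers r q'" "l q' a' b'"
        unfolding split_less_def by blast
      obtain q where q: "q \<in> x" "q \<in> ?A" "f q = q'" using memFD[OF q'(1)] by blast
      obtain a where a: "a \<in> x" "a \<in> ?A" "f a = a'" using memFD[OF q'(3)] by blast
      obtain b where b: "b \<in> x'" "b \<in> ?A" "f b = b'" using memFD[OF q'(5)] by blast
      have "q \<in> x'" using memF[OF q(2)] q(3) q'(2) by blast
      moreover have "a \<in> covers r q" "b \<in> covers r q" using covers[OF q(2)] a b q(3) q' by blast+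
      moreover then have "l q a b" using l[OF q(2)] q a b q'(7) by blast
      ultimately show "split_less r l x x'" unfolding split_less_def using q a b by blast
    qed
  qed
  moreover have "bij_betw F (cone_at r p) (branches r)"
    unfolding bij_betw_def inj_on_def using Finj Fsurj Fbranch by blast
  ultimately show ?thesis unfolding ord_isomorphic_def by blast
qed

end

text \<open>The predecessors of \<open>q\<close> are those of \<open>p\<close> with \<open>p\<close>
  on top. Any partial order is allowed because the lemma is also applied to the restriction of
  \<open>r\<close> to \<open>above r p\<close>.\<close>

lemma node_ord_cover:
  assumes po: "partial_order_on T r" and wo: "Well_order (node_ord r q)" and q: "q \<in> covers r p"
  shows "node_ord r q =o ord_suc (node_ord r p)"
proof -
  interpret partial_order_set T r by unfold_locales (rule po)
  have refl: "\<And>x y. (x, y) \<in> r \<Longrightarrow> (x, x) \<in> r \<and> (y, y) \<in> r" using r_sub r_refl by blast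
  have pq: "(p, q) \<in> r" "p \<noteq> q" and cov: "\<And>c. (p, c) \<in> r \<Longrightarrow> (c, q) \<in> r \<Longrightarrow> c = p \<or> c = q"
    using q unfolding covers_def by blast+
  have Field: "Field (node_ord r x) = underS r x" for x
    unfolding node_ord_def Field_def underS_def using refl by blast
  have linear: "(x, y) \<in> r \<or> (y, x) \<in> r" if "x \<in> underS r q" "y \<in> underS r q" for x y
  proof (cases "x = y")
    case False
    then have "(x, y) \<in> node_ord r q \<or> (y, x) \<in> node_ord r q"
      using wo that Field[of q] unfolding well_order_on_def linear_order_on_def total_on_def by blast
    then show ?thesis unfolding node_ord_def by blast
  qed (use that refl underS_def in fast)
  have pS: "p \<in> underS r q" using pq unfolding underS_def by blast
  have under_q: "underS r q = insert p (underS r p)"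
  proof (intro equalityI subsetI)
    fix x assume x: "x \<in> underS r q"
    then show "x \<in> insert p (underS r p)"
      using linear[OF x pS] cov[of x] unfolding underS_def by blast
  next
    fix x assume "x \<in> insert p (underS r p)"
    then show "x \<in> underS r q" using pS pq r_trans[of x p q] r_antisym[of x p] unfolding underS_def by blast
  qed
  \<comment> \<open>The greatest predecessor \<open>p\<close> of \<open>q\<close> becomes the new
    top element \<open>None\<close>.\<close>
  define f where "f x = (if x = p then None else Some x)" for x
  have inj: "inj_on f (Field (node_ord r q))" unfolding f_def inj_on_def by auto
  have "dir_image (node_ord r q) f = ord_suc (node_ord r p)"
  proof (intro equalityI subrelI)
    fix u v assume "(u, v) \<in> dir_image (node_ord r q) f"
    then obtain x y where xy: "u = f x" "v = f y" "(x, y) \<in> r" "x \<in> underS r q" "y \<in> underS r q"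
      unfolding dir_image_def node_ord_def by blast
    have "x = p \<or> x \<in> underS r p" "y = p \<or> y \<in> underS r p" using xy under_q by blast+
    moreover have "x = p \<Longrightarrow> y = p"
      using xy(3) r_antisym[of p y] under_q xy(5) unfolding underS_def by blast
    ultimately show "(u, v) \<in> ord_suc (node_ord r p)"
      unfolding xy(1,2) f_def ord_suc_def Field using xy(3)
      by (auto simp: node_ord_def underS_def)
  next
    fix u v assume uv: "(u, v) \<in> ord_suc (node_ord r p)"
    have in_image: "(f x, f y) \<in> dir_image (node_ord r q) f"
      if "x \<in> insert p (underS r p)" "y \<in> insert p (underS r p)" "(x, y) \<in> r" for x y
      using that unfolding dir_image_def node_ord_def under_q by blast
    have pp: "(p, p) \<in> r" using refl pq by blast
    have fS: "f x = Some x" if "x \<in> underS r p" for x using that unfolding f_def underS_def by auto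
    have fp: "f p = None" unfolding f_def by simp
    consider x y where "u = Some x" "v = Some y" "(x, y) \<in> node_ord r p"
      | "u = None" "v = None" | x where "u = Some x" "v = None" "x \<in> underS r p"
      using uv unfolding ord_suc_def Field by blast
    then show "(u, v) \<in> dir_image (node_ord r q) f"
    proof cases
      case 1
      then show ?thesis using in_image[of x y] fS[of x] fS[of y] unfolding node_ord_def by auto
    next
      case 2 then show ?thesis using in_image[of p p] pp fp by auto
    next
      case 3
      then show ?thesis using in_image[of x p] fS[of x] fp unfolding underS_def by auto
    qed
  qed
  then show ?thesis using dir_image_ordIso[OF wo inj] by simp
qed

text \<open>Needed because \<open>branch_nth\<close> fixes ordinals only up to \<open>=o\<close>.
  The premise on \<open>ord_suc \<alpha>\<close> is met in the application since some node has this
  order.\<close>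

lemma ord_suc_cong:
  assumes iso: "\<alpha> =o \<beta>" and wo: "Well_order (ord_suc \<alpha>)"
  shows "ord_suc \<alpha> =o ord_suc \<beta>"
proof -
  obtain f where f: "iso \<alpha> \<beta> f" using iso unfolding ordIso_def by blast
  then have bij: "bij_betw f (Field \<alpha>) (Field \<beta>)"
    and ord: "\<And>a b. a \<in> Field \<alpha> \<Longrightarrow> b \<in> Field \<alpha> \<Longrightarrow> (a, b) \<in> \<alpha> \<longleftrightarrow> (f a, f b) \<in> \<beta>"
    unfolding iso_iff2 by blast+
  have Fs: "Field (ord_suc \<gamma>) = insert None (Some ` Field \<gamma>)" for \<gamma> :: "'c rel"
  proof
    show "insert None (Some ` Field \<gamma>) \<subseteq> Field (ord_suc \<gamma>)"
    proof
      fix u assume "u \<in> insert None (Some ` Field \<gamma>)"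
      then have "(u, None) \<in> ord_suc \<gamma>" unfolding ord_suc_def by blast
      then show "u \<in> Field (ord_suc \<gamma>)" by (rule FieldI1)
    qed
    show "Field (ord_suc \<gamma>) \<subseteq> insert None (Some ` Field \<gamma>)"
    proof
      fix u assume "u \<in> Field (ord_suc \<gamma>)"
      then obtain v where "(u, v) \<in> ord_suc \<gamma> \<or> (v, u) \<in> ord_suc \<gamma>" unfolding Field_def by blast
      then show "u \<in> insert None (Some ` Field \<gamma>)"
        unfolding ord_suc_def by (auto intro: FieldI1 FieldI2)
    qed
  qed
  have inj: "inj_on (map_option f) (Field (ord_suc \<alpha>))"
    using bij_betw_imp_inj_on[OF bij] unfolding Fs inj_on_def by auto
  have surj: "\<exists>a\<in>Field \<alpha>. f a = b" if "b \<in> Field \<beta>" for b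
    using bij_betw_imp_surj_on[OF bij] that by (metis imageE)
  have "dir_image (ord_suc \<alpha>) (map_option f) = ord_suc \<beta>"
  proof (intro equalityI subrelI)
    fix u v assume "(u, v) \<in> dir_image (ord_suc \<alpha>) (map_option f)"
    then obtain x y where xy: "u = map_option f x" "v = map_option f y" "(x, y) \<in> ord_suc \<alpha>"
      unfolding dir_image_def by blast
    have fF: "f a \<in> Field \<beta>" if "a \<in> Field \<alpha>" for a using bij that bij_betwE by blast
    have fo: "(f a, f b) \<in> \<beta>" if "(a, b) \<in> \<alpha>" for a b
      using ord[OF FieldI1[OF that] FieldI2[OF that]] that by blast
    show "(u, v) \<in> ord_suc \<beta>"
      using xy fF fo unfolding ord_suc_def by auto
  next
    fix u v assume "(u, v) \<in> ord_suc \<beta>"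
    then consider b b' where "u = Some b" "v = Some b'" "(b, b') \<in> \<beta>"
      | "u = None" "v = None" | b where "u = Some b" "v = None" "b \<in> Field \<beta>"
      unfolding ord_suc_def by blast
    then show "(u, v) \<in> dir_image (ord_suc \<alpha>) (map_option f)"
    proof cases
      case 1
      obtain a where a: "a \<in> Field \<alpha>" "f a = b" using surj FieldI1[OF 1(3)] by blast
      obtain a' where a': "a' \<in> Field \<alpha>" "f a' = b'" using surj FieldI2[OF 1(3)] by blast
      have "(Some a, Some a') \<in> ord_suc \<alpha>" using ord a a' 1(3) unfolding ord_suc_def by blast
      then show ?thesis using 1 a a' unfolding dir_image_def by force
    next
      case 2
      have "(None, None) \<in> ord_suc \<alpha>" unfolding ord_suc_def by blast
      then show ?thesis using 2 unfolding dir_image_def by force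
    next
      case 3
      obtain a where a: "a \<in> Field \<alpha>" "f a = b" using surj 3(3) by blast
      have "(Some a, None) \<in> ord_suc \<alpha>" using a unfolding ord_suc_def by blast
      then show ?thesis using 3 a unfolding dir_image_def by force
    qed
  qed
  then show ?thesis using dir_image_ordIso[OF wo inj] by simp
qed

section \<open>From well-ordered predecessor sets to the abstract tree locales\<close>

locale wo_tree =
  fixes T :: "'a set" and r :: "'a rel"
  assumes tree: "tree T r"
begin

sublocale partial_order_set T r
  using tree unfolding tree_def by unfold_locales blast

lemma wo: "p \<in> T \<Longrightarrow> Well_order (node_ord r p)"
  using tree well_order_on_Well_order unfolding tree_def by blast

lemma Field_node_ord: "Field (node_ord r p) = underS r p"
  unfolding node_ord_def Field_def underS_def using r_refl r_sub by blast

sublocale tree_order T r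
proof
  show "(q, q') \<in> r \<or> (q', q) \<in> r" if qp: "(q, p) \<in> r" "(q', p) \<in> r" for p q q'
  proof (cases "q = p \<or> q' = p \<or> q = q'")
    case True then show ?thesis using qp r_refl r_sub by blast
  next
    case False
    then have "q \<in> Field (node_ord r p)" "q' \<in> Field (node_ord r p)"
      unfolding Field_node_ord underS_def using qp by blast+
    then have "(q, q') \<in> node_ord r p \<or> (q', q) \<in> node_ord r p"
      using wo[of p] r_sub[OF qp(1)] False
      unfolding well_order_on_def linear_order_on_def total_on_def by blast
    then show ?thesis unfolding node_ord_def by blast
  qed
  show "wf (r - Id)"
  proof (rule wfI_min)
    fix x and Q :: "'a set" assume x: "x \<in> Q"
    \<comment> \<open>Well-foundedness is given only below each node, so a minimal element is sought
      among the predecessors of \<open>x\<close>.\<close>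
    show "\<exists>z\<in>Q. \<forall>y. (y, z) \<in> r - Id \<longrightarrow> y \<notin> Q"
    proof (cases "Q \<inter> underS r x = {}")
      case True
      then show ?thesis using x unfolding underS_def by blast
    next
      case False
      then obtain c where c: "c \<in> Q \<inter> underS r x" by blast
      have xT: "x \<in> T" using c r_sub unfolding underS_def by blast
      have "wf (node_ord r x - Id)" using wo[OF xT] unfolding well_order_on_def by blast
      then obtain m where m: "m \<in> Q \<inter> underS r x"
        "\<And>y. (y, m) \<in> node_ord r x - Id \<Longrightarrow> y \<notin> Q \<inter> underS r x"
        using c by (rule wfE_min) (rule that)
      have "y \<notin> Q" if y: "(y, m) \<in> r - Id" for y
      proof -
        have mx: "(m, x) \<in> r" "m \<noteq> x" using m(1) unfolding underS_def by blast+
        have "y \<in> underS r x"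
          using y mx r_trans[of y m x] r_antisym[of m x] unfolding underS_def by blast
        then show ?thesis using m y unfolding node_ord_def by blast
      qed
      then show ?thesis using m(1) by blast
    qed
  qed
qed

text \<open>\<open>node_ord r c\<close> is the initial segment of \<open>node_ord r q\<close> cut
  off at \<open>c\<close>. Consequently comparable nodes of equal order coincide.\<close>

lemma node_ord_less:
  assumes "(c, q) \<in> r" "c \<noteq> q" shows "node_ord r c <o node_ord r q"
proof -
  have c: "c \<in> Field (node_ord r q)" unfolding Field_node_ord underS_def using assms by blast
  have "underS (node_ord r q) c = underS r c" "underS r c \<subseteq> underS r q"
    using assms r_trans[of _ c q] r_antisym[of c q] unfolding node_ord_def underS_def by blast+
  then have "node_ord r c = Restr (node_ord r q) (underS (node_ord r q) c)"
    unfolding node_ord_def by blast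
  moreover have "Restr (node_ord r q) (underS (node_ord r q) c) <o node_ord r q"
    by (rule underS_Restr_ordLess) (use wo r_sub[OF assms(1)] c in blast)+
  ultimately show ?thesis by simp
qed

lemma cover_node_ord: "q \<in> covers r p \<Longrightarrow> node_ord r q =o ord_suc (node_ord r p)"
  by (rule node_ord_cover[OF partial_order wo]) (use covers_sub in blast)+

lemma same_level_eq:
  assumes "(c, q) \<in> r" "node_ord r c =o node_ord r q" shows "c = q"
  using node_ord_less[OF assms(1)] not_ordLess_ordIso assms(2) by blast

text \<open>A node \<open>q\<close> above \<open>p\<close> of order \<open>o(p) + 1\<close> lies
  above some cover of \<open>p\<close>, which has the same order and so equals
  \<open>q\<close>.\<close>

lemma imm_succ_covers:
  assumes p: "p \<in> T" and not_single: "\<not> is_singleton (imm_succ r p)"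
  shows "imm_succ r p = covers r p"
proof
  show "covers r p \<subseteq> imm_succ r p"
    unfolding imm_succ_def above_def using cover_node_ord coversD(1) by blast
  show "imm_succ r p \<subseteq> covers r p"
  proof
    fix q assume q: "q \<in> imm_succ r p"
    then have pq: "(p, q) \<in> r" and oq: "node_ord r q =o ord_suc (node_ord r p)"
      unfolding imm_succ_def above_def by blast+
    have eq: "node_ord r c =o node_ord r q" if "c \<in> covers r p" for c
      using cover_node_ord[OF that] oq ordIso_symmetric ordIso_transitive by blast
    show "q \<in> covers r p"
    proof (cases "p = q")
      case False
      then obtain c where c: "c \<in> covers r p" "(c, q) \<in> r" using cover_below[OF pq] by blast
      then show ?thesis using same_level_eq[OF c(2) eq[OF c(1)]] by blast
    next
      \<comment> \<open>\<open>above r p\<close> contains \<open>p\<close>, which has to be excluded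
        as its own successor. A cover of \<open>p\<close> would have the same order as
        \<open>p\<close>; without covers, \<open>imm_succ r p\<close> would be the singleton
        \<open>{p}\<close>.\<close>
      case True
      have "covers r p = {}"
      proof (rule ccontr)
        assume "covers r p \<noteq> {}"
        then obtain c where c: "c \<in> covers r p" by blast
        have "p = c" using same_level_eq[OF coversD(1)[OF c]] eq[OF c] True ordIso_symmetric by blast
        then show False using coversD(2)[OF c] by blast
      qed
      then have "above r p \<subseteq> {p}" using cover_below unfolding above_def by blast
      then have "imm_succ r p = {p}" using q True unfolding imm_succ_def by blast
      then show ?thesis using not_single unfolding is_singleton_def by blast
    qed
  qed
qed

lemma node_ord_empty_iff: "p \<in> T \<Longrightarrow> node_ord r p =o ({} :: 'a rel) \<longleftrightarrow> underS r p = {}"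
proof
  assume "node_ord r p =o ({} :: 'a rel)"
  then have "\<exists>f. iso (node_ord r p) ({} :: 'a rel) f" unfolding ordIso_def by blast
  then obtain f where "bij_betw f (underS r p) (Field ({} :: 'a rel))"
    unfolding iso_iff2 Field_node_ord by blast
  then show "underS r p = {}" unfolding bij_betw_def by simp
next
  assume "p \<in> T" "underS r p = {}"
  then show "node_ord r p =o ({} :: 'a rel)"
    using ordIso_reflexive[OF wo[of p]] unfolding node_ord_def by simp
qed

text \<open>An isomorphism onto \<open>ord_suc \<beta>\<close> would make the preimage of
  \<open>None\<close> a greatest predecessor.\<close>

lemma limit_ord_node_ord:
  assumes p: "p \<in> T" and ne: "underS r p \<noteq> {}"
    and nomax: "\<And>c. c \<in> underS r p \<Longrightarrow> \<exists>d\<in>underS r p. (c, d) \<in> r \<and> c \<noteq> d"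
  shows "limit_ord (node_ord r p)"
proof -
  have "node_ord r p \<noteq> {}" using ne Field_node_ord[of p] by auto
  moreover have False if iso: "node_ord r p =o ord_suc \<beta>" for \<beta> :: "'a rel"
  proof -
    have "\<exists>f. iso (node_ord r p) (ord_suc \<beta>) f" using iso unfolding ordIso_def by blast
    then obtain f where f: "bij_betw f (underS r p) (Field (ord_suc \<beta>))"
      "\<And>a b. a \<in> underS r p \<Longrightarrow> b \<in> underS r p \<Longrightarrow> (a, b) \<in> node_ord r p \<longleftrightarrow> (f a, f b) \<in> ord_suc \<beta>"
      unfolding iso_iff2 Field_node_ord by blast
    have "(None, None) \<in> ord_suc \<beta>" unfolding ord_suc_def by blast
    then have "None \<in> f ` underS r p" using bij_betw_imp_surj_on[OF f(1)] FieldI1 by metis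
    then obtain c where c: "c \<in> underS r p" "f c = None" by (metis imageE)
    obtain d where d: "d \<in> underS r p" "(c, d) \<in> r" "c \<noteq> d" using nomax[OF c(1)] by blast
    have "(None, f d) \<in> ord_suc \<beta>" using f(2)[OF c(1) d(1)] c d unfolding node_ord_def by auto
    then have "f d = f c" using c(2) unfolding ord_suc_def by auto
    then show False using bij_betw_imp_inj_on[OF f(1)] c d unfolding inj_on_def by blast
  qed
  ultimately show ?thesis unfolding limit_ord_def using wo[OF p] by blast
qed

text \<open>Without predecessors this is uniqueness of the root; otherwise it is the limit clause of
  semi-normality.\<close>

lemma semi_normal_limit_unique:
  assumes sn: "semi_normal T r" and pq: "p \<in> T" "q \<in> T" "underS r p = underS r q"
    and nomax: "\<And>c. c \<in> underS r p \<Longrightarrow> \<exists>d\<in>underS r p. (c, d) \<in> r \<and> c \<noteq> d"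
  shows "p = q"
proof (cases "underS r p = {}")
  case True
  then show ?thesis
    using sn pq node_ord_empty_iff unfolding semi_normal_def by metis
next
  case False
  have "node_ord r p =o node_ord r q"
    using ordIso_reflexive[OF wo[OF pq(1)]] pq(3) unfolding node_ord_def by simp
  moreover have "limit_ord (node_ord r p)" by (rule limit_ord_node_ord[OF pq(1) False nomax])
  ultimately show ?thesis using sn pq unfolding semi_normal_def by blast
qed

lemma root_least:
  assumes sn: "semi_normal T r"
  shows "tree_root T r \<in> T" "p \<in> T \<Longrightarrow> (tree_root T r, p) \<in> r"
proof -
  have ex1: "\<exists>!p. p \<in> T \<and> node_ord r p =o ({} :: 'a rel)" using sn unfolding semi_normal_def by blast
  have root: "tree_root T r \<in> T \<and> node_ord r (tree_root T r) =o ({} :: 'a rel)"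
    unfolding tree_root_def by (rule theI'[OF ex1])
  then show "tree_root T r \<in> T" by blast
  assume p: "p \<in> T"
  let ?A = "{q. (q, p) \<in> r}"
  have "p \<in> ?A" using p r_refl by blast
  from minimal_ex[OF this] obtain m where m: "(m, p) \<in> r" "\<forall>a\<in>?A. (a, m) \<in> r \<longrightarrow> a = m" by blast
  have "underS r m = {}" using m r_trans unfolding underS_def by blast
  then have "node_ord r m =o ({} :: 'a rel)" using node_ord_empty_iff r_sub[OF m(1)] by blast
  then have "m = tree_root T r" using ex1 root r_sub[OF m(1)] by blast
  then show "(tree_root T r, p) \<in> r" using m(1) by simp
qed

text \<open>If the height were less than the order type of \<open>x\<close>, it would be the order
  of some node of \<open>x\<close>, all of which it strictly exceeds. So \<open>x\<close> injects
  into a countable ordinal.\<close>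

lemma Omega_bounded_countable_branch:
  assumes ob: "Omega_bounded r" and x: "x \<in> branches r" shows "countable x"
proof -
  note chain = branch_chain[OF x] and down = branch_down[OF x]
  have xT: "x \<subseteq> T" using branch_sub[OF x] by blast
  let ?a = "height r x" and ?R = "Restr r x"
  have h: "Well_order ?a" "\<And>p. p \<in> x \<Longrightarrow> node_ord r p <o ?a"
    using is_height_height[OF tree xT] unfolding is_height_def by blast+
  have "?a <o Omega" using ob x unfolding Omega_bounded_def by blast
  then have count: "countable (Field ?a)" using ordLess_Omega_iff[OF h(1)] by blast
  have FR: "Field ?R = x" unfolding Field_def using r_refl xT by blast
  have wR: "Well_order ?R"
  proof -
    have "refl_on x ?R" "trans ?R" "antisym ?R" "total_on x ?R"
      using r_refl xT chain r_trans r_antisym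
      unfolding refl_on_def trans_def antisym_def total_on_def by blast+
    moreover have "wf (?R - Id)" by (rule wf_subset[OF wf]) blast
    moreover have "?R \<subseteq> x \<times> x" by blast
    ultimately show ?thesis unfolding FR
      by (simp add: well_order_on_def linear_order_on_def partial_order_on_def preorder_on_def)
  qed
  have "\<not> ?a <o ?R"
  proof
    assume "?a <o ?R"
    then obtain p where p: "p \<in> x" "?a =o Restr ?R (underS ?R p)"
      using ordLess_iff_ordIso_Restr[OF wR h(1)] FR by blast
    have "Restr ?R (underS ?R p) = node_ord r p"
      using down[OF p(1)] p(1) unfolding node_ord_def underS_def by blast
    then have "?a =o node_ord r p" using p(2) by simp
    then show False using h(2)[OF p(1)] not_ordLess_ordIso ordIso_symmetric by blast
  qed
  then have "?R \<le>o ?a" using not_ordLess_iff_ordLeq[OF wR h(1)] by blast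
  then have "|x| \<le>o |Field ?a|" using card_of_mono2 FR by metis
  then show ?thesis using countable_ordLeq count by blast
qed

lemma bi_tree_iso_above:
  assumes p: "p \<in> T" and f: "bi_tree_iso (Restr r (above r p)) s r s f"
  shows bi_tree_iso_bij: "bij_betw f (above r p) T"
    and bi_tree_iso_le: "x \<in> above r p \<Longrightarrow> y \<in> above r p \<Longrightarrow> (x, y) \<in> r \<longleftrightarrow> (f x, f y) \<in> r"
    and bi_tree_iso_covers: "q \<in> above r p \<Longrightarrow> a \<in> above r p \<Longrightarrow> a \<in> covers r q \<longleftrightarrow> f a \<in> covers r (f q)"
    and bi_tree_iso_less: "q \<in> above r p \<Longrightarrow> a \<in> covers r q \<Longrightarrow> b \<in> covers r q \<Longrightarrow>
      strict_of (s q) a b \<longleftrightarrow> strict_of (s (f q)) (f a) (f b)"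
proof -
  let ?A = "above r p" and ?R = "Restr r (above r p)"
  have AT: "?A \<subseteq> T" unfolding above_def using r_sub by blast
  have A_up: "y \<in> ?A" if "x \<in> ?A" "(x, y) \<in> r" for x y using that r_trans unfolding above_def by blast
  have FR: "Field ?R = ?A" unfolding Field_def using AT r_refl by blast
  have Fr: "Field r = T" unfolding Field_def using r_refl r_sub by blast
  have iso: "iso ?R r f"
    and s: "\<And>q a b. q \<in> ?A \<Longrightarrow> a \<in> imm_succ ?R q \<Longrightarrow> b \<in> imm_succ ?R q \<Longrightarrow> (a, b) \<in> s q \<longleftrightarrow> (f a, f b) \<in> s (f q)"
    using f unfolding bi_tree_iso_def FR by blast+
  show bij: "bij_betw f ?A T" using iso unfolding iso_iff2 FR Fr by blast
  show le: "(x, y) \<in> r \<longleftrightarrow> (f x, f y) \<in> r" if "x \<in> ?A" "y \<in> ?A" for x y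
    using iso that unfolding iso_iff2 FR by blast
  have inj: "f x = f y \<longleftrightarrow> x = y" if "x \<in> ?A" "y \<in> ?A" for x y
    using bij_betw_imp_inj_on[OF bij] that unfolding inj_on_def by blast
  have surj: "\<exists>x\<in>?A. f x = y" if "y \<in> T" for y
    using bij_betw_imp_surj_on[OF bij] that by (metis imageE)
  show "a \<in> covers r q \<longleftrightarrow> f a \<in> covers r (f q)" if q: "q \<in> ?A" and a: "a \<in> ?A" for q a
  proof
    assume *: "a \<in> covers r q"
    have "c = f q \<or> c = f a" if c: "(f q, c) \<in> r" "(c, f a) \<in> r" for c
    proof -
      obtain c' where c': "c' \<in> ?A" "f c' = c" using surj r_sub[OF c(1)] by blast
      then show ?thesis using coversD(3)[OF *, of c'] le q a c by blast
    qed
    then show "f a \<in> covers r (f q)"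
      using coversD(1,2)[OF *] le[OF q a] inj[OF q a] unfolding covers_def by blast
  next
    assume *: "f a \<in> covers r (f q)"
    have "c = q \<or> c = a" if c: "(q, c) \<in> r" "(c, a) \<in> r" for c
    proof -
      have cA: "c \<in> ?A" using A_up[OF q c(1)] .
      then show ?thesis using coversD(3)[OF *, of "f c"] le q a c inj by blast
    qed
    then show "a \<in> covers r q"
      using coversD(1,2)[OF *] le[OF q a] inj[OF q a] unfolding covers_def by blast
  qed
  have poR: "partial_order_on ?A ?R"
  proof -
    have "refl_on ?A ?R" "trans ?R" "antisym ?R" "?R \<subseteq> ?A \<times> ?A"
      using r_refl AT r_trans r_antisym unfolding refl_on_def trans_def antisym_def by blast+
    then show ?thesis by (simp add: partial_order_on_def preorder_on_def)
  qed
  \<comment> \<open>\<open>bi_tree_iso\<close> speaks of successors in the restricted tree, where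
    orders are computed afresh; hence \<open>node_ord_cover\<close> is applied to
    \<open>?R\<close>.\<close>
  have imm: "a \<in> imm_succ ?R q" if q: "q \<in> ?A" and a: "a \<in> covers r q" for q a
  proof -
    have aA: "a \<in> ?A" using A_up[OF q coversD(1)[OF a]] .
    have "node_ord ?R a = Restr (node_ord r a) ?A"
      unfolding node_ord_def underS_def using aA by blast
    then have "Well_order (node_ord ?R a)" using Well_order_Restr[OF wo] aA AT by (metis subsetD)
    moreover have "a \<in> covers ?R q" using q a aA unfolding covers_def by blast
    ultimately have "node_ord ?R a =o ord_suc (node_ord ?R q)" using node_ord_cover[OF poR] by blast
    then show ?thesis using q aA coversD(1)[OF a] unfolding imm_succ_def above_def by blast
  qed
  show "strict_of (s q) a b \<longleftrightarrow> strict_of (s (f q)) (f a) (f b)"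
    if q: "q \<in> ?A" and ab: "a \<in> covers r q" "b \<in> covers r q" for q a b
    using s[OF q imm[OF q ab(1)] imm[OF q ab(2)]] inj A_up[OF q coversD(1)] ab
    unfolding strict_of_def by blast
qed

text \<open>\<open>p\<close> is least in \<open>T\<^sub>p\<close>, so its image is least in
  \<open>T\<close>. This is what relates the successors of an arbitrary node to
  \<open>S\<^sub>0\<close>.\<close>

lemma bi_tree_iso_root:
  assumes sn: "semi_normal T r" and p: "p \<in> T" and f: "bi_tree_iso (Restr r (above r p)) s r s f"
  shows "f p = tree_root T r" "bij_betw f (covers r p) (covers r (tree_root T r))"
proof -
  note bij = bi_tree_iso_bij[OF p f] and le = bi_tree_iso_le[OF p f] and cov = bi_tree_iso_covers[OF p f]
  let ?root = "tree_root T r"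
  have pA: "p \<in> above r p" using r_refl[OF p] unfolding above_def by simp
  have surj: "\<exists>x\<in>above r p. f x = y" if "y \<in> T" for y
    using bij_betw_imp_surj_on[OF bij] that by (metis imageE)
  obtain x where x: "x \<in> above r p" "f x = ?root" using surj root_least(1)[OF sn] by blast
  have "(p, x) \<in> r" using x(1) unfolding above_def by blast
  then have "(f p, ?root) \<in> r" using le[OF pA x(1)] x(2) by simp
  moreover have "(?root, f p) \<in> r" using root_least(2)[OF sn] bij pA bij_betwE by blast
  ultimately show fp: "f p = ?root" using r_antisym by blast
  have sub: "covers r p \<subseteq> above r p" unfolding above_def using coversD(1) by blast
  have "f ` covers r p = covers r ?root"
  proof
    show "f ` covers r p \<subseteq> covers r ?root" using cov[OF pA] sub fp by auto
    show "covers r ?root \<subseteq> f ` covers r p"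
    proof
      fix b assume b: "b \<in> covers r ?root"
      obtain a where a: "a \<in> above r p" "f a = b" using surj covers_sub[OF b] by blast
      then have "a \<in> covers r p" using cov[OF pA a(1)] b fp by simp
      then show "b \<in> f ` covers r p" using a(2) by blast
    qed
  qed
  then show "bij_betw f (covers r p) (covers r ?root)"
    using bij_betw_subset[OF bij sub] by blast
qed

end

text \<open>On one branch a node is determined by its order: the cover of \<open>p\<close> on the
  branch also has order \<open>\<epsilon> + 1\<close>, hence is the node selected by
  \<open>branch_nth\<close>.\<close>

lemma branch_less_iff_split_less:
  assumes "tree T r" and "tree_branches T r" and x: "x \<in> branches r" and y: "y \<in> branches r"
  shows "branch_less r s x y \<longleftrightarrow> split_less r (\<lambda>p. strict_of (s p)) x y"
proof -
  interpret wo_tree T r by unfold_locales fact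
  interpret tree_branches T r by fact
  show ?thesis
  proof
    assume "branch_less r s x y"
    then obtain \<epsilon> :: "'a rel" and p a b where
      p: "p \<in> x" "p \<in> y" "node_ord r p =o \<epsilon>" and
      a: "a \<in> x" "node_ord r a =o ord_suc \<epsilon>" and b: "b \<in> y" "node_ord r b =o ord_suc \<epsilon>" and
      ab: "a \<noteq> b" "(a, b) \<in> s p"
      unfolding branch_less_def branch_nth_def by (elim exE conjE)
    have "Well_order (ord_suc \<epsilon>)" using a(2) unfolding ordIso_def by blast
    then have suc: "ord_suc \<epsilon> =o ord_suc (node_ord r p)"
      using ord_suc_cong[OF ordIso_symmetric[OF p(3)]] by blast
    have cov: "c \<in> covers r p" if z: "z \<in> branches r" "p \<in> z" "c \<in> z" "node_ord r c =o ord_suc \<epsilon>" for z c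
    proof -
      obtain d where d: "d \<in> z" "d \<in> covers r p" using branch_next[OF z(1,2)] by blast
      have "node_ord r c =o node_ord r d"
        by (rule ordIso_transitive[OF ordIso_transitive[OF z(4) suc] ordIso_symmetric[OF cover_node_ord[OF d(2)]]])
      then have "c = d"
        using branch_chain[OF z(1,3) d(1)] same_level_eq ordIso_symmetric by blast
      then show ?thesis using d by blast
    qed
    have "a \<in> covers r p" "b \<in> covers r p" using cov x y p a b by blast+
    then show "split_less r (\<lambda>p. strict_of (s p)) x y"
      unfolding split_less_def strict_of_def using p a b ab by blast
  next
    assume "split_less r (\<lambda>p. strict_of (s p)) x y"
    then obtain p a b where p: "p \<in> x" "p \<in> y" and a: "a \<in> x" "a \<in> covers r p"
      and b: "b \<in> y" "b \<in> covers r p" and ab: "a \<noteq> b" "(a, b) \<in> s p"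
      unfolding split_less_def strict_of_def by blast
    have "node_ord r p =o node_ord r p" by (rule ordIso_reflexive[OF wo[OF branch_sub[OF x p(1)]]])
    then show "branch_less r s x y"
      unfolding branch_less_def branch_nth_def
      using p a(1) b(1) cover_node_ord[OF a(2)] cover_node_ord[OF b(2)] ab by blast
  qed
qed

theorem theorem1p2:
  fixes T :: "'a set" and r :: "'a rel" and s :: "'a \<Rightarrow> 'a rel"
  assumes "bi_ordered_tree T r s"
    and "Omega_bounded r"
    and "reproductive T r s"
    and "HLOTS (imm_succ r (tree_root T r)) (s (tree_root T r))"
  shows "HLOTS (branches r) (branch_order r s)"
proof -
  let ?root = "tree_root T r" and ?l = "\<lambda>p. strict_of (s p)"
  have tree: "tree T r" and sn: "semi_normal T r" using assms(1) unfolding bi_ordered_tree_def by blast+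
  interpret wo_tree T r by unfold_locales (rule tree)
  have "imm_succ r ?root = covers r ?root"
    by (rule imm_succ_covers) (use sn root_least(1)[OF sn] in \<open>auto simp: semi_normal_def\<close>)
  then have hom_root: "homogeneous (covers r ?root) (?l ?root)"
    using assms(4) unfolding HLOTS_iff_homogeneous by simp
  have iso: "\<exists>f. bi_tree_iso (Restr r (above r p)) s r s f" if "p \<in> T" for p
    using assms(3) that unfolding reproductive_def by blast
  \<comment> \<open>Reproductivity transports the hypothesis on \<open>S\<^sub>0\<close> to the
    successors of every node.\<close>
  have hom: "homogeneous (covers r p) (?l p)" if p: "p \<in> T" for p
  proof -
    obtain f where f: "bi_tree_iso (Restr r (above r p)) s r s f" using iso[OF p] by blast
    have pA: "p \<in> above r p" using r_refl[OF p] unfolding above_def by simp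
    show ?thesis
      by (rule homogeneous_iso[OF bi_tree_iso_root(2)[OF sn p f] _ hom_root])
        (use bi_tree_iso_less[OF p f pA] bi_tree_iso_root(1)[OF sn p f] in simp)
  qed
  \<comment> \<open>That every node has a successor comes from \<open>hom\<close>, since homogeneous
    orders are nonempty.\<close>
  interpret tree_branches T r
  proof
    show "p = q" if "p \<in> T" "q \<in> T" "underS r p = underS r q"
      "\<And>c. c \<in> underS r p \<Longrightarrow> \<exists>d\<in>underS r p. (c, d) \<in> r \<and> c \<noteq> d" for p q
      by (rule semi_normal_limit_unique[OF sn that])
    show "covers r p \<noteq> {}" if "p \<in> T" for p
      using hom[OF that] unfolding homogeneous_def order_dense_def by blast
  qed
  interpret branch_space T r ?l ?root
  proof
    fix p assume p: "p \<in> T"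
    obtain f where f: "bi_tree_iso (Restr r (above r p)) s r s f" using iso[OF p] by blast
    show "ord_isomorphic (split_less r ?l) (cone_at r p) (split_less r ?l) (branches r)"
    proof (rule cone_isomorphic[OF p bi_tree_iso_bij[OF p f]])
      show "\<not> strict_of (s q) a a" for q a unfolding strict_of_def by simp
    qed (rule bi_tree_iso_le[OF p f] bi_tree_iso_covers[OF p f] bi_tree_iso_less[OF p f]; assumption)+
  qed (use root_least[OF sn] hom Omega_bounded_countable_branch[OF assms(2)] in blast)+
  have less: "branch_less r s x y \<longleftrightarrow> split_less r ?l x y" if "x \<in> X" "y \<in> X" for x y
    by (rule branch_less_iff_split_less[OF tree tree_branches_axioms that])
  have strict: "strict_of (branch_order r s) x y \<longleftrightarrow> split_less r ?l x y" if "x \<in> X" "y \<in> X" for x y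
    using less[OF that] X.irrefl that unfolding strict_of_def branch_order_def by auto
  have "linear_order_on X (branch_order r s)"
  proof -
    have mem: "(x, y) \<in> branch_order r s \<longleftrightarrow> x \<in> X \<and> y \<in> X \<and> (x = y \<or> blt x y)" for x y
      using less unfolding branch_order_def by blast
    have "refl_on X (branch_order r s)" unfolding refl_on_def by (simp add: mem)
    moreover have "branch_order r s \<subseteq> X \<times> X" unfolding branch_order_def by blast
    moreover have "total_on X (branch_order r s)" unfolding total_on_def mem using X.total by blast
    moreover have "antisym (branch_order r s)" unfolding antisym_def mem using X.asym by blast
    moreover have "trans (branch_order r s)"
      unfolding trans_def mem using X.trans by metis
    ultimately show ?thesis
      by (simp add: linear_order_on_def partial_order_on_def preorder_on_def)
  qed
  \<comment> \<open>On branches the strict part of \<open>branch_order\<close> is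
    \<open>split_less\<close>, so the identity transports homogeneity.\<close>
  moreover have "homogeneous X (strict_of (branch_order r s))"
    by (rule homogeneous_iso[where f = id, OF _ _ homogeneous_branches]) (simp_all add: strict)
  ultimately show ?thesis unfolding HLOTS_iff_homogeneous by blast
qed

end
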